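(* There is a solution $w\in C^{1+\gamma/2,2+\gamma}([0,T]\times(0,\infty))$, for some $\gamma\in(0,1)$, to $$w_t(t,y)-\lambda w(t,y)+\lambda y\,w_y(t,y)+\xi y^2 w_{yy}(t,y)+\lambda f(t)\frac{(-w_y(t,y))^{p_2}}{p_2}=0,\qquad w(T,y)=-\frac{y^{q_1}}{q_1}.$$ Moreover, $w$ satisfies the following properties: (i) $w$ is strictly positive; specifically, $$w(t,y)>-\exp\big\{(q_1-1)(\lambda+\xi q_1)(T-t)\big\}\frac{y^{q_1}}{q_1}>0.$$ (ii) $w$ is strictly decreasing in $y$. (iii) There exist $\eta>0$ and $C>0$ (depending on $T>0$) such that $$w(t,y)\le C(1+y^{-\eta})\qquad\forall (t,y)\in[0,T]\times(0,\infty).$$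
   Context: Constants: $T,\lambda,\mu,\sigma>0$; $p_1,p_2\in(0,1)$ with $p_1>p_2$; $\xi:=\frac{\mu^2}{2\sigma^2}>0$; $q_1<0$ is defined by $\frac1{p_1}+\frac1{q_1}=1$. The function $f$ is $f(t):=\exp\big(-\frac{\mu^2}{2\sigma^2}(T-t)\big)=\exp(-\xi(T-t))$, $t\in[0,T]$. The unknown $w$ is a function of $(t,y)\in[0,T]\times(0,\infty)$. $C^{1+\gamma/2,2+\gamma}$ is the usual parabolic Hölder class (one derivative in $t$ and two in $y$, Hölder continuous with exponent $\gamma/2$ in $t$ and $\gamma$ in $y$).
   Formalization: The strict lower bound in (i) is proved for t<T only, since at t=T the terminal condition makes it an equality; the Hölder bounds are taken on compact subsets of [0,T]×(0,∞), since global ones fail for y^{q_1} near y=0. *)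

theory Defs
  imports "HOL-Analysis.Analysis"
begin

text \<open>
  Functions of time and space are curried, \<open>u t y\<close>. The parabolic Hoelder condition
  on a set \<open>K\<close> of points \<open>(t, y)\<close> has exponent \<open>\<gamma>/2\<close> in \<open>t\<close> and \<open>\<gamma>\<close> in \<open>y\<close>.
\<close>

definition parabolic_holder_on :: "real \<Rightarrow> (real \<times> real) set \<Rightarrow> (real \<Rightarrow> real \<Rightarrow> real) \<Rightarrow> bool"
  where "parabolic_holder_on \<gamma> K u \<longleftrightarrow>
    (\<exists>C. \<forall>(t, y)\<in>K. \<forall>(s, z)\<in>K.
       \<bar>u t y - u s z\<bar> \<le> C * (\<bar>t - s\<bar> powr (\<gamma> / 2) + \<bar>y - z\<bar> powr \<gamma>))"

text \<open>
  \<open>C_parabolic \<gamma> I D w w_t w_y w_yy\<close>: \<open>w\<close> belongs to the class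
  \<open>C^{1+\<gamma>/2, 2+\<gamma>}\<close> on \<open>I \<times> D\<close>, with derivatives \<open>w_t\<close>, \<open>w_y\<close>, \<open>w_yy\<close>.
  The Hoelder bounds are uniform on each compact subset of \<open>I \<times> D\<close> only:
  on \<open>{0..T} \<times> {0<..}\<close> they cannot be global for a function that equals
  \<open>- (y powr q) / q\<close> with \<open>q < 0\<close> at time \<open>T\<close>.
  Derivatives in time are taken within \<open>I\<close>, hence one-sided at the end points.
\<close>

definition C_parabolic ::
  "real \<Rightarrow> real set \<Rightarrow> real set \<Rightarrow> (real \<Rightarrow> real \<Rightarrow> real) \<Rightarrow>
   (real \<Rightarrow> real \<Rightarrow> real) \<Rightarrow> (real \<Rightarrow> real \<Rightarrow> real) \<Rightarrow> (real \<Rightarrow> real \<Rightarrow> real) \<Rightarrow> bool"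
  where "C_parabolic \<gamma> I D w w_t w_y w_yy \<longleftrightarrow>
    (\<forall>t\<in>I. \<forall>y\<in>D.
       ((\<lambda>s. w s y) has_real_derivative w_t t y) (at t within I) \<and>
       ((\<lambda>z. w t z) has_real_derivative w_y t y) (at y within D) \<and>
       ((\<lambda>z. w_y t z) has_real_derivative w_yy t y) (at y within D)) \<and>
    (\<forall>K. compact K \<and> K \<subseteq> I \<times> D \<longrightarrow>
       parabolic_holder_on \<gamma> K w \<and> parabolic_holder_on \<gamma> K w_t \<and>
       parabolic_holder_on \<gamma> K w_y \<and> parabolic_holder_on \<gamma> K w_yy)"

end

theory Submission
  imports Defs "HOL-Probability.Distributions"
begin

text \<open>
  With \<open>a = p2 / (1 - p2)\<close>, \<open>Q = - q1\<close>, \<open>b = Q - a > 0\<close>, \<open>s = \<xi> (T - t)\<close> and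
  \<open>x = ln y + \<beta> (T - t)\<close>, the substitution \<open>w = exp (\<kappa> (T - t)) y\<^sup>-\<^sup>a u s x / Q\<close> turns the
  equation into the translation invariant one
  \<open>u\<^sub>s = u\<^sub>x\<^sub>x + c s (a u - u\<^sub>x) powr p2\<close>, \<open>u 0 x = exp (- b x)\<close>.
  Replacing \<open>z powr p2\<close> by \<open>(max z 0 + \<epsilon>) powr p2\<close> makes the nonlinearity Lipschitz, and the
  mild formulation has a fixed point in a sup norm weighted by \<open>cosh (b x)\<close>.

  A comparison principle, applied to translates of the solution, to their multiples by
  \<open>exp (b h)\<close>, and to different \<open>\<epsilon>\<close>, gives \<open>- b u \<le> u\<^sub>x \<le> 0\<close> and monotonicity in \<open>\<epsilon>\<close>. Hence the
  solutions decrease to a limit as \<open>\<epsilon> \<rightarrow> 0\<close>; their space derivatives converge too, because they are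
  uniformly Hoelder continuous, and dominated convergence yields a mild solution of the original
  equation with \<open>a u - u\<^sub>x \<ge> a exp (- b x)\<close>. Away from zero the power is smooth, so the right-hand
  side \<open>h\<close> is Hoelder continuous, the Duhamel integral is twice differentiable in \<open>x\<close>, therefore
  \<open>h\<close> is differentiable in \<open>x\<close>, and \<open>u\<^sub>x\<^sub>x\<close> is a singular integral of order one of \<open>h\<^sub>x\<close>, which is
  again Hoelder continuous up to \<open>s = 0\<close>.
\<close>

section \<open>The heat kernel\<close>

text \<open>The datum \<open>exp (- b x)\<close> is unbounded, and \<open>cosh (k x)\<close> is an
  eigenfunction of the heat semigroup, so bounds in this weight survive convolution up to a factor
  that depends only on the time horizon. For a source with a weighted sup bound the gradient kernel
  costs \<open>r powr (-1/2)\<close>; interpolation against one more derivative turns this into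
  \<open>r powr (-3/4)\<close>, still integrable, and leaves exponent 1/2 in space and 1/4 in time,
  whence \<gamma> = 1/2. These estimates see the source only through its sup bound, which is why
  they are uniform in \<epsilon>. The obstacle is that the power is not Lipschitz at 0, while the
  only lower bound for its argument decays like \<open>exp (- b x)\<close>. The derivative of the
  power therefore costs a factor of size \<open>cosh (b x)\<close> each time it is used, and the
  weights b, 2b and 3b occur in turn. The exponent a is the one for which the nonlinear term scales
  in y like the linear terms, and p1 > p2 says exactly that b > 0.\<close>

lemma has_real_derivative_integral_dominated:
  fixes f f' :: "real \<Rightarrow> 'a \<Rightarrow> real"
  assumes e: "e > 0"
    and int: "\<And>y. \<bar>y - x\<bar> < e \<Longrightarrow> integrable M (f y)"
    and der: "\<And>y \<omega>. \<omega> \<in> space M \<Longrightarrow> \<bar>y - x\<bar> < e \<Longrightarrow>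
      ((\<lambda>y. f y \<omega>) has_real_derivative f' y \<omega>) (at y)"
    and bd: "\<And>y \<omega>. \<omega> \<in> space M \<Longrightarrow> \<bar>y - x\<bar> < e \<Longrightarrow> \<bar>f' y \<omega>\<bar> \<le> g \<omega>"
    and g: "integrable M g"
    and meas: "f' x \<in> borel_measurable M"
  shows "((\<lambda>y. \<integral>\<omega>. f y \<omega> \<partial>M) has_real_derivative (\<integral>\<omega>. f' x \<omega> \<partial>M)) (at x)"
  unfolding DERIV_def tendsto_at_iff_sequentially comp_def
proof (intro allI impI)
  fix X :: "nat \<Rightarrow> real"
  assume X0: "\<forall>i. X i \<in> UNIV - {0}" and X: "X \<longlonglongrightarrow> 0"
  define q where "q i \<omega> = (f (x + X i) \<omega> - f x \<omega>) / X i" for i \<omega>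
  have "\<forall>\<^sub>F i in sequentially. \<bar>X i\<bar> < e"
    using X e by (auto simp: tendsto_iff dist_real_def)
  then obtain N where N: "\<And>i. i \<ge> N \<Longrightarrow> \<bar>X i\<bar> < e"
    by (auto simp: eventually_sequentially)
  \<comment> \<open>The sequence is shifted by N so that every increment stays in the interval where
    the derivative bound holds; the mean value inequality then bounds all difference quotients by
    g.\<close>
  have "(\<lambda>i. \<integral>\<omega>. q (i + N) \<omega> \<partial>M) \<longlonglongrightarrow> (\<integral>\<omega>. f' x \<omega> \<partial>M)"
  proof (rule integral_dominated_convergence[where w = g])
    show "AE \<omega> in M. (\<lambda>i. q (i + N) \<omega>) \<longlonglongrightarrow> f' x \<omega>"
    proof (rule AE_I2)
      fix \<omega> assume "\<omega> \<in> space M"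
      then have "((\<lambda>h. (f (x + h) \<omega> - f x \<omega>) / h) \<longlongrightarrow> f' x \<omega>) (at 0)"
        using der[of \<omega> x] e by (simp add: DERIV_def)
      then have "(\<lambda>i. q i \<omega>) \<longlonglongrightarrow> f' x \<omega>"
        using X X0 unfolding tendsto_at_iff_sequentially comp_def q_def by blast
      then show "(\<lambda>i. q (i + N) \<omega>) \<longlonglongrightarrow> f' x \<omega>"
        by (rule LIMSEQ_ignore_initial_segment)
    qed
    show "AE \<omega> in M. norm (q (i + N) \<omega>) \<le> g \<omega>" for i
    proof (rule AE_I2)
      fix \<omega> assume om: "\<omega> \<in> space M"
      let ?h = "X (i + N)"
      have h: "\<bar>?h\<bar> < e" "?h \<noteq> 0" using N X0 by auto
      have "norm (f (x + ?h) \<omega> - f x \<omega>) \<le> g \<omega> * norm (x + ?h - x)"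
      proof (rule field_differentiable_bound[where S = "{x - \<bar>?h\<bar>..x + \<bar>?h\<bar>}"])
        show "((\<lambda>y. f y \<omega>) has_field_derivative f' y \<omega>) (at y within {x - \<bar>?h\<bar>..x + \<bar>?h\<bar>})"
          if "y \<in> {x - \<bar>?h\<bar>..x + \<bar>?h\<bar>}" for y
        proof -
          have "\<bar>y - x\<bar> < e" using that h by (auto simp: abs_le_iff)
          from has_field_derivative_at_within[OF der[OF om this]] show ?thesis .
        qed
        show "norm (f' y \<omega>) \<le> g \<omega>" if "y \<in> {x - \<bar>?h\<bar>..x + \<bar>?h\<bar>}" for y
        proof -
          have "\<bar>y - x\<bar> < e" using that h by (auto simp: abs_le_iff)
          from bd[OF om this] show ?thesis by simp
        qed
      qed auto
      then show "norm (q (i + N) \<omega>) \<le> g \<omega>"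
        using h by (simp add: q_def divide_le_eq abs_divide)
    qed
    show "q (i + N) \<in> borel_measurable M" for i
    proof -
      have "integrable M (f (x + X (i + N)))" "integrable M (f x)"
        using N[of "i + N"] e by (auto intro!: int)
      then show ?thesis unfolding q_def by measurable
    qed
  qed (use meas g in auto)
  moreover have "(\<integral>\<omega>. q (i + N) \<omega> \<partial>M) =
      ((\<integral>\<omega>. f (x + X (i + N)) \<omega> \<partial>M) - (\<integral>\<omega>. f x \<omega> \<partial>M)) / X (i + N)" for i
    unfolding q_def using N[of "i + N"] e
    by (subst Bochner_Integration.integral_diff[symmetric]) (auto intro!: int)
  ultimately have "(\<lambda>i. ((\<integral>\<omega>. f (x + X (i + N)) \<omega> \<partial>M) - (\<integral>\<omega>. f x \<omega> \<partial>M)) / X (i + N))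
      \<longlonglongrightarrow> (\<integral>\<omega>. f' x \<omega> \<partial>M)" by simp
  then show "(\<lambda>i. ((\<integral>\<omega>. f (x + X i) \<omega> \<partial>M) - (\<integral>\<omega>. f x \<omega> \<partial>M)) / X i)
      \<longlonglongrightarrow> (\<integral>\<omega>. f' x \<omega> \<partial>M)" by (rule LIMSEQ_offset)
qed

text \<open>Rescaled Hermite polynomials: the quotient of the n-th z-derivative of the Gaussian by
  the Gaussian itself. The last branch is the case n = 3 and carries no meaning beyond it.\<close>

definition heat_factor :: "nat \<Rightarrow> real \<Rightarrow> real \<Rightarrow> real" where
  "heat_factor n r z = (if n = 0 then 1 else if n = 1 then - (z / (2 * r))
     else if n = 2 then z\<^sup>2 / (4 * r\<^sup>2) - 1 / (2 * r)
     else - (z ^ 3 / (8 * r ^ 3)) + 3 * z / (4 * r\<^sup>2))"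

text \<open>The \<open>n\<close>-th space derivative of the heat kernel, for \<open>n \<le> 3\<close> only.\<close>
definition heat :: "nat \<Rightarrow> real \<Rightarrow> real \<Rightarrow> real" where
  "heat n r z = heat_factor n r z * (exp (- (z\<^sup>2 / (4 * r))) / sqrt (4 * pi * r))"

lemma heat_measurable[measurable]:
  "(\<lambda>x. heat n (f x) (g x)) \<in> borel_measurable M"
  if [measurable]: "f \<in> borel_measurable M" "g \<in> borel_measurable M"
  unfolding heat_def heat_factor_def by measurable

lemma heat_deriv_space:
  assumes "r > 0" "n \<le> 2"
  shows "((\<lambda>z. heat n r z) has_real_derivative heat (Suc n) r z) (at z)"
proof -
  define E where "E z = exp (- (z\<^sup>2 / (4 * r))) / sqrt (4 * pi * r)" for z
  have e: "(E has_real_derivative - (z / (2 * r)) * E z) (at z)"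
  proof -
    have "((\<lambda>z. exp (- (z\<^sup>2 / (4 * r)))) has_real_derivative - (z / (2 * r)) * exp (- (z\<^sup>2 / (4 * r)))) (at z)"
      using assms(1) by (auto intro!: derivative_eq_intros)
    from DERIV_cdivide[OF this, of "sqrt (4 * pi * r)"] show ?thesis
      unfolding E_def by simp
  qed
  have p1: "((\<lambda>z. - (z / (2 * r))) has_real_derivative - (1 / (2 * r))) (at z)"
    using assms(1) by (auto intro!: derivative_eq_intros)
  have p2: "((\<lambda>z. z\<^sup>2 / (4 * r\<^sup>2) - 1 / (2 * r)) has_real_derivative z / (2 * r\<^sup>2)) (at z)"
    using assms(1) by (auto intro!: derivative_eq_intros simp: field_simps power2_eq_square power4_eq_xxxx)
  have h: "heat 0 r = (\<lambda>z. 1 * E z)" "heat (Suc 0) r = (\<lambda>z. - (z / (2 * r)) * E z)"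
    "heat (Suc (Suc 0)) r = (\<lambda>z. (z\<^sup>2 / (4 * r\<^sup>2) - 1 / (2 * r)) * E z)"
    "heat (Suc (Suc (Suc 0))) r = (\<lambda>z. (- (z ^ 3 / (8 * r ^ 3)) + 3 * z / (4 * r\<^sup>2)) * E z)"
    by (auto simp: heat_def heat_factor_def E_def fun_eq_iff)
  have "n = 0 \<or> n = Suc 0 \<or> n = Suc (Suc 0)" using assms by auto
  then show ?thesis
  proof (elim disjE)
    assume "n = 0"
    then show ?thesis using e h by simp
  next
    assume n: "n = Suc 0"
    show ?thesis unfolding n h
      by (rule DERIV_cong[OF DERIV_mult[OF p1 e]]) (use assms(1) in \<open>simp add: algebra_simps power2_eq_square\<close>)
  next
    assume n: "n = Suc (Suc 0)"
    show ?thesis unfolding n h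
      by (rule DERIV_cong[OF DERIV_mult[OF p2 e]])
        (use assms(1) in \<open>simp add: field_simps power2_eq_square power3_eq_cube\<close>)
  qed
qed

text \<open>The heat equation for the kernel and for its first space derivative: one time derivative
  costs two space derivatives. The bound on n keeps n + 2 within the range where \<open>heat\<close>
  is a derivative of the kernel.\<close>

lemma heat_deriv_time:
  assumes "r > 0" "n \<le> 1"
  shows "((\<lambda>r. heat n r z) has_real_derivative heat (n + 2) r z) (at r)"
proof -
  define E where "E r = exp (- (z\<^sup>2 / (4 * r))) / sqrt (4 * pi * r)" for r
  have e1: "((\<lambda>r. exp (- (z\<^sup>2 / (4 * r)))) has_real_derivative
      exp (- (z\<^sup>2 / (4 * r))) * (z\<^sup>2 / (4 * r\<^sup>2))) (at r)"
    using assms(1) by (auto intro!: derivative_eq_intros simp: power2_eq_square)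
  have e2: "((\<lambda>r. sqrt (4 * pi * r)) has_real_derivative sqrt (4 * pi * r) / (2 * r)) (at r)"
  proof -
    have "sqrt (4 * pi * r) * sqrt (4 * pi * r) = 4 * pi * r" using assms(1) by simp
    then have q: "4 * pi / sqrt (4 * pi * r) = sqrt (4 * pi * r) / r"
      using assms(1) by (simp add: divide_simps)
    have "((\<lambda>r. 4 * pi * r) has_real_derivative 4 * pi) (at r)"
      by (auto intro!: derivative_eq_intros)
    from DERIV_chain2[OF DERIV_real_sqrt this] assms(1)
    show ?thesis by (rule_tac DERIV_cong) (auto simp: q[symmetric] divide_simps)
  qed
  have q: "(x * w * s - x * (s / (2 * r))) / (s * s) = (w - 1 / (2 * r)) * (x / s)"
    if "s > 0" for x w s :: real
    using that assms(1) by (simp add: field_simps)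
  have e: "(E has_real_derivative (z\<^sup>2 / (4 * r\<^sup>2) - 1 / (2 * r)) * E r) (at r)"
    unfolding E_def
    using DERIV_divide[OF e1 e2] assms(1) by (subst q[symmetric]) auto
  have p1: "((\<lambda>r. - (z / (2 * r))) has_real_derivative z / (2 * r\<^sup>2)) (at r)"
    using assms(1) by (auto intro!: derivative_eq_intros simp: power2_eq_square)
  have h: "(\<lambda>r. heat 0 r z) = (\<lambda>r. 1 * E r)" "(\<lambda>r. heat (Suc 0) r z) = (\<lambda>r. - (z / (2 * r)) * E r)"
    "heat (Suc (Suc 0)) r z = (z\<^sup>2 / (4 * r\<^sup>2) - 1 / (2 * r)) * E r"
    "heat (Suc (Suc (Suc 0))) r z = (- (z ^ 3 / (8 * r ^ 3)) + 3 * z / (4 * r\<^sup>2)) * E r"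
    by (auto simp: heat_def heat_factor_def E_def fun_eq_iff)
  have "n = 0 \<or> n = Suc 0" using assms by auto
  then show ?thesis
  proof (elim disjE)
    assume "n = 0"
    then show ?thesis using e h by (simp add: numeral_2_eq_2)
  next
    assume n: "n = Suc 0"
    have n2: "Suc 0 + 2 = Suc (Suc (Suc 0))" by simp
    show ?thesis unfolding n n2 h
      by (rule DERIV_cong[OF DERIV_mult[OF p1 e]])
        (use assms(1) in \<open>simp add: field_simps power2_eq_square power3_eq_cube\<close>)
  qed
qed

text \<open>Lets half of the Gaussian exponent absorb a polynomial in the similarity variable. The
  Taylor polynomial gives 1 + \<theta>^4 / 128 \<le> exp (\<theta>^2 / 8), hence the constant 128 +
  1.\<close>

lemma power_le_exp_eighth:
  fixes \<theta> :: real
  assumes "\<theta> \<ge> 0" "j \<le> 4"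
  shows "\<theta> ^ j \<le> 129 * exp (\<theta>\<^sup>2 / 8)"
proof -
  have "1 + \<theta>\<^sup>2 / 8 + (\<theta>\<^sup>2 / 8)\<^sup>2 / 2 \<le> exp (\<theta>\<^sup>2 / 8)"
    by (rule exp_lower_Taylor_quadratic) simp
  moreover have "(\<theta>\<^sup>2 / 8)\<^sup>2 / 2 = \<theta> ^ 4 / 128" by (simp add: power2_eq_square power4_eq_xxxx)
  ultimately have "1 + \<theta>\<^sup>2 / 8 + \<theta> ^ 4 / 128 \<le> exp (\<theta>\<^sup>2 / 8)" by simp
  moreover have "0 \<le> \<theta>\<^sup>2" by simp
  moreover have "u + t / 8 + v / 128 \<le> e \<Longrightarrow> 0 \<le> t \<Longrightarrow> u = 1 \<Longrightarrow> 1 + v \<le> 129 * e \<or> v < 0" for u t v e :: real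
    by linarith
  ultimately have e: "1 + \<theta> ^ 4 \<le> 129 * exp (\<theta>\<^sup>2 / 8)"
    using zero_le_even_power[of 4 \<theta>] by force
  have "\<theta> ^ j \<le> 1 + \<theta> ^ 4"
  proof (cases "\<theta> \<le> 1")
    case True
    then have "\<theta> ^ j \<le> 1" using assms by (simp add: power_le_one)
    then show ?thesis using assms by (simp add: add_increasing2)
  next
    case False
    then have "\<theta> ^ j \<le> \<theta> ^ 4" using assms(2) by (intro power_increasing) auto
    then show ?thesis by simp
  qed
  with e show ?thesis by simp
qed


text \<open>Parabolic scaling with z of size \<theta> sqrt r: every derivative costs r^(-1/2), and
  an additional factor sqrt |z| gains r^(1/4). The disjunction restricts the second estimate to n
  \<le> 2 while both parts share one hypothesis.\<close>

lemma heat_factor_bound: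
  fixes r z :: real
  assumes r: "r > 0" and n: "n \<le> 3"
  defines "\<theta> \<equiv> \<bar>z\<bar> / sqrt r"
  shows "\<bar>heat_factor n r z\<bar> \<le> r powr (- real n / 2) * (1 + \<theta> ^ n)"
    and "n = 3 \<or> \<bar>heat_factor n r z\<bar> * sqrt \<bar>z\<bar> \<le> r powr (1 / 4 - real n / 2) * (2 + 2 * \<theta> ^ (n + 1))"
proof -
  define s where "s = sqrt r"
  have s: "s > 0" "r = s\<^sup>2" using r by (auto simp: s_def)
  have th: "\<theta> \<ge> 0" using r by (simp add: \<theta>_def)
  have z: "\<bar>z\<bar> = \<theta> * s" unfolding \<theta>_def s_def[symmetric] using s(1) by simp
  have p: "r powr (- real n / 2) = 1 / s ^ n"
  proof -
    have "r powr (real n / 2) = (s powr 2) powr (real n / 2)" using s powr_realpow[of s 2] by simp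
    also have "\<dots> = s ^ n" using s(1) by (simp only: powr_powr) (simp add: powr_realpow)
    finally have "r powr (- (real n / 2)) = inverse (s ^ n)" by (simp only: powr_minus)
    then show ?thesis by (simp only: minus_divide_left inverse_eq_divide)
  qed
  have le3: "\<theta> \<le> 1 + \<theta> ^ 3"
  proof (cases "\<theta> \<le> 1")
    case True
    moreover have "0 \<le> \<theta> ^ 3" using th by simp
    ultimately show ?thesis by linarith
  next
    case False
    then have "\<theta> ^ 1 \<le> \<theta> ^ 3" by (intro power_increasing) auto
    then show ?thesis by simp
  qed
  have n': "n = 0 \<or> n = 1 \<or> n = 2 \<or> n = 3" using n by auto
  show *: "\<bar>heat_factor n r z\<bar> \<le> r powr (- real n / 2) * (1 + \<theta> ^ n)"
    using n'
  proof (elim disjE)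
    assume n: "n = 0" show ?thesis unfolding n p[unfolded n] by (simp add: heat_factor_def)
  next
    assume n: "n = 1"
    have "\<bar>heat_factor n r z\<bar> = (\<theta> / 2) / s"
      using s th by (simp add: n heat_factor_def z abs_divide power2_eq_square)
    also have "\<dots> \<le> (1 + \<theta> ^ n) / s" using th s by (intro divide_right_mono) (auto simp: n)
    finally show ?thesis using p n by simp
  next
    assume n: "n = 2"
    have "\<bar>heat_factor n r z\<bar> \<le> \<bar>z\<bar>\<^sup>2 / (4 * r\<^sup>2) + 1 / (2 * r)"
      using r unfolding heat_factor_def n by (auto intro: order_trans[OF abs_triangle_ineq4])
    also have "\<dots> = (\<theta>\<^sup>2 / 4 + 1 / 2) / s\<^sup>2"
      using s unfolding z by (simp add: field_simps power2_eq_square)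
    also have "\<dots> \<le> (1 + \<theta> ^ n) / s\<^sup>2"
    proof (rule divide_right_mono)
      have "0 \<le> \<theta>\<^sup>2" by simp
      then show "\<theta>\<^sup>2 / 4 + 1 / 2 \<le> 1 + \<theta> ^ n" unfolding n by linarith
    qed simp
    finally show ?thesis using p n by simp
  next
    assume n: "n = 3"
    have "\<bar>heat_factor n r z\<bar> \<le> \<bar>z\<bar> ^ 3 / (8 * r ^ 3) + 3 * \<bar>z\<bar> / (4 * r\<^sup>2)"
    proof -
      have "\<bar>heat_factor n r z\<bar> = \<bar>3 * z / (4 * r\<^sup>2) - z ^ 3 / (8 * r ^ 3)\<bar>"
        unfolding heat_factor_def n by simp
      also have "\<dots> \<le> \<bar>3 * z / (4 * r\<^sup>2)\<bar> + \<bar>z ^ 3 / (8 * r ^ 3)\<bar>" by (rule abs_triangle_ineq4)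
      also have "\<dots> = \<bar>z\<bar> ^ 3 / (8 * r ^ 3) + 3 * \<bar>z\<bar> / (4 * r\<^sup>2)"
        using r by (simp add: abs_mult power_abs)
      finally show ?thesis .
    qed
    also have "\<dots> = (\<theta> ^ 3 / 8 + 3 * \<theta> / 4) / s ^ 3"
      using s unfolding z by (simp add: field_simps power2_eq_square power3_eq_cube)
    also have "\<dots> \<le> (1 + \<theta> ^ n) / s ^ 3"
    proof (rule divide_right_mono)
      have "0 \<le> \<theta> ^ 3" using th by simp
      then show "\<theta> ^ 3 / 8 + 3 * \<theta> / 4 \<le> 1 + \<theta> ^ n" using le3 unfolding n by linarith
    qed (use s in simp)
    finally show ?thesis using p n by simp
  qed
  have sq: "sqrt \<bar>z\<bar> \<le> r powr (1 / 4) * (1 + \<theta>)"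
  proof -
    have "sqrt \<theta> \<le> 1 + \<theta>" using th by (intro real_le_lsqrt) (simp_all add: power2_eq_square algebra_simps)
    moreover have "sqrt s = r powr (1/4)"
      using r unfolding s_def by (simp add: powr_powr flip: powr_half_sqrt)
    moreover have "sqrt \<bar>z\<bar> = sqrt s * sqrt \<theta>" unfolding z by (simp add: real_sqrt_mult)
    ultimately show ?thesis by (simp add: mult_left_mono)
  qed
  have "(1 + \<theta> ^ n) * (1 + \<theta>) \<le> 2 + 2 * \<theta> ^ (n + 1)"
  proof -
    have "0 \<le> (1 - \<theta>) * (1 - \<theta> ^ n)"
    proof (cases "\<theta> \<le> 1")
      case True then show ?thesis using th by (intro mult_nonneg_nonneg) (auto simp: power_le_one)
    next
      case False then show ?thesis by (intro mult_nonpos_nonpos) (auto intro: one_le_power)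
    qed
    then show ?thesis by (simp add: algebra_simps)
  qed
  then have "r powr (1/4 - real n / 2) * ((1 + \<theta> ^ n) * (1 + \<theta>)) \<le> r powr (1/4 - real n / 2) * (2 + 2 * \<theta> ^ (n + 1))"
    by (intro mult_left_mono) auto
  moreover have "\<bar>heat_factor n r z\<bar> * sqrt \<bar>z\<bar> \<le>
      (r powr (- real n / 2) * (1 + \<theta> ^ n)) * (r powr (1 / 4) * (1 + \<theta>))"
    using th by (intro mult_mono * sq mult_nonneg_nonneg) auto
  moreover have "(r powr (- real n / 2) * (1 + \<theta> ^ n)) * (r powr (1 / 4) * (1 + \<theta>)) =
      r powr (1/4 - real n / 2) * ((1 + \<theta> ^ n) * (1 + \<theta>))"
    using powr_add[of r "1/4" "- real n / 2"] by (simp add: algebra_simps)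
  ultimately show "n = 3 \<or> \<bar>heat_factor n r z\<bar> * sqrt \<bar>z\<bar> \<le> r powr (1 / 4 - real n / 2) * (2 + 2 * \<theta> ^ (n + 1))"
    by linarith
qed

lemma heat_0: "heat 0 r z = exp (- (z\<^sup>2 / (4 * r))) / sqrt (4 * pi * r)"
  by (simp add: heat_def heat_factor_def)

lemma heat_0_pos: "r > 0 \<Longrightarrow> heat 0 r z > 0"
  by (simp add: heat_0)

text \<open>The polynomial in \<theta> is paid for by doubling the time: exp (\<theta>^2 / 8) times
  the Gaussian at time r is the Gaussian at time 2r up to a factor sqrt 2, rounded to 2. The
  constant is 2 * 258 * 2, as the second estimate requires.\<close>

lemma heat_bound:
  assumes r: "r > 0" and n: "n \<le> 3"
  shows "\<bar>heat n r z\<bar> \<le> 1032 * r powr (- real n / 2) * heat 0 (2 * r) z"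
    and "n = 3 \<or> \<bar>heat n r z\<bar> * sqrt \<bar>z\<bar> \<le> 1032 * r powr (1 / 4 - real n / 2) * heat 0 (2 * r) z"
proof -
  define \<theta> where "\<theta> = \<bar>z\<bar> / sqrt r"
  have th: "\<theta> \<ge> 0" "\<theta>\<^sup>2 = z\<^sup>2 / r" using r by (auto simp: \<theta>_def power_divide)
  have h: "\<bar>heat n r z\<bar> = \<bar>heat_factor n r z\<bar> * heat 0 r z" for n
  proof -
    have "heat n r z = heat_factor n r z * heat 0 r z" by (simp add: heat_def heat_factor_def[of 0])
    then show ?thesis using heat_0_pos[OF r, of z] by (simp add: abs_mult)
  qed
  have e: "exp (\<theta>\<^sup>2 / 8) * heat 0 r z \<le> 2 * heat 0 (2 * r) z"
  proof -
    have "sqrt (8 * pi * r) \<le> sqrt (16 * pi * r)" using r by (intro real_sqrt_le_mono) auto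
    also have "sqrt (16 * pi * r) = 2 * sqrt (4 * pi * r)"
      using r by (simp add: real_sqrt_mult)
    finally have "1 / sqrt (4 * pi * r) \<le> 2 / sqrt (8 * pi * r)"
      using r by (simp add: field_simps)
    moreover have "exp (\<theta>\<^sup>2 / 8) * exp (- (z\<^sup>2 / (4 * r))) = exp (- (z\<^sup>2 / (4 * (2 * r))))"
      using r by (simp add: th(2) flip: exp_add)
    ultimately have "exp (- (z\<^sup>2 / (4 * (2 * r)))) * (1 / sqrt (4 * pi * r)) \<le>
        exp (- (z\<^sup>2 / (4 * (2 * r)))) * (2 / sqrt (8 * pi * r))"
      by (intro mult_left_mono) auto
    then show ?thesis
      unfolding heat_0 \<open>exp (\<theta>\<^sup>2 / 8) * exp (- (z\<^sup>2 / (4 * r))) = _\<close>[symmetric]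
      by (simp add: ac_simps)
  qed
  have pe: "1 + \<theta> ^ j \<le> 258 * exp (\<theta>\<^sup>2 / 8)" if "j \<le> 4" for j
    using power_le_exp_eighth[OF th(1) that] power_le_exp_eighth[OF th(1), of 0] by simp
  have "\<bar>heat n r z\<bar> \<le> (r powr (- real n / 2) * (258 * exp (\<theta>\<^sup>2 / 8))) * heat 0 r z"
    unfolding h using heat_0_pos[OF r, of z] n
    by (intro mult_right_mono order_trans[OF heat_factor_bound(1)[OF r n]])
      (auto intro!: mult_left_mono pe simp: \<theta>_def[symmetric])
  also have "\<dots> = (258 * r powr (- real n / 2)) * (exp (\<theta>\<^sup>2 / 8) * heat 0 r z)" by simp
  also have "\<dots> \<le> (258 * r powr (- real n / 2)) * (2 * heat 0 (2 * r) z)"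
    by (intro mult_left_mono e) auto
  also have "\<dots> \<le> 1032 * r powr (- real n / 2) * heat 0 (2 * r) z"
    using heat_0_pos[of "2 * r" z] r by simp
  finally show "\<bar>heat n r z\<bar> \<le> 1032 * r powr (- real n / 2) * heat 0 (2 * r) z" .
  show "n = 3 \<or> \<bar>heat n r z\<bar> * sqrt \<bar>z\<bar> \<le> 1032 * r powr (1 / 4 - real n / 2) * heat 0 (2 * r) z"
  proof (cases "n = 3")
    case False
    have "\<bar>heat n r z\<bar> * sqrt \<bar>z\<bar> = (\<bar>heat_factor n r z\<bar> * sqrt \<bar>z\<bar>) * heat 0 r z"
      by (simp add: h)
    also have "\<dots> \<le> (r powr (1/4 - real n / 2) * (2 * (258 * exp (\<theta>\<^sup>2 / 8)))) * heat 0 r z"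
    proof (intro mult_right_mono)
      have "\<bar>heat_factor n r z\<bar> * sqrt \<bar>z\<bar> \<le> r powr (1/4 - real n / 2) * (2 + 2 * \<theta> ^ (n + 1))"
        using heat_factor_bound(2)[OF r n, of z] False by (simp add: \<theta>_def[symmetric])
      also have "\<dots> \<le> r powr (1/4 - real n / 2) * (2 * (258 * exp (\<theta>\<^sup>2 / 8)))"
        using pe[of "n + 1"] False n by (intro mult_left_mono) auto
      finally show "\<bar>heat_factor n r z\<bar> * sqrt \<bar>z\<bar> \<le> r powr (1/4 - real n / 2) * (2 * (258 * exp (\<theta>\<^sup>2 / 8)))" .
    qed (use heat_0_pos[OF r, of z] in auto)
    also have "\<dots> = (516 * r powr (1/4 - real n / 2)) * (exp (\<theta>\<^sup>2 / 8) * heat 0 r z)" by simp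
    also have "\<dots> \<le> (516 * r powr (1/4 - real n / 2)) * (2 * heat 0 (2 * r) z)"
      by (intro mult_left_mono e) auto
    also have "\<dots> = 1032 * r powr (1/4 - real n / 2) * heat 0 (2 * r) z" by simp
    finally show ?thesis by simp
  qed simp
qed

text \<open>Moment generating function of the normal law of variance 2r: completing the square tilts
  the Gaussian to mean x + 2 r k, and the tilted density has mass one.\<close>

lemma heat_0_exp:
  assumes r: "r > 0"
  shows "has_bochner_integral lborel (\<lambda>\<xi>. heat 0 r (x - \<xi>) * exp (k * \<xi>)) (exp (k * x + k\<^sup>2 * r))"
proof -
  have "heat 0 r (x - \<xi>) * exp (k * \<xi>) =
      exp (k * x + k\<^sup>2 * r) * normal_density (x + 2 * r * k) (sqrt (2 * r)) \<xi>" for \<xi>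
  proof -
    have "exp (- ((x - \<xi>)\<^sup>2 / (4 * r))) * exp (k * \<xi>) =
        exp (k * x + k\<^sup>2 * r) * exp (- ((\<xi> - (x + 2 * r * k))\<^sup>2 / (4 * r)))"
      using r unfolding exp_add[symmetric]
      by (intro arg_cong[of _ _ exp]) (simp add: field_simps power2_eq_square)
    then show ?thesis using r by (simp add: heat_0 normal_density_def)
  qed
  moreover have "has_bochner_integral lborel (\<lambda>\<xi>. exp (k * x + k\<^sup>2 * r) *
      normal_density (x + 2 * r * k) (sqrt (2 * r)) \<xi>) (exp (k * x + k\<^sup>2 * r) * 1)"
    using r by (intro has_bochner_integral_mult_right) (auto simp: has_bochner_integral_iff)
  ultimately show ?thesis by simp
qed

text \<open>\<open>cosh (k x)\<close> is an eigenfunction of the heat semigroup with eigenvalue exp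
  (k^2 r). Therefore a bound in this weight is preserved by convolution, while the weight still
  dominates exponentials on both half lines.\<close>

lemma heat_0_cosh:
  assumes r: "r > 0"
  shows "has_bochner_integral lborel (\<lambda>\<xi>. heat 0 r (x - \<xi>) * cosh (k * \<xi>)) (exp (k\<^sup>2 * r) * cosh (k * x))"
proof -
  have "has_bochner_integral lborel (\<lambda>\<xi>. (heat 0 r (x - \<xi>) * exp (k * \<xi>) + heat 0 r (x - \<xi>) * exp ((- k) * \<xi>)) / 2)
     ((exp (k * x + k\<^sup>2 * r) + exp ((- k) * x + (- k)\<^sup>2 * r)) / 2)"
    by (intro has_bochner_integral_divide has_bochner_integral_add heat_0_exp r)
  then show ?thesis by (simp add: cosh_def exp_add exp_diff exp_minus field_simps)
qed

section \<open>Convolution with the heat kernel\<close>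

lemma borel_measurable_cosh[measurable]:
  fixes f :: "'a \<Rightarrow> real"
  assumes "f \<in> borel_measurable M"
  shows "(\<lambda>x. cosh (f x)) \<in> borel_measurable M"
  by (rule borel_measurable_continuous_on[OF _ assms]) (intro continuous_intros)

text \<open>The weight changes by a bounded factor under a bounded shift, so dominating functions at
  x also serve the points near x, and translates of solutions stay in the same growth class.\<close>

lemma cosh_shift_le: "cosh (k * (x + h)) \<le> exp \<bar>k * h\<bar> * cosh (k * x)" for k x h :: real
proof -
  have "cosh (k * (x + h)) = cosh (k * x) * cosh (k * h) + sinh (k * x) * sinh (k * h)"
    by (simp add: cosh_add distrib_left)
  also have "sinh (k * x) * sinh (k * h) \<le> \<bar>sinh (k * x)\<bar> * \<bar>sinh (k * h)\<bar>"
    unfolding abs_mult[symmetric] by simp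
  also have "\<bar>sinh (k * x)\<bar> * \<bar>sinh (k * h)\<bar> \<le> cosh (k * x) * sinh \<bar>k * h\<bar>"
  proof (rule mult_mono)
    show "\<bar>sinh (k * x)\<bar> \<le> cosh (k * x)" by (simp add: sinh_def cosh_def abs_le_iff field_simps)
    show "\<bar>sinh (k * h)\<bar> \<le> sinh \<bar>k * h\<bar>" by (auto simp: abs_if)
  qed auto
  also have "cosh (k * x) * cosh (k * h) + cosh (k * x) * sinh \<bar>k * h\<bar> = exp \<bar>k * h\<bar> * cosh (k * x)"
  proof -
    have "cosh (k * h) = cosh \<bar>k * h\<bar>" by (auto simp: abs_if)
    then have "cosh (k * h) + sinh \<bar>k * h\<bar> = exp \<bar>k * h\<bar>"
      by (simp add: cosh_def sinh_def field_simps)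
    then show ?thesis by (metis distrib_left mult.commute)
  qed
  finally show ?thesis by simp
qed

text \<open>Supplies one integrable majorant for all times within a factor two and all shifts up to
  one, as differentiation under the integral requires. The Gaussian at time 8r is wide enough to
  cover both perturbations.\<close>

lemma heat_locally_dominated:
  assumes r: "r > 0" and n: "n \<le> 3"
  obtains K where "K \<ge> 0"
    "\<And>r' y z. r / 2 < r' \<Longrightarrow> r' < 2 * r \<Longrightarrow> \<bar>y\<bar> \<le> 1 \<Longrightarrow> \<bar>heat n r' (z + y)\<bar> \<le> K * heat 0 (8 * r) z"
proof -
  define K where "K = 1032 * (r / 2) powr (- real n / 2) * (exp (1 / (16 * r)) * sqrt (4 * pi * (8 * r)) / sqrt (4 * pi * r))"
  have "\<bar>heat n r' (z + y)\<bar> \<le> K * heat 0 (8 * r) z"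
    if r': "r / 2 < r'" "r' < 2 * r" and y: "\<bar>y\<bar> \<le> 1" for r' y z
  proof -
    have r'0: "r' > 0" using r r' by simp
    have yy: "y\<^sup>2 \<le> 1" using y by (simp add: abs_square_le_1)
    \<comment> \<open>This square is exactly 2 (z + y)^2 + 2 y^2 - z^2, so z^2 is controlled by the
      shifted square.\<close>
    have "0 \<le> (z + 2 * y)\<^sup>2" by simp
    then have "z\<^sup>2 \<le> 2 * (z + y)\<^sup>2 + 2" using yy by (simp add: power2_eq_square algebra_simps)
    then have "z\<^sup>2 / (32 * r) \<le> (2 * (z + y)\<^sup>2 + 2) / (32 * r)"
      using r by (intro divide_right_mono) auto
    also have "\<dots> = (z + y)\<^sup>2 / (16 * r) + 1 / (16 * r)" using r by (simp add: field_simps)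
    also have "(z + y)\<^sup>2 / (16 * r) \<le> (z + y)\<^sup>2 / (4 * (2 * r'))"
      using r r' r'0 by (intro divide_left_mono) auto
    finally have "exp (- ((z + y)\<^sup>2 / (4 * (2 * r')))) \<le> exp (1 / (16 * r) + - (z\<^sup>2 / (4 * (8 * r))))"
      by simp
    also have "\<dots> = exp (1 / (16 * r)) * exp (- (z\<^sup>2 / (4 * (8 * r))))" by (rule exp_add)
    finally have e: "exp (- ((z + y)\<^sup>2 / (4 * (2 * r')))) \<le> exp (1 / (16 * r)) * exp (- (z\<^sup>2 / (4 * (8 * r))))" .
    have "heat 0 (2 * r') (z + y) \<le> exp (1 / (16 * r)) * exp (- (z\<^sup>2 / (4 * (8 * r)))) / sqrt (4 * pi * r)"
      unfolding heat_0 using r r'0 r' by (intro frac_le e real_sqrt_le_mono) auto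
    also have "\<dots> = exp (1 / (16 * r)) * sqrt (4 * pi * (8 * r)) / sqrt (4 * pi * r) * heat 0 (8 * r) z"
      unfolding heat_0 using r by simp
    finally have h: "heat 0 (2 * r') (z + y) \<le> exp (1 / (16 * r)) * sqrt (4 * pi * (8 * r)) / sqrt (4 * pi * r) * heat 0 (8 * r) z" .
    have "r' powr (- real n / 2) \<le> (r / 2) powr (- real n / 2)"
      using r r' by (intro powr_mono2') auto
    then have "1032 * r' powr (- real n / 2) * heat 0 (2 * r') (z + y) \<le>
        1032 * (r / 2) powr (- real n / 2) * (exp (1 / (16 * r)) * sqrt (4 * pi * (8 * r)) / sqrt (4 * pi * r) * heat 0 (8 * r) z)"
      using r'0 heat_0_pos[of "2 * r'" "z + y"] by (intro mult_mono h) auto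
    with heat_bound(1)[OF r'0 n, of "z + y"] show ?thesis unfolding K_def by (simp add: mult.assoc)
  qed
  moreover have "K \<ge> 0" using r by (simp add: K_def)
  ultimately show ?thesis using that by blast
qed

definition heat_conv :: "nat \<Rightarrow> real \<Rightarrow> (real \<Rightarrow> real) \<Rightarrow> real \<Rightarrow> real" where
  "heat_conv n r g x = (\<integral>\<xi>. heat n r (x - \<xi>) * g \<xi> \<partial>lborel)"

lemma integrable_heat_0_cosh:
  "r > 0 \<Longrightarrow> integrable lborel (\<lambda>\<xi>. heat 0 r (x - \<xi>) * cosh (k * \<xi>))"
  using heat_0_cosh[of r x k] by (simp add: has_bochner_integral_iff)

lemma heat_0_nonneg: "r > 0 \<Longrightarrow> 0 \<le> heat 0 r z"
  using heat_0_pos by (rule less_imp_le)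

context
  fixes g :: "real \<Rightarrow> real" and C k :: real
  assumes g[measurable]: "g \<in> borel_measurable borel"
    and gC: "\<And>\<xi>. \<bar>g \<xi>\<bar> \<le> C * cosh (k * \<xi>)"
begin

lemma weight_const_nonneg: "C \<ge> 0"
proof -
  have "0 \<le> C * cosh (k * 0)" using gC[of 0] by linarith
  then show ?thesis by simp
qed

lemma heat_conv_integrable:
  assumes r: "r > 0" and n: "n \<le> 3"
  shows "integrable lborel (\<lambda>\<xi>. heat n r (x - \<xi>) * g \<xi>)"
proof (rule Bochner_Integration.integrable_bound)
  show "integrable lborel (\<lambda>\<xi>. (1032 * r powr (- real n / 2) * C) * (heat 0 (2 * r) (x - \<xi>) * cosh (k * \<xi>)))"
    using r by (intro integrable_mult_right integrable_heat_0_cosh) auto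
  have "\<bar>heat n r (x - \<xi>)\<bar> * \<bar>g \<xi>\<bar> \<le> (1032 * r powr (- real n / 2) * heat 0 (2 * r) (x - \<xi>)) * (C * cosh (k * \<xi>))" for \<xi>
    using r weight_const_nonneg by (intro mult_mono heat_bound(1) n gC) (auto intro!: heat_0_nonneg mult_nonneg_nonneg)
  then show "AE \<xi> in lborel. norm (heat n r (x - \<xi>) * g \<xi>) \<le>
      norm ((1032 * r powr (- real n / 2) * C) * (heat 0 (2 * r) (x - \<xi>) * cosh (k * \<xi>)))"
    using r weight_const_nonneg heat_0_nonneg[of "2 * r"]
    by (auto simp: abs_mult ac_simps)
qed measurable

lemma heat_conv_bound:
  assumes r: "r > 0" and n: "n \<le> 3"
  shows "\<bar>heat_conv n r g x\<bar> \<le> 1032 * C * r powr (- real n / 2) * (exp (2 * k\<^sup>2 * r) * cosh (k * x))"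
proof -
  have b: "\<bar>heat n r (x - \<xi>) * g \<xi>\<bar> \<le> (1032 * r powr (- real n / 2) * C) * (heat 0 (2 * r) (x - \<xi>) * cosh (k * \<xi>))" for \<xi>
  proof -
    have "\<bar>heat n r (x - \<xi>)\<bar> * \<bar>g \<xi>\<bar> \<le> (1032 * r powr (- real n / 2) * heat 0 (2 * r) (x - \<xi>)) * (C * cosh (k * \<xi>))"
      using r weight_const_nonneg by (intro mult_mono heat_bound(1) n gC) (auto intro!: heat_0_nonneg mult_nonneg_nonneg)
    then show ?thesis by (simp add: abs_mult ac_simps)
  qed
  have "\<bar>heat_conv n r g x\<bar> \<le> (\<integral>\<xi>. (1032 * r powr (- real n / 2) * C) * (heat 0 (2 * r) (x - \<xi>) * cosh (k * \<xi>)) \<partial>lborel)"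
    unfolding heat_conv_def
    by (rule integral_abs_bound_integral[OF heat_conv_integrable[OF r n]])
      (use r b in \<open>auto intro!: integrable_mult_right integrable_heat_0_cosh\<close>)
  also have "\<dots> = (1032 * r powr (- real n / 2) * C) * (exp (k\<^sup>2 * (2 * r)) * cosh (k * x))"
    using r has_bochner_integral_integral_eq[OF heat_0_cosh[of "2 * r" x k]] by simp
  finally show ?thesis by (simp add: ac_simps)
qed

lemma heat_conv_deriv_space:
  assumes r: "r > 0" and n: "n \<le> 2"
  shows "(heat_conv n r g has_real_derivative heat_conv (Suc n) r g x) (at x)"
proof -
  obtain K where K: "K \<ge> 0"
    "\<And>r' y z. r / 2 < r' \<Longrightarrow> r' < 2 * r \<Longrightarrow> \<bar>y\<bar> \<le> 1 \<Longrightarrow> \<bar>heat (Suc n) r' (z + y)\<bar> \<le> K * heat 0 (8 * r) z"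
    using heat_locally_dominated[OF r, of "Suc n"] n by auto
  have "((\<lambda>y. \<integral>\<xi>. heat n r (y - \<xi>) * g \<xi> \<partial>lborel) has_real_derivative
      (\<integral>\<xi>. heat (Suc n) r (x - \<xi>) * g \<xi> \<partial>lborel)) (at x)"
  proof (rule has_real_derivative_integral_dominated[where e = 1 and g = "\<lambda>\<xi>. (K * C) * (heat 0 (8 * r) (x - \<xi>) * cosh (k * \<xi>))"])
    show "integrable lborel (\<lambda>\<xi>. heat n r (y - \<xi>) * g \<xi>)" for y
      using n by (intro heat_conv_integrable r) auto
    show "((\<lambda>y. heat n r (y - \<omega>) * g \<omega>) has_real_derivative heat (Suc n) r (y - \<omega>) * g \<omega>) (at y)" for y \<omega>
    proof -
      have "((\<lambda>y. y - \<omega>) has_real_derivative 1) (at y)" by (auto intro!: derivative_eq_intros)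
      from DERIV_chain2[OF heat_deriv_space[OF r n] this]
      show ?thesis by (intro DERIV_cmult_right) simp
    qed
    show "\<bar>heat (Suc n) r (y - \<omega>) * g \<omega>\<bar> \<le> (K * C) * (heat 0 (8 * r) (x - \<omega>) * cosh (k * \<omega>))"
      if "\<bar>y - x\<bar> < 1" for y \<omega>
    proof -
      have "\<bar>heat (Suc n) r (y - \<omega>)\<bar> * \<bar>g \<omega>\<bar> \<le> (K * heat 0 (8 * r) (x - \<omega>)) * (C * cosh (k * \<omega>))"
        using r that K(2)[of r "y - x" "x - \<omega>"] K(1)
        by (intro mult_mono gC) (auto intro!: mult_nonneg_nonneg heat_0_nonneg)
      then show ?thesis by (simp add: abs_mult ac_simps)
    qed
    show "integrable lborel (\<lambda>\<xi>. (K * C) * (heat 0 (8 * r) (x - \<xi>) * cosh (k * \<xi>)))"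
      using r by (intro integrable_mult_right integrable_heat_0_cosh) auto
  qed auto
  then show ?thesis unfolding heat_conv_def .
qed

lemma heat_conv_deriv_time:
  assumes r: "r > 0" and n: "n \<le> 1"
  shows "((\<lambda>r. heat_conv n r g x) has_real_derivative heat_conv (n + 2) r g x) (at r)"
proof -
  obtain K where K: "K \<ge> 0"
    "\<And>r' y z. r / 2 < r' \<Longrightarrow> r' < 2 * r \<Longrightarrow> \<bar>y\<bar> \<le> 1 \<Longrightarrow> \<bar>heat (n + 2) r' (z + y)\<bar> \<le> K * heat 0 (8 * r) z"
    using heat_locally_dominated[OF r, of "n + 2"] n by auto
  have "((\<lambda>r. \<integral>\<xi>. heat n r (x - \<xi>) * g \<xi> \<partial>lborel) has_real_derivative
      (\<integral>\<xi>. heat (n + 2) r (x - \<xi>) * g \<xi> \<partial>lborel)) (at r)"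
  proof (rule has_real_derivative_integral_dominated[where e = "r / 2" and g = "\<lambda>\<xi>. (K * C) * (heat 0 (8 * r) (x - \<xi>) * cosh (k * \<xi>))"])
    show "r / 2 > 0" using r by simp
    show "integrable lborel (\<lambda>\<xi>. heat n r' (x - \<xi>) * g \<xi>)" if "\<bar>r' - r\<bar> < r / 2" for r'
    proof -
      have "r' > 0" using that r by (simp add: abs_if split: if_splits)
      then show ?thesis using n by (intro heat_conv_integrable) auto
    qed
    show "((\<lambda>r'. heat n r' (x - \<omega>) * g \<omega>) has_real_derivative heat (n + 2) r' (x - \<omega>) * g \<omega>) (at r')"
      if "\<bar>r' - r\<bar> < r / 2" for r' \<omega>
    proof -
      have "r' > 0" using that r by (simp add: abs_if split: if_splits)
      then show ?thesis by (intro DERIV_cmult_right heat_deriv_time n)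
    qed
    show "\<bar>heat (n + 2) r' (x - \<omega>) * g \<omega>\<bar> \<le> (K * C) * (heat 0 (8 * r) (x - \<omega>) * cosh (k * \<omega>))"
      if "\<bar>r' - r\<bar> < r / 2" for r' \<omega>
    proof -
      have "r / 2 < r'" "r' < 2 * r" using that r by (auto simp: abs_if split: if_splits)
      then have "\<bar>heat (n + 2) r' (x - \<omega>)\<bar> * \<bar>g \<omega>\<bar> \<le> (K * heat 0 (8 * r) (x - \<omega>)) * (C * cosh (k * \<omega>))"
        using r K(2)[of r' "0" "x - \<omega>"] K(1)
        by (intro mult_mono gC) (auto intro!: mult_nonneg_nonneg heat_0_nonneg)
      then show ?thesis by (simp add: abs_mult ac_simps)
    qed
    show "integrable lborel (\<lambda>\<xi>. (K * C) * (heat 0 (8 * r) (x - \<xi>) * cosh (k * \<xi>)))"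
      using r by (intro integrable_mult_right integrable_heat_0_cosh) auto
  qed auto
  then show ?thesis unfolding heat_conv_def .
qed

end

text \<open>The kernel has mass one. The second moment identity is obtained by differentiating the
  constant function twice rather than by integrating the Hermite factor; it is the cancellation
  behind the bounds for second derivatives.\<close>

lemma heat_conv_const:
  assumes r: "r > 0"
  shows "heat_conv 0 r (\<lambda>_. c) x = c" "heat_conv 2 r (\<lambda>_. c) x = 0"
proof -
  have *: "heat_conv 0 r (\<lambda>_. c) x = c" for x
    using has_bochner_integral_integral_eq[OF heat_0_cosh[OF r, of x 0]]
    unfolding heat_conv_def by simp
  show "heat_conv 0 r (\<lambda>_. c) x = c" by (rule *)
  have bd: "\<bar>c\<bar> \<le> \<bar>c\<bar> * cosh (0 * \<xi>)" for \<xi> :: real by simp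
  have "(heat_conv 0 r (\<lambda>_. c) has_real_derivative heat_conv 1 r (\<lambda>_. c) x) (at x)" for x
    using heat_conv_deriv_space[OF _ bd r, of 0] by simp
  moreover have eq: "heat_conv 0 r (\<lambda>_. c) = (\<lambda>x. c)" using * by auto
  ultimately have "heat_conv 1 r (\<lambda>_. c) = (\<lambda>x. 0)"
    using DERIV_unique DERIV_const by (metis (no_types) ext)
  moreover have "(heat_conv 1 r (\<lambda>_. c) has_real_derivative heat_conv 2 r (\<lambda>_. c) x) (at x)"
    using heat_conv_deriv_space[OF _ bd r, of 1] by (simp add: numeral_2_eq_2)
  ultimately show "heat_conv 2 r (\<lambda>_. c) x = 0"
    using DERIV_unique DERIV_const by metis
qed

lemma heat_conv_translate:
  "heat_conv n r g x = (\<integral>z. heat n r z * g (x - z) \<partial>lborel)"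
  unfolding heat_conv_def
  using lborel_integral_real_affine[of "-1" "\<lambda>\<xi>. heat n r (x - \<xi>) * g \<xi>" x] by simp

text \<open>Subtracting the constant g x inside the integral makes sqrt |\<xi> - x| available, which
  gains r^(1/4). For n = 2, where constants convolve to 0, the singularity improves from r^(-1) to
  the integrable r^(-3/4). The factor 2064 = 2 * 1032 accounts for the weight at \<xi> and at
  x.\<close>

lemma heat_conv_holder:
  assumes g[measurable]: "g \<in> borel_measurable borel"
    and gC: "\<And>\<xi>. \<bar>g \<xi>\<bar> \<le> C * cosh (k * \<xi>)"
    and gH: "\<And>\<xi>. \<bar>g \<xi> - g x\<bar> \<le> H * sqrt \<bar>\<xi> - x\<bar> * (cosh (k * \<xi>) + cosh (k * x))"
    and H: "H \<ge> 0" and r: "r > 0" and n: "n \<le> 2"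
  shows "\<bar>heat_conv n r g x - heat_conv n r (\<lambda>_. g x) x\<bar> \<le>
    2064 * H * r powr (1 / 4 - real n / 2) * (exp (2 * k\<^sup>2 * r) * cosh (k * x))"
proof -
  define G where "G = (\<lambda>\<xi>. heat 0 (2 * r) (x - \<xi>) * cosh (k * \<xi>) + cosh (k * x) * (heat 0 (2 * r) (x - \<xi>) * cosh (0 * \<xi>)))"
  have bd: "\<bar>g x\<bar> \<le> \<bar>g x\<bar> * cosh (0 * \<xi>)" for \<xi> :: real by simp
  have i1: "integrable lborel (\<lambda>\<xi>. heat n r (x - \<xi>) * g \<xi>)"
    using n by (intro heat_conv_integrable[OF g gC r]) auto
  have i2: "integrable lborel (\<lambda>\<xi>. heat n r (x - \<xi>) * g x)"
    using n by (intro heat_conv_integrable[OF _ bd r]) auto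
  have iG: "has_bochner_integral lborel G (exp (k\<^sup>2 * (2 * r)) * cosh (k * x) + cosh (k * x) * (exp (0\<^sup>2 * (2 * r)) * cosh (0 * x)))"
    unfolding G_def using r by (intro has_bochner_integral_add has_bochner_integral_mult_right heat_0_cosh) auto
  have "heat_conv n r g x - heat_conv n r (\<lambda>_. g x) x = (\<integral>\<xi>. heat n r (x - \<xi>) * g \<xi> - heat n r (x - \<xi>) * g x \<partial>lborel)"
    unfolding heat_conv_def by (rule Bochner_Integration.integral_diff[symmetric, OF i1 i2])
  also have "\<bar>\<dots>\<bar> \<le> (\<integral>\<xi>. (1032 * H * r powr (1 / 4 - real n / 2)) * G \<xi> \<partial>lborel)"
  proof (rule integral_abs_bound_integral)
    show "integrable lborel (\<lambda>\<xi>. (1032 * H * r powr (1 / 4 - real n / 2)) * G \<xi>)"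
      using iG by (intro integrable_mult_right) (auto simp: has_bochner_integral_iff)
    show "\<bar>heat n r (x - \<xi>) * g \<xi> - heat n r (x - \<xi>) * g x\<bar> \<le> (1032 * H * r powr (1 / 4 - real n / 2)) * G \<xi>" for \<xi>
    proof -
      have "\<bar>heat n r (x - \<xi>) * g \<xi> - heat n r (x - \<xi>) * g x\<bar> = \<bar>heat n r (x - \<xi>)\<bar> * \<bar>g \<xi> - g x\<bar>"
        by (simp add: right_diff_distrib[symmetric] abs_mult)
      also have "\<dots> \<le> \<bar>heat n r (x - \<xi>)\<bar> * (H * sqrt \<bar>\<xi> - x\<bar> * (cosh (k * \<xi>) + cosh (k * x)))"
        by (intro mult_left_mono gH) auto
      also have "\<dots> = (\<bar>heat n r (x - \<xi>)\<bar> * sqrt \<bar>x - \<xi>\<bar>) * (H * (cosh (k * \<xi>) + cosh (k * x)))"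
        by (simp add: abs_minus_commute)
      also have "\<dots> \<le> (1032 * r powr (1 / 4 - real n / 2) * heat 0 (2 * r) (x - \<xi>)) * (H * (cosh (k * \<xi>) + cosh (k * x)))"
        using heat_bound(2)[OF r, of n "x - \<xi>"] n H by (intro mult_right_mono) auto
      finally show ?thesis by (simp add: G_def algebra_simps)
    qed
  qed (use i1 i2 in auto)
  also have "\<dots> = (1032 * H * r powr (1 / 4 - real n / 2)) * (exp (2 * k\<^sup>2 * r) * cosh (k * x) + cosh (k * x))"
    using has_bochner_integral_integral_eq[OF iG] by (simp add: ac_simps)
  also have "\<dots> \<le> (1032 * H * r powr (1 / 4 - real n / 2)) * (2 * (exp (2 * k\<^sup>2 * r) * cosh (k * x)))"
    using H r by (intro mult_left_mono) auto
  finally show ?thesis by simp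
qed

text \<open>No boundary terms are handled: the convolution of g is differentiated once with the
  derivative on the kernel and once, after the substitution in \<open>heat_conv_translate\<close>,
  with the derivative on g. Uniqueness of the derivative identifies the two.\<close>

lemma heat_conv_by_parts:
  assumes g': "g' \<in> borel_measurable borel" "\<And>\<xi>. \<bar>g' \<xi>\<bar> \<le> C' * cosh (k' * \<xi>)"
    and gd: "\<And>\<xi>. (g has_real_derivative g' \<xi>) (at \<xi>)"
    and gC: "\<And>\<xi>. \<bar>g \<xi>\<bar> \<le> C * cosh (k * \<xi>)"
    and r: "r > 0" and n: "n \<le> 2"
  shows "heat_conv (Suc n) r g x = heat_conv n r g' x"
proof -
  have [measurable]: "g \<in> borel_measurable borel"
    using gd by (intro borel_measurable_continuous_onI) (auto intro!: continuous_at_imp_continuous_on DERIV_isCont)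
  note [measurable] = g'(1)
  have tr: "integrable lborel (\<lambda>z. heat n r z * f (y - z))"
    if "f \<in> borel_measurable borel" "\<And>\<xi>. \<bar>f \<xi>\<bar> \<le> C * cosh (k * \<xi>)" for f C k y
  proof -
    have "integrable lborel (\<lambda>\<xi>. heat n r (y - \<xi>) * f \<xi>)"
      using n by (intro heat_conv_integrable[OF that r]) auto
    from lborel_integrable_real_affine[OF this, of "-1" y] show ?thesis by simp
  qed
  have "((\<lambda>y. \<integral>z. heat n r z * g (y - z) \<partial>lborel) has_real_derivative
      (\<integral>z. heat n r z * g' (x - z) \<partial>lborel)) (at x)"
  proof (rule has_real_derivative_integral_dominated[where e = 1 and g = "\<lambda>z. \<bar>heat n r z * (C' * exp \<bar>k'\<bar> * cosh (k' * (x - z)))\<bar>"])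
    show "integrable lborel (\<lambda>z. heat n r z * g (y - z))" for y
      using gC by (intro tr) auto
    show "integrable lborel (\<lambda>z. \<bar>heat n r z * (C' * exp \<bar>k'\<bar> * cosh (k' * (x - z)))\<bar>)"
      using tr[of "\<lambda>z. C' * exp \<bar>k'\<bar> * cosh (k' * z)" "\<bar>C'\<bar> * exp \<bar>k'\<bar>" k'] by (intro integrable_abs) (auto simp: abs_mult)
    show "((\<lambda>y. heat n r z * g (y - z)) has_real_derivative heat n r z * g' (y - z)) (at y)" for y z
    proof -
      have "((\<lambda>y. y - z) has_real_derivative 1) (at y)" by (auto intro!: derivative_eq_intros)
      from DERIV_chain2[OF gd this] show ?thesis by (intro DERIV_cmult) simp
    qed
    show "\<bar>heat n r z * g' (y - z)\<bar> \<le> \<bar>heat n r z * (C' * exp \<bar>k'\<bar> * cosh (k' * (x - z)))\<bar>" if "\<bar>y - x\<bar> < 1" for y z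
    proof -
      have C': "C' \<ge> 0" by (rule weight_const_nonneg[OF g'])
      have "cosh (k' * (y - z)) \<le> exp \<bar>k' * (y - x)\<bar> * cosh (k' * (x - z))"
        using cosh_shift_le[of k' "x - z" "y - x"] by simp
      also have "\<dots> \<le> exp \<bar>k'\<bar> * cosh (k' * (x - z))"
        using that by (intro mult_right_mono) (auto simp: abs_mult intro: mult_left_le)
      finally have "C' * cosh (k' * (y - z)) \<le> C' * (exp \<bar>k'\<bar> * cosh (k' * (x - z)))"
        using C' by (intro mult_left_mono)
      then have "\<bar>g' (y - z)\<bar> \<le> C' * exp \<bar>k'\<bar> * cosh (k' * (x - z))"
        using g'(2)[of "y - z"] by simp
      then show ?thesis using C' by (simp add: abs_mult mult_left_mono)
    qed
  qed auto
  then have "(heat_conv n r g has_real_derivative heat_conv n r g' x) (at x)"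
    unfolding heat_conv_translate[abs_def] .
  from DERIV_unique[OF heat_conv_deriv_space[OF _ gC r n] this] show ?thesis by simp
qed

section \<open>Duhamel integrals\<close>

lemma has_bochner_integral_powr_singular:
  fixes a s \<alpha> :: real
  assumes "a \<le> s" "\<alpha> < 1"
  shows "has_bochner_integral lborel (\<lambda>r. indicator {a<..<s} r * (s - r) powr (- \<alpha>))
    ((s - a) powr (1 - \<alpha>) / (1 - \<alpha>))"
proof -
  have "((\<lambda>x. x powr (- \<alpha>)) has_integral ((s - a) powr (- \<alpha> + 1) / (- \<alpha> + 1))) {0..s - a}"
    using assms by (intro has_integral_powr_from_0) auto
  then have "((\<lambda>x. x powr (- \<alpha>)) has_integral ((s - a) powr (1 - \<alpha>) / (1 - \<alpha>))) {0<..<s - a}"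
    by (simp add: has_integral_Icc_iff_Ioo)
  then have "((\<lambda>x. if x \<in> {0<..<s - a} then x powr (- \<alpha>) else 0) has_integral ((s - a) powr (1 - \<alpha>) / (1 - \<alpha>))) UNIV"
    by (simp only: has_integral_restrict_UNIV)
  also have "(\<lambda>x. if x \<in> {0<..<s - a} then x powr (- \<alpha>) else 0) = (\<lambda>x. indicator {0<..<s - a} x * x powr (- \<alpha>))"
    by (auto simp: indicator_def)
  finally have "(\<integral>\<^sup>+x. ennreal (indicator {0<..<s - a} x * x powr (- \<alpha>)) \<partial>lborel) = ennreal ((s - a) powr (1 - \<alpha>) / (1 - \<alpha>))"
    by (intro nn_integral_has_integral_lborel) auto
  then have "has_bochner_integral lborel (\<lambda>x. indicator {0<..<s - a} x * x powr (- \<alpha>)) ((s - a) powr (1 - \<alpha>) / (1 - \<alpha>))"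
    using assms by (intro has_bochner_integral_nn_integral) auto
  \<comment> \<open>The reflection x to s - x moves the singularity from the left end to the right
    end.\<close>
  then have "has_bochner_integral lborel (\<lambda>x. indicator {0<..<s - a} (s + (-1) * x) * (s + (-1) * x) powr (- \<alpha>))
      (((s - a) powr (1 - \<alpha>) / (1 - \<alpha>)) /\<^sub>R \<bar>-1\<bar>)"
    by (subst (asm) lborel_has_bochner_integral_real_affine_iff[of "-1" _ _ s]) auto
  moreover have "indicator {0<..<s - a} (s + (-1) * x) = (indicator {a<..<s} x :: real)" for x
    by (auto simp: indicator_def)
  ultimately show ?thesis by simp
qed

text \<open>3/4 is the common singularity to which the later kernel estimates are reduced: 1/2 for a
  gradient plus 1/4 spent on Hoelder continuity, or 1 for a second derivative minus the 1/4 gained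
  by cancellation.\<close>

lemma has_bochner_integral_powr_three_quarters:
  fixes s :: real
  assumes "0 \<le> s"
  shows "has_bochner_integral lborel (\<lambda>r. indicator {0<..<s} r * (s - r) powr (- (3/4))) (4 * s powr (1/4))"
proof -
  have "(s - 0) powr (1 - 3/4) / (1 - 3/4) = 4 * s powr (1/4)" by simp
  with has_bochner_integral_powr_singular[OF assms, of "3/4"] show ?thesis
    by (simp add: mult.commute)
qed

text \<open>The space derivative is placed under the time integral. For n \<le> 1 this converges for
  every source of cosh growth; for n = 2 convergence depends on Hoelder continuity of the source,
  and only then is it a derivative of the case n = 1.\<close>

definition duhamel :: "nat \<Rightarrow> (real \<Rightarrow> real \<Rightarrow> real) \<Rightarrow> real \<Rightarrow> real \<Rightarrow> real" where
  "duhamel n h s x = (\<integral>r. indicator {0<..<s} r * heat_conv n (s - r) (h r) x \<partial>lborel)"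

text \<open>Controls the weight at an intermediate point of the mean value theorem by its values at
  the two ends.\<close>

lemma cosh_between:
  fixes k x y z :: real
  assumes "x \<le> y" "y \<le> z"
  shows "cosh (k * y) \<le> cosh (k * x) + cosh (k * z)"
proof -
  have m: "cosh u \<le> cosh v" if "\<bar>u\<bar> \<le> \<bar>v\<bar>" for u v :: real
  proof -
    have "cosh \<bar>u\<bar> \<le> cosh \<bar>v\<bar>" using that by (subst cosh_real_nonneg_le_iff) auto
    then show ?thesis by (auto simp: abs_if split: if_splits)
  qed
  have "\<bar>y\<bar> \<le> \<bar>x\<bar> \<or> \<bar>y\<bar> \<le> \<bar>z\<bar>" using assms by linarith
  then have "\<bar>k * y\<bar> \<le> \<bar>k * x\<bar> \<or> \<bar>k * y\<bar> \<le> \<bar>k * z\<bar>" by (auto simp: abs_mult mult_left_mono)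
  then have "cosh (k * y) \<le> cosh (k * x) \<or> cosh (k * y) \<le> cosh (k * z)" using m by blast
  moreover have "cosh (k * x) > 0" "cosh (k * z) > 0" by auto
  ultimately show ?thesis by linarith
qed

text \<open>Geometric mean of the two bounds: the powers of \<rho> average to -3/4 and d enters with
  exponent 1/2. The split at d = sqrt \<rho> is where both hypotheses coincide.\<close>

lemma powr_interpolation:
  fixes \<rho> d :: real
  assumes "\<rho> > 0" "d \<ge> 0" "u \<le> M * \<rho> powr (- (1/2))" "u \<le> M * \<rho> powr (- 1) * d" "M \<ge> 0"
  shows "u \<le> M * \<rho> powr (- (3/4)) * sqrt d"
proof (cases "d \<le> \<rho> powr (1/2)")
  case True
  have "sqrt d \<le> sqrt (\<rho> powr (1/2))" using True by simp
  also have "\<dots> = \<rho> powr (1/4)" by (simp add: powr_powr flip: powr_half_sqrt)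
  finally have "sqrt d * sqrt d \<le> \<rho> powr (1/4) * sqrt d" using assms by (intro mult_right_mono) auto
  then have "M * \<rho> powr (- 1) * d \<le> M * \<rho> powr (- 1) * (\<rho> powr (1/4) * sqrt d)"
    using assms by (intro mult_left_mono) auto
  also have "\<dots> = M * (\<rho> powr (- 1) * \<rho> powr (1/4)) * sqrt d" by simp
  also have "\<rho> powr (- 1) * \<rho> powr (1/4) = \<rho> powr (- (3/4))" by (subst powr_add[symmetric]) simp
  finally show ?thesis using assms by simp
next
  case False
  then have "sqrt (\<rho> powr (1/2)) \<le> sqrt d" by simp
  then have "\<rho> powr (1/4) \<le> sqrt d" by (simp add: powr_powr flip: powr_half_sqrt)
  then have "\<rho> powr (- (3/4)) * \<rho> powr (1/4) \<le> \<rho> powr (- (3/4)) * sqrt d" by (intro mult_left_mono) auto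
  then have "\<rho> powr (- (1/2)) \<le> \<rho> powr (- (3/4)) * sqrt d" by (simp flip: powr_add)
  then have "M * \<rho> powr (- (1/2)) \<le> M * (\<rho> powr (- (3/4)) * sqrt d)" using assms by (intro mult_left_mono) auto
  then show ?thesis using assms by simp
qed

text \<open>Time version: weights 3/4 and 1/4 on the two bounds give -3/8 - 3/8 = -3/4 for \<rho>
  and 1/4 for d. The bounds coincide at d = \<rho>.\<close>

lemma powr_interpolation':
  fixes \<rho> d :: real
  assumes "\<rho> > 0" "d \<ge> 0" "u \<le> M * \<rho> powr (- (1/2))" "u \<le> M * \<rho> powr (- (3/2)) * d" "M \<ge> 0"
  shows "u \<le> M * \<rho> powr (- (3/4)) * d powr (1/4)"
proof (cases "d \<le> \<rho>")
  case True
  have "d = d powr (3/4) * d powr (1/4)" using assms by (simp flip: powr_add)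
  also have "\<dots> \<le> \<rho> powr (3/4) * d powr (1/4)" using True assms by (intro mult_right_mono powr_mono2) auto
  finally have "M * \<rho> powr (- (3/2)) * d \<le> M * \<rho> powr (- (3/2)) * (\<rho> powr (3/4) * d powr (1/4))"
    using assms by (intro mult_left_mono) auto
  also have "\<dots> = M * (\<rho> powr (- (3/2)) * \<rho> powr (3/4)) * d powr (1/4)" by simp
  also have "\<rho> powr (- (3/2)) * \<rho> powr (3/4) = \<rho> powr (- (3/4))" by (simp flip: powr_add)
  finally show ?thesis using assms by simp
next
  case False
  then have "\<rho> powr (1/4) \<le> d powr (1/4)" using assms by (intro powr_mono2) auto
  then have "\<rho> powr (- (3/4)) * \<rho> powr (1/4) \<le> \<rho> powr (- (3/4)) * d powr (1/4)" by (intro mult_left_mono) auto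
  then have "\<rho> powr (- (1/2)) \<le> \<rho> powr (- (3/4)) * d powr (1/4)" by (simp flip: powr_add)
  then have "M * \<rho> powr (- (1/2)) \<le> M * (\<rho> powr (- (3/4)) * d powr (1/4))" using assms by (intro mult_left_mono) auto
  then show ?thesis using assms by simp
qed

text \<open>On a bounded interval a weaker singularity is dominated by a stronger one. Restricting
  the gap of exponents to at most one keeps the constant at 1 + S.\<close>

lemma powr_lower_exponent:
  fixes \<rho> S a b :: real
  assumes "0 < \<rho>" "\<rho> \<le> S" "a \<le> b" "b \<le> a + 1"
  shows "\<rho> powr b \<le> (1 + S) * \<rho> powr a"
proof -
  have "\<rho> powr (b - a) \<le> (1 + S) powr (b - a)" using assms by (intro powr_mono2) auto
  also have "\<dots> \<le> (1 + S) powr 1" using assms by (intro powr_mono) auto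
  finally have "\<rho> powr a * \<rho> powr (b - a) \<le> \<rho> powr a * (1 + S)" using assms by (intro mult_left_mono) auto
  then show ?thesis by (simp add: mult.commute flip: powr_add)
qed

section \<open>Potentials of measurable sources with cosh growth\<close>

locale heat_source =
  fixes S k C :: real and h :: "real \<Rightarrow> real \<Rightarrow> real"
  assumes S_pos: "S > 0"
    and h_meas: "(\<lambda>(r, \<xi>). h r \<xi>) \<in> borel_measurable (borel \<Otimes>\<^sub>M borel)"
    and h_bound: "\<And>r \<xi>. 0 \<le> r \<Longrightarrow> r \<le> S \<Longrightarrow> \<bar>h r \<xi>\<bar> \<le> C * cosh (k * \<xi>)"
begin

lemma h_measurable[measurable (raw)]:
  assumes [measurable]: "f \<in> borel_measurable M" "g \<in> borel_measurable M"
  shows "(\<lambda>x. h (f x) (g x)) \<in> borel_measurable M"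
proof -
  have "(\<lambda>x. (f x, g x)) \<in> measurable M (borel \<Otimes>\<^sub>M borel)" by measurable
  from measurable_compose[OF this h_meas] show ?thesis by simp
qed

lemma heat_conv_measurable[measurable (raw)]:
  assumes [measurable]: "a \<in> borel_measurable M" "b \<in> borel_measurable M" "c \<in> borel_measurable M"
  shows "(\<lambda>w. heat_conv n (a w) (h (b w)) (c w)) \<in> borel_measurable M"
  unfolding heat_conv_def by measurable

lemma duhamel_measurable[measurable (raw)]:
  assumes [measurable]: "a \<in> borel_measurable M" "c \<in> borel_measurable M"
  shows "(\<lambda>w. duhamel n h (a w) (c w)) \<in> borel_measurable M"
proof -
  \<comment> \<open>The interval depends on the parameter s, so the indicator is replaced by a case
    distinction whose joint measurability is automatic.\<close>
  have eq: "duhamel n h s x = (\<integral>r. (if 0 < r \<and> r < s then 1 else 0) * heat_conv n (s - r) (h r) x \<partial>lborel)" for s x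
    unfolding duhamel_def by (intro Bochner_Integration.integral_cong) (auto simp: indicator_def)
  show ?thesis unfolding eq by measurable
qed

lemma C_nonneg: "C \<ge> 0"
proof -
  have "0 \<le> C * cosh (k * 0)" using h_bound[of 0 0] S_pos by linarith
  then show ?thesis by simp
qed

text \<open>The constant of \<open>heat_conv_bound\<close> with the eigenvalue frozen at the horizon
  S; the factor 1 + S pays for treating n = 0 with the exponent of n = 1. It depends on the source
  only through C.\<close>

definition D where "D = 1032 * C * exp (2 * k\<^sup>2 * S) * (1 + S)"

lemma D_nonneg: "D \<ge> 0"
  using C_nonneg S_pos by (simp add: D_def)

text \<open>Value (n = 0) and gradient (n = 1) are handled together: i counts the additional
  derivatives, and the exponent is the worse one, that of n = 1.\<close>

lemma heat_conv_source_bound: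
  assumes "0 < \<rho>" "\<rho> \<le> S" "0 \<le> r" "r \<le> S" "n \<le> 1" "i \<le> 2"
  shows "\<bar>heat_conv (n + i) \<rho> (h r) x\<bar> \<le> D * \<rho> powr (- (real i + 1) / 2) * cosh (k * x)"
proof -
  have "\<bar>heat_conv (n + i) \<rho> (h r) x\<bar> \<le> 1032 * C * \<rho> powr (- real (n + i) / 2) * (exp (2 * k\<^sup>2 * \<rho>) * cosh (k * x))"
    by (rule heat_conv_bound[OF _ h_bound]) (use assms in auto)
  also have "\<dots> \<le> 1032 * C * ((1 + S) * \<rho> powr (- (real i + 1) / 2)) * (exp (2 * k\<^sup>2 * S) * cosh (k * x))"
    using assms C_nonneg
    by (intro mult_mono powr_lower_exponent mult_nonneg_nonneg) (auto simp: mult_left_mono mult_right_mono field_simps)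
  finally show ?thesis by (simp add: D_def ac_simps)
qed

lemma duhamel_bound:
  assumes s: "0 \<le> s" "s \<le> S"
    and b: "\<And>r. 0 < r \<Longrightarrow> r < s \<Longrightarrow> \<bar>heat_conv n (s - r) (h r) x\<bar> \<le> B * (s - r) powr (- (3/4))"
  shows "integrable lborel (\<lambda>r. indicator {0<..<s} r * heat_conv n (s - r) (h r) x)"
    and "\<bar>duhamel n h s x\<bar> \<le> 4 * B * s powr (1/4)"
proof -
  have I: "has_bochner_integral lborel (\<lambda>r. B * (indicator {0<..<s} r * (s - r) powr (- (3/4)))) (B * (4 * s powr (1/4)))"
    by (intro has_bochner_integral_mult_right has_bochner_integral_powr_three_quarters s)
  have b': "\<bar>indicator {0<..<s} r * heat_conv n (s - r) (h r) x\<bar> \<le> B * (indicator {0<..<s} r * (s - r) powr (- (3/4)))" for r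
    using b by (auto simp: indicator_def)
  show i: "integrable lborel (\<lambda>r. indicator {0<..<s} r * heat_conv n (s - r) (h r) x)"
    by (rule Bochner_Integration.integrable_bound[of _ "\<lambda>r. B * (indicator {0<..<s} r * (s - r) powr (- (3/4)))"])
      (use I in \<open>auto simp: has_bochner_integral_iff intro!: AE_I2 order_trans[OF b' abs_ge_self] simp del: abs_mult\<close>)
  have "\<bar>duhamel n h s x\<bar> \<le> (\<integral>r. B * (indicator {0<..<s} r * (s - r) powr (- (3/4))) \<partial>lborel)"
    unfolding duhamel_def
    by (rule integral_abs_bound_integral) (use I b' i in \<open>auto simp: has_bochner_integral_iff\<close>)
  also have "\<dots> = 4 * B * s powr (1/4)"
    unfolding has_bochner_integral_integral_eq[OF I] by simp
  finally show "\<bar>duhamel n h s x\<bar> \<le> 4 * B * s powr (1/4)" .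
qed

lemma heat_conv_source_bound':
  assumes "0 < r" "r < s" "s \<le> S" "n \<le> 1"
  shows "\<bar>heat_conv n (s - r) (h r) x\<bar> \<le> (D * (1 + S) * cosh (k * x)) * (s - r) powr (- (3/4))"
proof -
  have "\<bar>heat_conv n (s - r) (h r) x\<bar> \<le> D * (s - r) powr (- (1/2)) * cosh (k * x)"
    using heat_conv_source_bound[of "s - r" r n 0 x] assms by simp
  also have "\<dots> \<le> D * ((1 + S) * (s - r) powr (- (3/4))) * cosh (k * x)"
    using assms D_nonneg by (intro mult_mono powr_lower_exponent) auto
  finally show ?thesis by (simp add: ac_simps)
qed

lemma duhamel_source_bound:
  assumes "0 \<le> s" "s \<le> S" "n \<le> 1"
  shows "integrable lborel (\<lambda>r. indicator {0<..<s} r * heat_conv n (s - r) (h r) x)"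
    and "\<bar>duhamel n h s x\<bar> \<le> 4 * (D * (1 + S) * cosh (k * x)) * s powr (1/4)"
proof -
  have b: "\<bar>heat_conv n (s - r) (h r) x\<bar> \<le> (D * (1 + S) * cosh (k * x)) * (s - r) powr (- (3/4))"
    if "0 < r" "r < s" for r
    using that assms by (intro heat_conv_source_bound') auto
  show "integrable lborel (\<lambda>r. indicator {0<..<s} r * heat_conv n (s - r) (h r) x)"
    and "\<bar>duhamel n h s x\<bar> \<le> 4 * (D * (1 + S) * cosh (k * x)) * s powr (1/4)"
    using duhamel_bound[OF assms(1,2) b] by blast+
qed

text \<open>At time distance \<rho> the difference is at most of order \<rho>^(-1/2) by the triangle
  inequality and \<rho>^(-1) |x - y| by the mean value theorem. Interpolation leaves an integrable
  singularity and half a derivative.\<close>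

lemma duhamel_holder_space:
  assumes s: "0 \<le> s" "s \<le> S" and n: "n \<le> 1"
  shows "\<bar>duhamel n h s x - duhamel n h s y\<bar> \<le>
    4 * D * S powr (1/4) * (cosh (k * x) + cosh (k * y)) * sqrt \<bar>x - y\<bar>"
proof (induction x y rule: linorder_wlog)
  case (le x y)
  define W where "W = cosh (k * x) + cosh (k * y)"
  have W: "W \<ge> 0" unfolding W_def by simp
  have b: "\<bar>heat_conv n (s - r) (h r) x - heat_conv n (s - r) (h r) y\<bar> \<le> (D * W * sqrt \<bar>x - y\<bar>) * (s - r) powr (- (3/4))"
    if r: "0 < r" "r < s" for r
  proof -
    define \<rho> where "\<rho> = s - r"
    have \<rho>: "0 < \<rho>" "\<rho> \<le> S" "0 \<le> r" "r \<le> S" using r s by (auto simp: \<rho>_def)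
    note B = heat_conv_source_bound[OF \<rho> n]
    have "\<bar>heat_conv n \<rho> (h r) x - heat_conv n \<rho> (h r) y\<bar> \<le> \<bar>heat_conv n \<rho> (h r) x\<bar> + \<bar>heat_conv n \<rho> (h r) y\<bar>"
      by (rule abs_triangle_ineq4)
    also have "\<dots> \<le> (D * W) * \<rho> powr (- (1/2))"
      using B[of 0 x] B[of 0 y] by (simp add: W_def algebra_simps)
    finally have 1: "\<bar>heat_conv n \<rho> (h r) x - heat_conv n \<rho> (h r) y\<bar> \<le> (D * W) * \<rho> powr (- (1/2))" .
    have "norm (heat_conv n \<rho> (h r) x - heat_conv n \<rho> (h r) y) \<le> (D * \<rho> powr (- 1) * W) * norm (x - y)"
    proof (rule field_differentiable_bound[where S = "{x..y}" and f' = "heat_conv (Suc n) \<rho> (h r)"])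
      show "(heat_conv n \<rho> (h r) has_field_derivative heat_conv (Suc n) \<rho> (h r) z) (at z within {x..y})" for z
        by (rule has_field_derivative_at_within, rule heat_conv_deriv_space[OF _ h_bound])
          (use \<rho> n in auto)
      show "norm (heat_conv (Suc n) \<rho> (h r) z) \<le> D * \<rho> powr (- 1) * W" if "z \<in> {x..y}" for z
      proof -
        have "norm (heat_conv (Suc n) \<rho> (h r) z) \<le> D * \<rho> powr (- 1) * cosh (k * z)"
          using B[of 1 z] by simp
        also have "\<dots> \<le> D * \<rho> powr (- 1) * W"
          unfolding W_def using that D_nonneg by (intro mult_left_mono cosh_between) auto
        finally show ?thesis .
      qed
    qed (use le in auto)
    then have 2: "\<bar>heat_conv n \<rho> (h r) x - heat_conv n \<rho> (h r) y\<bar> \<le> (D * W) * \<rho> powr (- 1) * \<bar>x - y\<bar>"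
      by (simp add: ac_simps)
    show ?thesis
      using powr_interpolation[OF \<rho>(1) _ 1 2] D_nonneg W by (simp add: \<rho>_def ac_simps)
  qed
  have I: "has_bochner_integral lborel (\<lambda>r. (D * W * sqrt \<bar>x - y\<bar>) * (indicator {0<..<s} r * (s - r) powr (- (3/4))))
      ((D * W * sqrt \<bar>x - y\<bar>) * (4 * s powr (1/4)))"
    by (intro has_bochner_integral_mult_right has_bochner_integral_powr_three_quarters s)
  note i = duhamel_source_bound(1)[OF s n]
  have eq: "duhamel n h s x - duhamel n h s y =
      (\<integral>r. indicator {0<..<s} r * heat_conv n (s - r) (h r) x - indicator {0<..<s} r * heat_conv n (s - r) (h r) y \<partial>lborel)"
    unfolding duhamel_def by (rule Bochner_Integration.integral_diff[symmetric, OF i i])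
  have "\<bar>duhamel n h s x - duhamel n h s y\<bar> \<le> (\<integral>r. (D * W * sqrt \<bar>x - y\<bar>) * (indicator {0<..<s} r * (s - r) powr (- (3/4))) \<partial>lborel)"
    unfolding eq
  proof (rule integral_abs_bound_integral)
    show "integrable lborel (\<lambda>r. (D * W * sqrt \<bar>x - y\<bar>) * (indicator {0<..<s} r * (s - r) powr (- (3/4))))"
      using I unfolding has_bochner_integral_iff by (rule conjunct1)
    show "\<bar>indicator {0<..<s} r * heat_conv n (s - r) (h r) x - indicator {0<..<s} r * heat_conv n (s - r) (h r) y\<bar>
        \<le> (D * W * sqrt \<bar>x - y\<bar>) * (indicator {0<..<s} r * (s - r) powr (- (3/4)))" for r
      using b[of r] by (cases "r \<in> {0<..<s}") simp_all
  qed (intro Bochner_Integration.integrable_diff i)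
  also have "\<dots> = (D * W * sqrt \<bar>x - y\<bar>) * (4 * s powr (1/4))"
    by (rule has_bochner_integral_integral_eq[OF I])
  also have "\<dots> \<le> (D * W * sqrt \<bar>x - y\<bar>) * (4 * S powr (1/4))"
    using s D_nonneg W by (intro mult_left_mono powr_mono2) auto
  finally show ?case by (simp add: W_def ac_simps)
next
  case (sym x y)
  then show ?case by (simp add: abs_minus_commute add.commute)
qed

text \<open>For s \<le> t the common range (0, s) is interpolated against the time derivative, which
  is two space derivatives by the heat equation. The extra range (s, t) contributes the integral of
  \<rho>^(-1/2), of order (t - s)^(1/2), and is then weakened to exponent 1/4.\<close>

lemma duhamel_holder_time:
  assumes s: "0 \<le> s" "s \<le> S" and t: "0 \<le> t" "t \<le> S" and n: "n \<le> 1"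
  shows "\<bar>duhamel n h s x - duhamel n h t x\<bar> \<le>
    (8 * D * S powr (1/4) + 2 * D * (1 + S)) * cosh (k * x) * \<bar>s - t\<bar> powr (1/4)"
  using s t
proof (induction t s rule: linorder_wlog)
  case (le s t)
  define W where "W = D * cosh (k * x)"
  define d where "d = t - s"
  have W: "W \<ge> 0" unfolding W_def using D_nonneg by simp
  have d: "d \<ge> 0" "d \<le> S" using le by (auto simp: d_def)
  have b: "\<bar>heat_conv n (t - r) (h r) x - heat_conv n (s - r) (h r) x\<bar> \<le> (2 * W * d powr (1/4)) * (s - r) powr (- (3/4))"
    if r: "0 < r" "r < s" for r
  proof -
    define \<rho> where "\<rho> = s - r"
    have \<rho>: "0 < \<rho>" "\<rho> \<le> S" "0 \<le> r" "r \<le> S" using r le by (auto simp: \<rho>_def)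
    have td: "t - r = \<rho> + d" "\<rho> + d \<le> S" using r le by (auto simp: d_def \<rho>_def)
    have B: "\<bar>heat_conv (n + i) \<rho>' (h r) x\<bar> \<le> W * \<rho> powr (- (real i + 1) / 2)"
      if "\<rho> \<le> \<rho>'" "\<rho>' \<le> \<rho> + d" "i \<le> 2" for \<rho>' i
    proof -
      have "\<bar>heat_conv (n + i) \<rho>' (h r) x\<bar> \<le> D * \<rho>' powr (- (real i + 1) / 2) * cosh (k * x)"
        using heat_conv_source_bound[of \<rho>' r n i x] that \<rho> n td by auto
      also have "\<dots> \<le> D * \<rho> powr (- (real i + 1) / 2) * cosh (k * x)"
        using that \<rho> D_nonneg by (intro mult_right_mono mult_left_mono powr_mono2') auto
      finally show ?thesis by (simp add: W_def ac_simps)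
    qed
    have "\<bar>heat_conv n (\<rho> + d) (h r) x - heat_conv n \<rho> (h r) x\<bar> \<le> \<bar>heat_conv n (\<rho> + d) (h r) x\<bar> + \<bar>heat_conv n \<rho> (h r) x\<bar>"
      by (rule abs_triangle_ineq4)
    also have "\<dots> \<le> (2 * W) * \<rho> powr (- (1/2))"
      using B[of "\<rho> + d" 0] B[of \<rho> 0] d by simp
    finally have 1: "\<bar>heat_conv n (\<rho> + d) (h r) x - heat_conv n \<rho> (h r) x\<bar> \<le> (2 * W) * \<rho> powr (- (1/2))" .
    have "norm (heat_conv n (\<rho> + d) (h r) x - heat_conv n \<rho> (h r) x) \<le> (W * \<rho> powr (- (3/2))) * norm (\<rho> + d - \<rho>)"
    proof (rule field_differentiable_bound[where S = "{\<rho>..\<rho> + d}" and f = "\<lambda>\<rho>. heat_conv n \<rho> (h r) x" and f' = "\<lambda>\<rho>. heat_conv (n + 2) \<rho> (h r) x"])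
      show "((\<lambda>\<rho>. heat_conv n \<rho> (h r) x) has_field_derivative heat_conv (n + 2) z (h r) x) (at z within {\<rho>..\<rho> + d})"
        if "z \<in> {\<rho>..\<rho> + d}" for z
        by (rule has_field_derivative_at_within, rule heat_conv_deriv_time[OF _ h_bound])
          (use \<rho> n that in auto)
      show "norm (heat_conv (n + 2) z (h r) x) \<le> W * \<rho> powr (- (3/2))" if "z \<in> {\<rho>..\<rho> + d}" for z
        using B[of z 2] that by simp
    qed (use d in auto)
    also have "\<dots> \<le> (2 * W) * \<rho> powr (- (3/2)) * d"
      using d W by (simp add: mult_right_mono)
    finally have 2: "\<bar>heat_conv n (\<rho> + d) (h r) x - heat_conv n \<rho> (h r) x\<bar> \<le> (2 * W) * \<rho> powr (- (3/2)) * d"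
      by simp
    show ?thesis
      using powr_interpolation'[OF \<rho>(1) d(1) 1 2] W by (simp add: \<rho>_def[symmetric] td ac_simps)
  qed
  have b2: "\<bar>heat_conv n (t - r) (h r) x\<bar> \<le> W * (t - r) powr (- (1/2))" if "s \<le> r" "r < t" "0 < r" for r
    using heat_conv_source_bound[of "t - r" r n 0 x] that le n by (simp add: W_def ac_simps)
  have I: "has_bochner_integral lborel (\<lambda>r. (2 * W * d powr (1/4)) * (indicator {0<..<s} r * (s - r) powr (- (3/4))) +
        W * (indicator {s<..<t} r * (t - r) powr (- (1/2))))
      ((2 * W * d powr (1/4)) * (4 * s powr (1/4)) + W * ((t - s) powr (1 - 1/2) / (1 - 1/2)))"
    using le by (intro has_bochner_integral_add has_bochner_integral_mult_right
        has_bochner_integral_powr_singular has_bochner_integral_powr_three_quarters) auto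
  have ii: "integrable lborel (\<lambda>r. indicator {0<..<s} r * heat_conv n (s - r) (h r) x)"
    and it: "integrable lborel (\<lambda>r. indicator {0<..<t} r * heat_conv n (t - r) (h r) x)"
    using le n by (auto intro!: duhamel_source_bound(1))
  have eq: "duhamel n h t x - duhamel n h s x =
      (\<integral>r. indicator {0<..<t} r * heat_conv n (t - r) (h r) x - indicator {0<..<s} r * heat_conv n (s - r) (h r) x \<partial>lborel)"
    unfolding duhamel_def by (rule Bochner_Integration.integral_diff[symmetric, OF it ii])
  have "\<bar>duhamel n h t x - duhamel n h s x\<bar> \<le> (\<integral>r. \<bar>indicator {0<..<t} r * heat_conv n (t - r) (h r) x - indicator {0<..<s} r * heat_conv n (s - r) (h r) x\<bar> \<partial>lborel)"
    unfolding eq by (rule integral_abs_bound)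
  also have "\<dots> \<le> (\<integral>r. (2 * W * d powr (1/4)) * (indicator {0<..<s} r * (s - r) powr (- (3/4))) +
        W * (indicator {s<..<t} r * (t - r) powr (- (1/2))) \<partial>lborel)"
  proof (rule integral_mono_AE)
    show "AE r in lborel. \<bar>indicator {0<..<t} r * heat_conv n (t - r) (h r) x - indicator {0<..<s} r * heat_conv n (s - r) (h r) x\<bar>
      \<le> (2 * W * d powr (1/4)) * (indicator {0<..<s} r * (s - r) powr (- (3/4))) + W * (indicator {s<..<t} r * (t - r) powr (- (1/2)))"
      \<comment> \<open>The single time r = s must be discarded: it lies in (0, t) when 0 < s < t,
        but the majorant vanishes there.\<close>
      using AE_lborel_singleton[of s]
    proof eventually_elim
      case (elim r)
      then consider "r \<le> 0" | "0 < r" "r < s" | "0 < r" "s < r" "r < t" | "0 < r" "r \<ge> t" "r > s" using le by linarith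
      then show ?case
      proof cases
        case 2
        then have "indicat_real {0<..<t} r = 1" "indicat_real {0<..<s} r = 1" "indicat_real {s<..<t} r = 0"
          using le by auto
        then show ?thesis using b[OF 2] by simp
      next
        case 3
        then have "indicat_real {0<..<t} r = 1" "indicat_real {0<..<s} r = 0" "indicat_real {s<..<t} r = 1"
          by auto
        then show ?thesis using b2[of r] 3 by simp
      qed (use le in simp_all)
    qed
    show "integrable lborel (\<lambda>r. (2 * W * d powr (1/4)) * (indicator {0<..<s} r * (s - r) powr (- (3/4))) +
        W * (indicator {s<..<t} r * (t - r) powr (- (1/2))))"
      using I unfolding has_bochner_integral_iff by (rule conjunct1)
  qed (intro integrable_abs Bochner_Integration.integrable_diff ii it)
  also have "\<dots> = 8 * W * d powr (1/4) * s powr (1/4) + 2 * W * d powr (1/2)"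
    unfolding has_bochner_integral_integral_eq[OF I] by (simp add: d_def)
  also have "\<dots> \<le> 8 * W * d powr (1/4) * S powr (1/4) + 2 * W * ((1 + S) * d powr (1/4))"
  proof (intro add_mono mult_left_mono powr_mono2)
    show "d powr (1/2) \<le> (1 + S) * d powr (1/4)"
      using d powr_lower_exponent[of d S "1/4" "1/2"] by (cases "d = 0") auto
  qed (use le W in auto)
  also have "\<dots> = (8 * D * S powr (1/4) + 2 * D * (1 + S)) * cosh (k * x) * d powr (1/4)"
    by (simp add: W_def algebra_simps)
  finally show ?case using le by (simp add: d_def)
next
  case (sym s t)
  then show ?case by (simp add: abs_minus_commute)
qed

end

lemma integrable_powr_singular_left:
  fixes a s :: real
  assumes "a \<le> s"
  shows "integrable lborel (\<lambda>r. indicator {a<..<s} r * (r - a) powr (- (3/4)))"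
proof -
  have "integrable lborel (\<lambda>r. indicator {a<..<s} r * (s - r) powr (- (3/4)))"
    using has_bochner_integral_powr_singular[OF assms, of "3/4"] by (simp add: has_bochner_integral_iff)
  from lborel_integrable_real_affine[OF this, of "-1" "a + s"]
  have "integrable lborel (\<lambda>r. indicator {a<..<s} (a + s + (-1) * r) * (s - (a + s + (-1) * r)) powr (- (3/4)))" by simp
  also have "(\<lambda>r. indicator {a<..<s} (a + s + (-1) * r) * (s - (a + s + (-1) * r)) powr (- (3/4))) =
      (\<lambda>r. indicator {a<..<s} r * (r - a) powr (- (3/4)))"
    by (auto simp: indicator_def fun_eq_iff)
  finally show ?thesis .
qed

context heat_source
begin

text \<open>The hypothesis on the next derivative is kept abstract: for n = 0 every source satisfies
  it, for n = 1 it is the cancellation estimate for Hoelder sources.\<close>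

lemma duhamel_deriv_space:
  assumes s: "0 \<le> s" "s \<le> S" and n: "n \<le> 1"
    and b: "\<And>r y. 0 < r \<Longrightarrow> r < s \<Longrightarrow> \<bar>heat_conv (Suc n) (s - r) (h r) y\<bar> \<le> (B * cosh (k * y)) * (s - r) powr (- (3/4))"
    and B: "B \<ge> 0"
  shows "(duhamel n h s has_real_derivative duhamel (Suc n) h s x) (at x)"
  unfolding duhamel_def
proof (rule has_real_derivative_integral_dominated[where e = 1 and
      g = "\<lambda>r. (B * exp \<bar>k\<bar> * cosh (k * x)) * (indicator {0<..<s} r * (s - r) powr (- (3/4)))"])
  show "integrable lborel (\<lambda>r. indicator {0<..<s} r * heat_conv n (s - r) (h r) y)" for y
    by (rule duhamel_source_bound(1)[OF s n])
  show "integrable lborel (\<lambda>r. (B * exp \<bar>k\<bar> * cosh (k * x)) * (indicator {0<..<s} r * (s - r) powr (- (3/4))))"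
    using has_bochner_integral_powr_three_quarters[OF s(1)]
    by (intro integrable_mult_right) (simp add: has_bochner_integral_iff)
  show "((\<lambda>y. indicator {0<..<s} r * heat_conv n (s - r) (h r) y) has_real_derivative
      indicator {0<..<s} r * heat_conv (Suc n) (s - r) (h r) y) (at y)" for y r
  proof (cases "r \<in> {0<..<s}")
    case True
    then have "(heat_conv n (s - r) (h r) has_real_derivative heat_conv (Suc n) (s - r) (h r) y) (at y)"
      by (intro heat_conv_deriv_space[OF _ h_bound]) (use n s in auto)
    then show ?thesis by (intro DERIV_cmult)
  qed simp
  show "\<bar>indicator {0<..<s} r * heat_conv (Suc n) (s - r) (h r) y\<bar> \<le>
      (B * exp \<bar>k\<bar> * cosh (k * x)) * (indicator {0<..<s} r * (s - r) powr (- (3/4)))" if "\<bar>y - x\<bar> < 1" for y r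
  proof (cases "r \<in> {0<..<s}")
    case True
    have "cosh (k * y) \<le> exp \<bar>k * (y - x)\<bar> * cosh (k * x)"
      using cosh_shift_le[of k x "y - x"] by simp
    also have "\<dots> \<le> exp \<bar>k\<bar> * cosh (k * x)"
      using that by (intro mult_right_mono) (auto simp: abs_mult intro: mult_left_le)
    finally have "B * cosh (k * y) \<le> B * (exp \<bar>k\<bar> * cosh (k * x))"
      using B by (intro mult_left_mono)
    then have "(B * cosh (k * y)) * (s - r) powr (- (3/4)) \<le> (B * (exp \<bar>k\<bar> * cosh (k * x))) * (s - r) powr (- (3/4))"
      by (intro mult_right_mono) auto
    then show ?thesis using b[of r y] True by simp
  qed simp
qed auto

lemma duhamel_0_deriv_space:
  assumes s: "0 \<le> s" "s \<le> S"
  shows "(duhamel 0 h s has_real_derivative duhamel 1 h s x) (at x)"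
proof -
  have "(duhamel 0 h s has_real_derivative duhamel (Suc 0) h s x) (at x)"
    using D_nonneg S_pos s heat_conv_source_bound'[of _ s "Suc 0"]
    by (intro duhamel_deriv_space[where B = "D * (1 + S)"]) auto
  then show ?thesis by simp
qed

lemma continuous_on_heat_conv_source:
  assumes hc: "\<And>\<xi>. continuous_on {0..S} (\<lambda>r. h r \<xi>)" and \<rho>: "\<rho> > 0" and n: "n \<le> 3"
  shows "continuous_on {0..S} (\<lambda>r. heat_conv n \<rho> (h r) x)"
  unfolding continuous_on_sequentially comp_def
proof (intro allI ballI impI, elim conjE)
  fix X r assume X: "\<forall>i. X i \<in> {0..S}" "X \<longlonglongrightarrow> r" and r: "r \<in> {0..S}"
  show "(\<lambda>i. heat_conv n \<rho> (h (X i)) x) \<longlonglongrightarrow> heat_conv n \<rho> (h r) x"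
    unfolding heat_conv_def
  proof (rule integral_dominated_convergence[where w = "\<lambda>\<xi>. \<bar>heat n \<rho> (x - \<xi>) * (C * cosh (k * \<xi>))\<bar>"])
    show "integrable lborel (\<lambda>\<xi>. \<bar>heat n \<rho> (x - \<xi>) * (C * cosh (k * \<xi>))\<bar>)"
      using C_nonneg by (intro integrable_abs heat_conv_integrable[of _ C k]) (auto simp: \<rho> n abs_mult)
    show "AE \<xi> in lborel. (\<lambda>i. heat n \<rho> (x - \<xi>) * h (X i) \<xi>) \<longlonglongrightarrow> heat n \<rho> (x - \<xi>) * h r \<xi>"
    proof (rule AE_I2)
      fix \<xi>
      have "(\<lambda>i. h (X i) \<xi>) \<longlonglongrightarrow> h r \<xi>"
        using hc[of \<xi>] X r unfolding continuous_on_sequentially comp_def by blast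
      then show "(\<lambda>i. heat n \<rho> (x - \<xi>) * h (X i) \<xi>) \<longlonglongrightarrow> heat n \<rho> (x - \<xi>) * h r \<xi>"
        by (rule tendsto_mult_left)
    qed
    show "AE \<xi> in lborel. norm (heat n \<rho> (x - \<xi>) * h (X i) \<xi>) \<le> \<bar>heat n \<rho> (x - \<xi>) * (C * cosh (k * \<xi>))\<bar>" for i
    proof (rule AE_I2)
      fix \<xi>
      have "\<bar>h (X i) \<xi>\<bar> \<le> \<bar>C * cosh (k * \<xi>)\<bar>"
        using h_bound[of "X i" \<xi>] X(1)[rule_format, of i] by auto
      then show "norm (heat n \<rho> (x - \<xi>) * h (X i) \<xi>) \<le> \<bar>heat n \<rho> (x - \<xi>) * (C * cosh (k * \<xi>))\<bar>"
        unfolding real_norm_def abs_mult[of "heat n \<rho> (x - \<xi>)"] by (intro mult_left_mono) auto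
    qed
  qed measurable
qed

end

section \<open>Hoelder continuous sources: second derivatives and the heat equation\<close>

locale holder_source = heat_source +
  fixes H :: real
  assumes H_nonneg: "H \<ge> 0"
    and h_holder: "\<And>r \<xi> \<zeta>. 0 \<le> r \<Longrightarrow> r \<le> S \<Longrightarrow>
      \<bar>h r \<xi> - h r \<zeta>\<bar> \<le> H * sqrt \<bar>\<xi> - \<zeta>\<bar> * (cosh (k * \<xi>) + cosh (k * \<zeta>))"
    and h_cont: "\<And>\<xi>. continuous_on {0..S} (\<lambda>r. h r \<xi>)"
begin

definition B where "B = 2064 * H * exp (2 * k\<^sup>2 * S)"

lemma B_nonneg: "B \<ge> 0"
  using H_nonneg by (simp add: B_def)

text \<open>Both parts are the same oscillation estimate, read with n = 2 and n = 0: an integrable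
  second derivative, and a rate for the attainment of the initial value.\<close>

lemma heat_conv_2_source_bound:
  assumes "0 < \<rho>" "\<rho> \<le> S" "0 \<le> r" "r \<le> S"
  shows "\<bar>heat_conv 2 \<rho> (h r) x\<bar> \<le> (B * cosh (k * x)) * \<rho> powr (- (3/4))"
    and "\<bar>heat_conv 0 \<rho> (h r) x - h r x\<bar> \<le> (B * cosh (k * x)) * \<rho> powr (1/4)"
proof -
  note c = heat_conv_const[OF assms(1)]
  have m: "2064 * H * \<rho> powr p * (exp (2 * k\<^sup>2 * \<rho>) * cosh (k * x)) \<le> 2064 * H * \<rho> powr p * (exp (2 * k\<^sup>2 * S) * cosh (k * x))" for p
    using assms H_nonneg by (intro mult_left_mono mult_right_mono) (auto simp: mult_left_mono)
  have g: "\<bar>heat_conv n \<rho> (h r) x - heat_conv n \<rho> (\<lambda>_. h r x) x\<bar> \<le>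
      2064 * H * \<rho> powr (1/4 - real n / 2) * (exp (2 * k\<^sup>2 * \<rho>) * cosh (k * x))" if "n \<le> 2" for n
    using assms that by (intro heat_conv_holder[where C = C] h_bound h_holder H_nonneg) auto
  have *: "\<bar>heat_conv n \<rho> (h r) x - heat_conv n \<rho> (\<lambda>_. h r x) x\<bar> \<le> (B * cosh (k * x)) * \<rho> powr (1/4 - real n / 2)"
    if "n \<le> 2" for n
    using order_trans[OF g[OF that] m] by (simp add: B_def ac_simps)
  show "\<bar>heat_conv 2 \<rho> (h r) x\<bar> \<le> (B * cosh (k * x)) * \<rho> powr (- (3/4))"
    using *[of 2] by (simp add: c)
  show "\<bar>heat_conv 0 \<rho> (h r) x - h r x\<bar> \<le> (B * cosh (k * x)) * \<rho> powr (1/4)"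
    using *[of 0] by (simp add: c)
qed

lemma duhamel_1_deriv_space:
  assumes s: "0 \<le> s" "s \<le> S"
  shows "(duhamel 1 h s has_real_derivative duhamel 2 h s x) (at x)"
proof -
  have "(duhamel 1 h s has_real_derivative duhamel (Suc 1) h s x) (at x)"
    using s heat_conv_2_source_bound(1)
    by (intro duhamel_deriv_space[where B = B] B_nonneg) (auto simp: numeral_2_eq_2)
  then show ?thesis by (simp only: Suc_1)
qed

lemma duhamel_2_bound:
  assumes s: "0 \<le> s" "s \<le> S"
  shows "integrable lborel (\<lambda>r. indicator {0<..<s} r * heat_conv 2 (s - r) (h r) x)"
    and "\<bar>duhamel 2 h s x\<bar> \<le> 4 * (B * cosh (k * x)) * s powr (1/4)"
proof -
  have b: "\<bar>heat_conv 2 (s - r) (h r) x\<bar> \<le> (B * cosh (k * x)) * (s - r) powr (- (3/4))"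
    if "0 < r" "r < s" for r
    using that s by (intro heat_conv_2_source_bound) auto
  show "integrable lborel (\<lambda>r. indicator {0<..<s} r * heat_conv 2 (s - r) (h r) x)"
    and "\<bar>duhamel 2 h s x\<bar> \<le> 4 * (B * cosh (k * x)) * s powr (1/4)"
    using duhamel_bound[OF s b] by blast+
qed

lemma continuous_on_duhamel_2: "continuous_on {0..S} (\<lambda>s. duhamel 2 h s x)"
proof -
  \<comment> \<open>Substituting \<rho> = s - r moves the dependence on s from the singular kernel
    into the source, so that one majorant \<rho>^(-3/4) serves all s.\<close>
  have eq: "duhamel 2 h s x = (\<integral>\<rho>. indicator {0<..<s} \<rho> * heat_conv 2 \<rho> (h (s - \<rho>)) x \<partial>lborel)" for s
  proof -
    have "indicator {0<..<s} (s - \<rho>) = (indicator {0<..<s} \<rho> :: real)" for \<rho>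
      by (auto simp: indicator_def)
    then show ?thesis
      unfolding duhamel_def
      using lborel_integral_real_affine[of "-1" "\<lambda>r. indicator {0<..<s} r * heat_conv 2 (s - r) (h r) x" s] by simp
  qed
  show ?thesis
    unfolding eq continuous_on_sequentially comp_def
  proof (intro allI ballI impI, elim conjE)
    fix X s assume X: "\<forall>i. X i \<in> {0..S}" "X \<longlonglongrightarrow> s" and s: "s \<in> {0..S}"
    show "(\<lambda>i. \<integral>\<rho>. indicator {0<..<X i} \<rho> * heat_conv 2 \<rho> (h (X i - \<rho>)) x \<partial>lborel) \<longlonglongrightarrow>
        (\<integral>\<rho>. indicator {0<..<s} \<rho> * heat_conv 2 \<rho> (h (s - \<rho>)) x \<partial>lborel)"
    proof (rule integral_dominated_convergence[where w = "\<lambda>\<rho>. (B * cosh (k * x)) * (indicator {0<..<S} \<rho> * \<rho> powr (- (3/4)))"])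
      show "integrable lborel (\<lambda>\<rho>. (B * cosh (k * x)) * (indicator {0<..<S} \<rho> * \<rho> powr (- (3/4))))"
        using integrable_powr_singular_left[of 0 S] S_pos by (intro integrable_mult_right) auto
      show "AE \<rho> in lborel. (\<lambda>i. indicator {0<..<X i} \<rho> * heat_conv 2 \<rho> (h (X i - \<rho>)) x) \<longlonglongrightarrow>
          indicator {0<..<s} \<rho> * heat_conv 2 \<rho> (h (s - \<rho>)) x"
        \<comment> \<open>At \<rho> = s the indicators of (0, X i) need not converge, and this point
          is null.\<close>
        using AE_lborel_singleton[of s]
      proof eventually_elim
        case (elim \<rho>)
        consider "\<rho> \<le> 0" | "s < \<rho>" | "0 < \<rho>" "\<rho> < s" using elim by linarith
        then show ?case
        proof cases
          case 2
          have "\<forall>\<^sub>F i in sequentially. X i < \<rho>" using X(2) 2 by (rule order_tendstoD)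
          then have "\<forall>\<^sub>F i in sequentially. indicator {0<..<X i} \<rho> * heat_conv 2 \<rho> (h (X i - \<rho>)) x = 0"
            by eventually_elim simp
          then show ?thesis using 2 by (simp add: tendsto_eventually)
        next
          case 3
          have ev: "\<forall>\<^sub>F i in sequentially. \<rho> < X i" using X(2) 3(2) by (rule order_tendstoD)
          have "(\<lambda>i. heat_conv 2 \<rho> (h (X i - \<rho>)) x) \<longlonglongrightarrow> heat_conv 2 \<rho> (h (s - \<rho>)) x"
          proof (rule continuous_on_tendsto_compose[OF continuous_on_heat_conv_source[OF h_cont 3(1)]])
            show "(\<lambda>i. X i - \<rho>) \<longlonglongrightarrow> s - \<rho>" using X by (intro tendsto_intros)
            show "\<forall>\<^sub>F i in sequentially. X i - \<rho> \<in> {0..S}" using ev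
            proof eventually_elim
              case (elim i) then show ?case using X(1)[rule_format, of i] 3 by auto
            qed
          qed (use 3 s in auto)
          moreover have "\<forall>\<^sub>F i in sequentially. heat_conv 2 \<rho> (h (X i - \<rho>)) x =
              indicator {0<..<X i} \<rho> * heat_conv 2 \<rho> (h (X i - \<rho>)) x"
            using ev by eventually_elim (use 3 in simp)
          ultimately have "(\<lambda>i. indicator {0<..<X i} \<rho> * heat_conv 2 \<rho> (h (X i - \<rho>)) x) \<longlonglongrightarrow> heat_conv 2 \<rho> (h (s - \<rho>)) x"
            by (rule Lim_transform_eventually)
          then show ?thesis using 3 by simp
        qed simp
      qed
      show "AE \<rho> in lborel. norm (indicator {0<..<X i} \<rho> * heat_conv 2 \<rho> (h (X i - \<rho>)) x) \<le>
          (B * cosh (k * x)) * (indicator {0<..<S} \<rho> * \<rho> powr (- (3/4)))" for i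
      proof (rule AE_I2)
        fix \<rho>
        show "norm (indicator {0<..<X i} \<rho> * heat_conv 2 \<rho> (h (X i - \<rho>)) x) \<le>
          (B * cosh (k * x)) * (indicator {0<..<S} \<rho> * \<rho> powr (- (3/4)))"
        proof (cases "0 < \<rho> \<and> \<rho> < X i")
          case True
          then have "0 < \<rho>" "\<rho> < S" "0 \<le> X i - \<rho>" "X i - \<rho> \<le> S" using X(1)[rule_format, of i] by auto
          then show ?thesis using heat_conv_2_source_bound(1)[of \<rho> "X i - \<rho>" x] True by simp
        next
          case False
          then show ?thesis using B_nonneg by (auto simp: indicator_def)
        qed
      qed
    qed measurable
  qed
qed

text \<open>Fundamental theorem of calculus in time for the heat flow started from h \<rho>: its
  time derivative is its second space derivative, and the cancellation estimates give both
  integrability and continuity at the initial time.\<close>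

lemma integral_heat_conv_2:
  assumes "0 \<le> \<rho>" "\<rho> < s" "s \<le> S"
  shows "(\<integral>r. indicator {\<rho><..<s} r * heat_conv 2 (r - \<rho>) (h \<rho>) x \<partial>lborel) = heat_conv 0 (s - \<rho>) (h \<rho>) x - h \<rho> x"
proof -
  \<comment> \<open>The initial value is inserted by hand, because the kernel formula at time 0 is
    no delta function.\<close>
  define F where "F r = (if r = \<rho> then h \<rho> x else heat_conv 0 (r - \<rho>) (h \<rho>) x)" for r
  have der: "((\<lambda>r. heat_conv 0 (r - \<rho>) (h \<rho>) x) has_real_derivative heat_conv 2 (r - \<rho>) (h \<rho>) x) (at r)"
    if "\<rho> < r" for r
  proof -
    have "((\<lambda>r. heat_conv 0 r (h \<rho>) x) has_real_derivative heat_conv (0 + 2) (r - \<rho>) (h \<rho>) x) (at (r - \<rho>))"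
      using that assms by (intro heat_conv_deriv_time[OF _ h_bound]) auto
    moreover have "((\<lambda>r. r - \<rho>) has_real_derivative 1) (at r)" by (auto intro!: derivative_eq_intros)
    ultimately have "((\<lambda>r. heat_conv 0 (r - \<rho>) (h \<rho>) x) has_real_derivative heat_conv (0 + 2) (r - \<rho>) (h \<rho>) x * 1) (at r)"
      by (rule DERIV_chain2)
    then show ?thesis by (simp add: numeral_2_eq_2)
  qed
  have derF: "(F has_vector_derivative heat_conv 2 (r - \<rho>) (h \<rho>) x) (at r)" if "\<rho> < r" for r
  proof -
    have "(F has_real_derivative heat_conv 2 (r - \<rho>) (h \<rho>) x) (at r)"
    proof (rule has_field_derivative_transform_within_open[OF der[OF that], of "{\<rho><..}"])
      show "heat_conv 0 (r - \<rho>) (h \<rho>) x = F r" if "r \<in> {\<rho><..}" for r using that by (simp add: F_def)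
    qed (use that in auto)
    then show ?thesis by (simp add: has_real_derivative_iff_has_vector_derivative)
  qed
  have "continuous_on {\<rho>..s} F"
    unfolding continuous_on_eq_continuous_within
  proof
    fix r assume r: "r \<in> {\<rho>..s}"
    show "continuous (at r within {\<rho>..s}) F"
    proof (cases "r = \<rho>")
      case True
      have "((\<lambda>r. F r - h \<rho> x) \<longlongrightarrow> 0) (at \<rho> within {\<rho>..s})"
      proof (rule Lim_null_comparison)
        show "\<forall>\<^sub>F r in at \<rho> within {\<rho>..s}. norm (F r - h \<rho> x) \<le> (B * cosh (k * x)) * (r - \<rho>) powr (1/4)"
          unfolding eventually_at
        proof (intro exI[of _ 1] conjI ballI impI)
          fix r assume "r \<in> {\<rho>..s}" "r \<noteq> \<rho> \<and> dist r \<rho> < 1"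
          then show "norm (F r - h \<rho> x) \<le> (B * cosh (k * x)) * (r - \<rho>) powr (1/4)"
            using heat_conv_2_source_bound(2)[of "r - \<rho>" \<rho> x] assms by (simp add: F_def)
        qed simp
        have "((\<lambda>r. (B * cosh (k * x)) * (r - \<rho>) powr (1/4)) \<longlongrightarrow> (B * cosh (k * x)) * (\<rho> - \<rho>) powr (1/4)) (at \<rho> within {\<rho>..s})"
          by (intro tendsto_intros tendsto_powr') (auto simp: eventually_at intro!: exI[of _ 1])
        then show "((\<lambda>r. (B * cosh (k * x)) * (r - \<rho>) powr (1/4)) \<longlongrightarrow> 0) (at \<rho> within {\<rho>..s})" by simp
      qed
      then have "(F \<longlongrightarrow> h \<rho> x) (at \<rho> within {\<rho>..s})" by (rule LIM_zero_cancel)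
      then show ?thesis unfolding continuous_within True by (simp add: F_def)
    next
      case False
      then have "isCont F r" using r derF[of r] by (intro has_vector_derivative_continuous) auto
      then show ?thesis by (rule continuous_at_imp_continuous_at_within)
    qed
  qed
  then have "((\<lambda>r. heat_conv 2 (r - \<rho>) (h \<rho>) x) has_integral F s - F \<rho>) {\<rho>..s}"
    using assms derF by (intro fundamental_theorem_of_calculus_interior) auto
  then have I: "((\<lambda>r. heat_conv 2 (r - \<rho>) (h \<rho>) x) has_integral F s - F \<rho>) {\<rho><..<s}"
    by (simp add: has_integral_Icc_iff_Ioo)
  have "integrable lborel (\<lambda>r. indicator {\<rho><..<s} r * heat_conv 2 (r - \<rho>) (h \<rho>) x)"
  proof (rule Bochner_Integration.integrable_bound)
    show "integrable lborel (\<lambda>r. (B * cosh (k * x)) * (indicator {\<rho><..<s} r * (r - \<rho>) powr (- (3/4))))"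
      using assms by (intro integrable_mult_right integrable_powr_singular_left) auto
    show "AE r in lborel. norm (indicator {\<rho><..<s} r * heat_conv 2 (r - \<rho>) (h \<rho>) x) \<le>
        norm ((B * cosh (k * x)) * (indicator {\<rho><..<s} r * (r - \<rho>) powr (- (3/4))))"
    proof (rule AE_I2)
      fix r
      show "norm (indicator {\<rho><..<s} r * heat_conv 2 (r - \<rho>) (h \<rho>) x) \<le>
        norm ((B * cosh (k * x)) * (indicator {\<rho><..<s} r * (r - \<rho>) powr (- (3/4))))"
        using heat_conv_2_source_bound(1)[of "r - \<rho>" \<rho> x] assms B_nonneg
        by (cases "r \<in> {\<rho><..<s}") simp_all
    qed
  qed measurable
  then have "set_integrable lborel {\<rho><..<s} (\<lambda>r. heat_conv 2 (r - \<rho>) (h \<rho>) x)"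
    by (simp add: set_integrable_def)
  from set_borel_integral_eq_integral(2)[OF this] integral_unique[OF I]
  have "(\<integral>r. indicator {\<rho><..<s} r * heat_conv 2 (r - \<rho>) (h \<rho>) x \<partial>lborel) = F s - F \<rho>"
    by (simp add: set_lebesgue_integral_def)
  then show ?thesis using assms by (simp add: F_def)
qed

text \<open>Writing the potential as a time integral avoids differentiating an integral with moving
  end point and singular integrand. \<open>integral_heat_conv_2\<close> expresses each propagated
  source as its initial value plus an integral of second derivatives, and Fubini on the triangle 0 <
  \<rho> < r < s exchanges the order.\<close>

lemma duhamel_0_eq_integral:
  assumes s: "0 \<le> s" "s \<le> S"
  shows "((\<lambda>r. h r x + duhamel 2 h r x) has_integral duhamel 0 h s x) {0..s}"
proof -
  define F :: "real \<Rightarrow> real \<Rightarrow> real" where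
    "F r \<rho> = (if 0 < \<rho> \<and> \<rho> < r \<and> r < s then 1 else 0) * heat_conv 2 (r - \<rho>) (h \<rho>) x" for r \<rho>
  have Fm[measurable]: "case_prod F \<in> borel_measurable (lborel \<Otimes>\<^sub>M lborel)"
  proof -
    have "case_prod F \<in> borel_measurable (borel \<Otimes>\<^sub>M borel)" unfolding F_def by measurable
    then show ?thesis by (simp cong: measurable_cong_sets)
  qed
  have F1: "F r \<rho> = indicator {0<..<s} r * (indicator {0<..<r} \<rho> * heat_conv 2 (r - \<rho>) (h \<rho>) x)" for r \<rho>
    by (auto simp: F_def indicator_def)
  have F2: "F r \<rho> = indicator {0<..<s} \<rho> * (indicator {\<rho><..<s} r * heat_conv 2 (r - \<rho>) (h \<rho>) x)" for r \<rho>
    by (auto simp: F_def indicator_def)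
  have Fi: "integrable lborel (F r)" for r
  proof (cases "r \<in> {0<..<s}")
    case True
    then have "integrable lborel (\<lambda>\<rho>. indicator {0<..<r} \<rho> * heat_conv 2 (r - \<rho>) (h \<rho>) x)"
      using s by (intro duhamel_2_bound(1)) auto
    then show ?thesis unfolding F1[abs_def] by (rule integrable_mult_right)
  next
    case False
    then show ?thesis unfolding F1[abs_def] by simp
  qed
  have Fb: "(\<integral>\<rho>. norm (F r \<rho>) \<partial>lborel) \<le> indicator {0<..<s} r * (4 * (B * cosh (k * x)) * S powr (1/4))" for r
  proof (cases "r \<in> {0<..<s}")
    case True
    have I: "has_bochner_integral lborel (\<lambda>\<rho>. (B * cosh (k * x)) * (indicator {0<..<r} \<rho> * (r - \<rho>) powr (- (3/4)))) ((B * cosh (k * x)) * (4 * r powr (1/4)))"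
      using True by (intro has_bochner_integral_mult_right has_bochner_integral_powr_three_quarters) auto
    have "(\<integral>\<rho>. norm (F r \<rho>) \<partial>lborel) \<le> (\<integral>\<rho>. (B * cosh (k * x)) * (indicator {0<..<r} \<rho> * (r - \<rho>) powr (- (3/4))) \<partial>lborel)"
    proof (rule integral_mono[OF integrable_norm[OF Fi]])
      show "integrable lborel (\<lambda>\<rho>. (B * cosh (k * x)) * (indicator {0<..<r} \<rho> * (r - \<rho>) powr (- (3/4))))"
        using I unfolding has_bochner_integral_iff by (rule conjunct1)
      show "norm (F r \<rho>) \<le> (B * cosh (k * x)) * (indicator {0<..<r} \<rho> * (r - \<rho>) powr (- (3/4)))" for \<rho>
        using heat_conv_2_source_bound(1)[of "r - \<rho>" \<rho> x] True s unfolding F1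
        by (cases "\<rho> \<in> {0<..<r}") simp_all
    qed
    also have "\<dots> = (B * cosh (k * x)) * (4 * r powr (1/4))" by (rule has_bochner_integral_integral_eq[OF I])
    also have "\<dots> \<le> (B * cosh (k * x)) * (4 * S powr (1/4))"
      using True s B_nonneg by (intro mult_left_mono powr_mono2) auto
    finally show ?thesis using True by simp
  next
    case False
    then show ?thesis unfolding F1 by simp
  qed
  have "integrable (lborel \<Otimes>\<^sub>M lborel) (case_prod F)"
  proof (rule lborel_pair.Fubini_integrable[OF Fm])
    show "integrable lborel (\<lambda>r. \<integral>\<rho>. norm (case_prod F (r, \<rho>)) \<partial>lborel)"
    proof (rule Bochner_Integration.integrable_bound)
      show "integrable lborel (\<lambda>r. indicator {0<..<s} r * (4 * (B * cosh (k * x)) * S powr (1/4)))"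
        by (intro integrable_mult_left) (use s in \<open>auto simp: integrable_indicator_iff emeasure_lborel_Ioo\<close>)
      have "0 \<le> (\<integral>\<rho>. norm (F r \<rho>) \<partial>lborel)" for r by (rule Bochner_Integration.integral_nonneg) simp
      then show "AE r in lborel. norm (\<integral>\<rho>. norm (case_prod F (r, \<rho>)) \<partial>lborel) \<le>
          norm (indicator {0<..<s} r * (4 * (B * cosh (k * x)) * S powr (1/4)))"
        using order_trans[OF Fb abs_ge_self] by (intro AE_I2) (simp del: abs_mult)
    qed measurable
    show "AE r in lborel. integrable lborel (\<lambda>\<rho>. case_prod F (r, \<rho>))" using Fi by simp
  qed
  from lborel_pair.Fubini_integral[OF this]
  have fub: "(\<integral>\<rho>. (\<integral>r. F r \<rho> \<partial>lborel) \<partial>lborel) = (\<integral>r. (\<integral>\<rho>. F r \<rho> \<partial>lborel) \<partial>lborel)" .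
  have L: "(\<integral>r. F r \<rho> \<partial>lborel) = indicator {0<..<s} \<rho> * heat_conv 0 (s - \<rho>) (h \<rho>) x - indicator {0<..<s} \<rho> * h \<rho> x" for \<rho>
    unfolding F2 using integral_heat_conv_2[of \<rho> s x] s
    by (cases "\<rho> \<in> {0<..<s}") (simp_all add: right_diff_distrib)
  have R: "(\<integral>\<rho>. F r \<rho> \<partial>lborel) = indicator {0<..<s} r * duhamel 2 h r x" for r
    unfolding F1 duhamel_def by simp
  have c1: "continuous_on {0..s} (\<lambda>r. h r x)" and c2: "continuous_on {0..s} (\<lambda>r. duhamel 2 h r x)"
    using s by (auto intro: continuous_on_subset[OF h_cont] continuous_on_subset[OF continuous_on_duhamel_2])
  have int: "integrable lborel (\<lambda>r. indicator {0<..<s} r * f r)" and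
    hk: "(f has_integral (\<integral>r. indicator {0<..<s} r * f r \<partial>lborel)) {0..s}"
    if c: "continuous_on {0..s} f" for f :: "real \<Rightarrow> real"
  proof -
    have i: "set_integrable lborel {0<..<s} f"
      by (rule set_integrable_subset[OF borel_integrable_compact[OF compact_Icc c, folded set_integrable_def]]) auto
    then show "integrable lborel (\<lambda>r. indicator {0<..<s} r * f r)" by (simp add: set_integrable_def)
    from set_borel_integral_eq_integral[OF i]
    have "(f has_integral (LINT r:{0<..<s}|lborel. f r)) {0<..<s}"
      by (simp add: has_integral_iff)
    then show "(f has_integral (\<integral>r. indicator {0<..<s} r * f r \<partial>lborel)) {0..s}"
      by (simp add: has_integral_Icc_iff_Ioo set_lebesgue_integral_def)
  qed
  have "(\<integral>\<rho>. indicator {0<..<s} \<rho> * heat_conv 0 (s - \<rho>) (h \<rho>) x - indicator {0<..<s} \<rho> * h \<rho> x \<partial>lborel) =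
      duhamel 0 h s x - (\<integral>\<rho>. indicator {0<..<s} \<rho> * h \<rho> x \<partial>lborel)"
    unfolding duhamel_def
    by (rule Bochner_Integration.integral_diff[OF duhamel_source_bound(1)[OF s] int[OF c1]]) simp
  with fub have "duhamel 0 h s x = (\<integral>r. indicator {0<..<s} r * h r x \<partial>lborel) + (\<integral>r. indicator {0<..<s} r * duhamel 2 h r x \<partial>lborel)"
    unfolding L R by simp
  with has_integral_add[OF hk[OF c1] hk[OF c2]] show ?thesis by simp
qed

text \<open>The integrand of \<open>duhamel_0_eq_integral\<close> is continuous on the closed
  interval, so the fundamental theorem also yields the one-sided derivatives at both end
  points.\<close>

lemma duhamel_deriv_time:
  assumes s: "s \<in> {0..S}"
  shows "((\<lambda>s. duhamel 0 h s x) has_real_derivative h s x + duhamel 2 h s x) (at s within {0..S})"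
proof -
  have "((\<lambda>s. integral {0..s} (\<lambda>r. h r x + duhamel 2 h r x)) has_real_derivative h s x + duhamel 2 h s x) (at s within {0..S})"
    by (rule integral_has_real_derivative[OF _ s]) (intro continuous_intros h_cont continuous_on_duhamel_2)
  then show ?thesis
    by (rule has_field_derivative_transform_within[of _ _ _ _ 1])
      (use s duhamel_0_eq_integral in \<open>auto intro!: integral_unique\<close>)
qed

end

section \<open>Comparison principle\<close>

lemma second_derivative_at_min:
  fixes f f' :: "real \<Rightarrow> real"
  assumes e: "e > 0"
    and f: "\<And>y. \<bar>y - x\<bar> < e \<Longrightarrow> (f has_real_derivative f' y) (at y)"
    and f': "(f' has_real_derivative l) (at x)"
    and min: "\<And>y. \<bar>y - x\<bar> < e \<Longrightarrow> f x \<le> f y"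
  shows "f' x = 0" "l \<ge> 0"
proof -
  show 0: "f' x = 0"
    using DERIV_local_min[OF f[of x] e] min e by (simp add: abs_minus_commute)
  show "l \<ge> 0"
  proof (rule ccontr)
    assume "\<not> l \<ge> 0"
    then obtain d where d: "d > 0" "\<And>h. 0 < h \<Longrightarrow> h < d \<Longrightarrow> f' x > f' (x + h)"
      using has_real_derivative_neg_dec_right[OF f'] by auto
    define y where "y = x + min d e / 2"
    have y: "x < y" "y - x < d" "y - x < e" using d(1) e by (auto simp: y_def)
    have "\<exists>z>x. z < y \<and> f y - f x = (y - x) * f' z"
    proof (rule MVT2[OF y(1)])
      fix z assume "x \<le> z" "z \<le> y"
      then show "(f has_real_derivative f' z) (at z)" using y by (intro f) auto
    qed
    then obtain z where z: "x < z" "z < y" "f y - f x = (y - x) * f' z" by blast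
    have "f' z < 0" using d(2)[of "z - x"] z y 0 by simp
    then have "(y - x) * f' z < 0" using y by (intro mult_pos_neg) auto
    then have "f y < f x" using z(3) by linarith
    moreover have "f x \<le> f y" using y by (intro min) auto
    ultimately show False by simp
  qed
qed

text \<open>At a negative minimum of \<open>exp (- M s) d + \<eta> cosh (K x)\<close> the differential inequality
  forces \<open>M \<le> K\<^sup>2 + L (1 + K)\<close>.\<close>
lemma parabolic_comparison:
  fixes d ds dx dxx :: "real \<Rightarrow> real \<Rightarrow> real"
  assumes cont: "continuous_on ({0..S} \<times> UNIV) (\<lambda>(s, x). d s x)"
    and ds: "\<And>s x. 0 < s \<Longrightarrow> s \<le> S \<Longrightarrow> ((\<lambda>s. d s x) has_real_derivative ds s x) (at s within {0..S})"
    and dx: "\<And>s x. 0 < s \<Longrightarrow> s \<le> S \<Longrightarrow> (d s has_real_derivative dx s x) (at x)"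
    and dxx: "\<And>s x. 0 < s \<Longrightarrow> s \<le> S \<Longrightarrow> (dx s has_real_derivative dxx s x) (at x)"
    and ineq: "\<And>s x. 0 < s \<Longrightarrow> s \<le> S \<Longrightarrow> dxx s x - L * (\<bar>d s x\<bar> + \<bar>dx s x\<bar>) \<le> ds s x"
    and L: "L \<ge> 0"
    and init: "\<And>x. 0 \<le> d 0 x"
    and growth: "\<And>s x. 0 \<le> s \<Longrightarrow> s \<le> S \<Longrightarrow> \<bar>d s x\<bar> \<le> C * cosh (k * x)"
    and s: "0 \<le> s" "s \<le> S"
  shows "0 \<le> d s x"
proof (rule ccontr)
  assume neg: "\<not> 0 \<le> d s x"
  \<comment> \<open>One more than the growth rate of d, so that the barrier wins at
    infinity.\<close>
  define K where "K = \<bar>k\<bar> + 1"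
  define M where "M = K\<^sup>2 + L * (1 + K) + 1"
  \<comment> \<open>Chosen so that the barrier cancels exactly half of the assumed negative value at
    (s, x), leaving E negative there.\<close>
  define \<eta> where "\<eta> = exp (- M * s) * (- d s x) / (2 * cosh (K * x))"
  define E where "E s x = exp (- M * s) * d s x + \<eta> * cosh (K * x)" for s x
  have K: "K > 0" and M: "M > 0" using L by (auto simp: K_def M_def intro!: add_nonneg_pos)
  have eta: "\<eta> > 0" unfolding \<eta>_def using neg by (intro divide_pos_pos mult_pos_pos) auto
  have E1: "E s x < 0"
  proof -
    have "\<eta> * cosh (K * x) = exp (- M * s) * (- d s x) / 2" by (simp add: \<eta>_def)
    then have "E s x = exp (- M * s) * d s x / 2" by (simp add: E_def)
    moreover have "exp (- M * s) * d s x < 0" using neg by (intro mult_pos_neg) auto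
    ultimately show ?thesis by simp
  qed
  have C: "C \<ge> 0"
  proof -
    have "0 \<le> C * cosh (k * 0)" using growth[of 0 0] s by linarith
    then show ?thesis by simp
  qed
  \<comment> \<open>For |y| \<ge> R already exp |y| exceeds 2 C / \<eta>, which puts the barrier
    above the growth bound; |x| is included so that the negative point lies in the
    rectangle.\<close>
  define R where "R = \<bar>x\<bar> + 1 + 2 * C / \<eta>"
  have far: "0 \<le> E s' y" if s': "0 \<le> s'" "s' \<le> S" and y: "R \<le> \<bar>y\<bar>" for s' y
  proof -
    have "2 * C / \<eta> \<le> \<bar>y\<bar>" using y unfolding R_def by linarith
    also have "\<dots> \<le> exp \<bar>y\<bar>" using exp_ge_add_one_self[of "\<bar>y\<bar>"] by linarith
    finally have 1: "2 * C \<le> \<eta> * exp \<bar>y\<bar>" using eta by (simp add: field_simps)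
    have "cosh (k * y) \<le> exp \<bar>k * y\<bar>" using cosh_shift_le[of k 0 y] by simp
    then have "C * cosh (k * y) \<le> C * exp (\<bar>k\<bar> * \<bar>y\<bar>)" using C by (intro mult_left_mono) (auto simp: abs_mult)
    also have "\<dots> \<le> (\<eta> * exp \<bar>y\<bar> / 2) * exp (\<bar>k\<bar> * \<bar>y\<bar>)" using 1 by (intro mult_right_mono) auto
    also have "\<dots> = \<eta> * (exp (K * \<bar>y\<bar>) / 2)" by (simp add: K_def distrib_right exp_add)
    also have "exp (K * \<bar>y\<bar>) / 2 \<le> cosh (K * \<bar>y\<bar>)" by (simp add: cosh_def)
    also have "cosh (K * \<bar>y\<bar>) = cosh (K * y)" by (auto simp: abs_if)
    finally have 2: "C * cosh (k * y) \<le> \<eta> * cosh (K * y)" using eta by simp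
    have "\<bar>exp (- M * s') * d s' y\<bar> \<le> 1 * \<bar>d s' y\<bar>"
      unfolding abs_mult using M s' by (intro mult_right_mono) auto
    also have "\<dots> \<le> C * cosh (k * y)" using growth[OF s', of y] by simp
    finally show ?thesis using 2 unfolding E_def by linarith
  qed
  have "compact ({0..S} \<times> {-R..R})" by (intro compact_Times compact_Icc)
  moreover have xin: "(s, x) \<in> {0..S} \<times> {-R..R}"
  proof -
    have "0 \<le> 2 * C / \<eta>" using eta C by simp
    then have "\<bar>x\<bar> \<le> R" unfolding R_def by linarith
    then show ?thesis using s by (auto simp: abs_le_iff)
  qed
  moreover have "continuous_on ({0..S} \<times> {-R..R}) (\<lambda>(s, x). E s x)"
  proof -
    have "continuous_on ({0..S} \<times> {-R..R}) (\<lambda>z. exp (- M * fst z) * (case z of (s, x) \<Rightarrow> d s x) + \<eta> * cosh (K * snd z))"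
      by (intro continuous_intros continuous_on_subset[OF cont]) auto
    then show ?thesis by (simp add: E_def split_def)
  qed
  ultimately obtain z where z: "z \<in> {0..S} \<times> {-R..R}"
    "\<And>y. y \<in> {0..S} \<times> {-R..R} \<Longrightarrow> (\<lambda>(s, x). E s x) z \<le> (\<lambda>(s, x). E s x) y"
    using continuous_attains_inf[of "{0..S} \<times> {-R..R}" "\<lambda>(s, x). E s x"] by blast
  obtain s0 x0 where z0: "z = (s0, x0)" by (cases z)
  have min: "E s0 x0 \<le> E s' y" if "0 \<le> s'" "s' \<le> S" "\<bar>y\<bar> \<le> R" for s' y
    using z(2)[of "(s', y)"] that by (auto simp: z0 abs_le_iff)
  have E0: "E s0 x0 < 0" using z(2)[OF xin] E1 by (simp add: z0)
  have s0: "0 \<le> s0" "s0 \<le> S" "\<bar>x0\<bar> \<le> R" using z(1) by (auto simp: z0 abs_le_iff)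
  have "s0 \<noteq> 0"
  proof
    assume "s0 = 0"
    then have "0 \<le> E s0 x0" using init[of x0] eta by (simp add: E_def)
    with E0 show False by simp
  qed
  with s0 have s0': "0 < s0" by simp
  have x0: "\<bar>x0\<bar> < R" using far[of s0 x0] s0 E0 by force
  define q where "q = exp (- M * s0)"
  have q: "q > 0" by (simp add: q_def)
  have Ex: "(E s0 has_real_derivative q * dx s0 y + \<eta> * (K * sinh (K * y))) (at y)" for y
    unfolding E_def q_def
    by (auto intro!: derivative_eq_intros dx[OF s0' s0(2)] simp: ac_simps)
  have Exx: "((\<lambda>y. q * dx s0 y + \<eta> * (K * sinh (K * y))) has_real_derivative q * dxx s0 x0 + \<eta> * (K * (K * cosh (K * x0)))) (at x0)"
    by (auto intro!: derivative_eq_intros dxx[OF s0' s0(2)] simp: ac_simps)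
  have near: "E s0 x0 \<le> E s0 y" if "\<bar>y - x0\<bar> < R - \<bar>x0\<bar>" for y
    using that s0 by (intro min) auto
  have "0 < R - \<bar>x0\<bar>" using x0 by simp
  from second_derivative_at_min[OF this Ex Exx near]
  have D1: "q * dx s0 x0 = - (\<eta> * (K * sinh (K * x0)))" and D2: "- (\<eta> * (K * (K * cosh (K * x0)))) \<le> q * dxx s0 x0"
    by auto
  have Es: "((\<lambda>s. E s x0) has_real_derivative q * (ds s0 x0 - M * d s0 x0)) (at s0 within {0..S})"
    unfolding E_def q_def
    by (auto intro!: derivative_eq_intros ds[OF s0' s0(2)] simp: algebra_simps)
  \<comment> \<open>The minimum may sit at the final time, so it is compared only with earlier
    times; this fixes the sign of the one-sided time derivative.\<close>
  have D3: "q * (ds s0 x0 - M * d s0 x0) \<le> 0"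
  proof (rule ccontr)
    assume "\<not> ?thesis"
    then obtain e where e: "e > 0" "\<And>h. 0 < h \<Longrightarrow> s0 - h \<in> {0..S} \<Longrightarrow> h < e \<Longrightarrow> E (s0 - h) x0 < E s0 x0"
      using has_real_derivative_pos_inc_left[OF Es] by auto
    define h where "h = min e s0 / 2"
    have h: "0 < h" "h < e" "h \<le> s0" using e(1) s0' by (auto simp: h_def min_def)
    then have "E (s0 - h) x0 < E s0 x0" using s0 by (intro e(2)) auto
    moreover have "E s0 x0 \<le> E (s0 - h) x0" using h s0 by (intro min) auto
    ultimately show False by simp
  qed
  define \<delta> where "\<delta> = - (q * d s0 x0)"
  have del: "\<eta> * cosh (K * x0) < \<delta>" using E0 by (simp add: \<delta>_def E_def q_def)
  have "0 < \<eta> * cosh (K * x0)" using eta by simp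
  with del have del0: "\<delta> > 0" by linarith
  have a1: "q * \<bar>d s0 x0\<bar> = \<delta>"
  proof -
    have "d s0 x0 < 0" using del0 q by (simp add: \<delta>_def mult_less_0_iff)
    then show ?thesis by (simp add: \<delta>_def)
  qed
  have "\<bar>sinh (K * x0)\<bar> \<le> cosh (K * x0)" by (simp add: sinh_def cosh_def abs_le_iff field_simps)
  then have "\<eta> * \<bar>sinh (K * x0)\<bar> \<le> \<eta> * cosh (K * x0)" using eta by (intro mult_left_mono) auto
  then have sh: "\<eta> * \<bar>sinh (K * x0)\<bar> \<le> \<delta>" using del by linarith
  have a2: "q * \<bar>dx s0 x0\<bar> \<le> K * \<delta>"
  proof -
    have "q * \<bar>dx s0 x0\<bar> = \<bar>q * dx s0 x0\<bar>" using q by (simp add: abs_mult)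
    also have "\<dots> = K * (\<eta> * \<bar>sinh (K * x0)\<bar>)" unfolding D1 using eta K by (simp add: abs_mult)
    also have "\<dots> \<le> K * \<delta>" using sh K by (intro mult_left_mono) auto
    finally show ?thesis .
  qed
  have a3: "- (K\<^sup>2 * \<delta>) \<le> q * dxx s0 x0"
  proof -
    have "K\<^sup>2 * (\<eta> * cosh (K * x0)) \<le> K\<^sup>2 * \<delta>" using del by (intro mult_left_mono) auto
    then show ?thesis using D2 by (simp add: power2_eq_square ac_simps)
  qed
  have "q * (dxx s0 x0 - L * (\<bar>d s0 x0\<bar> + \<bar>dx s0 x0\<bar>)) \<le> q * ds s0 x0"
    using ineq[OF s0' s0(2)] q by (intro mult_left_mono) auto
  then have i: "q * dxx s0 x0 - L * (q * \<bar>d s0 x0\<bar> + q * \<bar>dx s0 x0\<bar>) \<le> q * ds s0 x0"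
    by (simp add: algebra_simps)
  have "L * (q * \<bar>d s0 x0\<bar> + q * \<bar>dx s0 x0\<bar>) \<le> L * (\<delta> + K * \<delta>)"
    using a1 a2 L by (intro mult_left_mono) auto
  with i a3 have "- (K\<^sup>2 * \<delta>) - L * (\<delta> + K * \<delta>) \<le> q * ds s0 x0" by linarith
  moreover have "q * ds s0 x0 \<le> - (M * \<delta>)" using D3 by (simp add: \<delta>_def algebra_simps)
  ultimately have "M * \<delta> \<le> K\<^sup>2 * \<delta> + L * (\<delta> + K * \<delta>)" by linarith
  then have "\<delta> \<le> 0" by (simp add: M_def algebra_simps)
  with del0 show False by simp
qed

text \<open>The geometric mean of a sup bound and a Lipschitz bound gives Hoelder exponent
  1/2.\<close>

lemma sqrt_interpolation:
  fixes u A m d :: real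
  assumes "\<bar>u\<bar> \<le> A" "\<bar>u\<bar> \<le> A * (m * d)" "m \<ge> 0" "d \<ge> 0"
  shows "\<bar>u\<bar> \<le> A * sqrt m * sqrt d"
proof -
  have A: "A \<ge> 0" using assms(1) by linarith
  have "\<bar>u\<bar> * \<bar>u\<bar> \<le> A * (A * (m * d))" using assms A by (intro mult_mono) auto
  then have "sqrt (\<bar>u\<bar> * \<bar>u\<bar>) \<le> sqrt (A * A * (m * d))" by (intro real_sqrt_le_mono) (simp add: mult.assoc)
  moreover have "sqrt (A * A * (m * d)) = A * sqrt m * sqrt d"
    unfolding real_sqrt_mult[of "A * A"] real_sqrt_mult[of m] using A by simp
  moreover have "sqrt (\<bar>u\<bar> * \<bar>u\<bar>) = \<bar>u\<bar>" by (simp flip: power2_eq_square)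
  ultimately show ?thesis by simp
qed

lemma exp_holder:
  fixes k x y :: real
  shows "\<bar>exp (- k * x) - exp (- k * y)\<bar> \<le> 2 * sqrt \<bar>k\<bar> * sqrt \<bar>x - y\<bar> * (cosh (k * x) + cosh (k * y))"
proof -
  have e: "exp (- k * z) \<le> 2 * cosh (k * z)" for z by (simp add: cosh_def)
  define A where "A = 2 * (cosh (k * x) + cosh (k * y))"
  have 1: "\<bar>exp (- k * x) - exp (- k * y)\<bar> \<le> A"
  proof -
    have "\<bar>exp (- k * x) - exp (- k * y)\<bar> \<le> \<bar>exp (- k * x)\<bar> + \<bar>exp (- k * y)\<bar>" by (rule abs_triangle_ineq4)
    also have "\<dots> = exp (- k * x) + exp (- k * y)" by simp
    also have "\<dots> \<le> 2 * cosh (k * x) + 2 * cosh (k * y)" by (intro add_mono e)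
    finally show ?thesis unfolding A_def by (simp only: distrib_left)
  qed
  have "norm (exp (- k * x) - exp (- k * y)) \<le> (\<bar>k\<bar> * A) * norm (x - y)"
  proof (rule field_differentiable_bound[where S = "closed_segment x y" and f' = "\<lambda>z. - k * exp (- k * z)"])
    show "((\<lambda>z. exp (- k * z)) has_field_derivative - k * exp (- k * z)) (at z within closed_segment x y)" for z
      by (auto intro!: derivative_eq_intros)
    show "norm (- k * exp (- k * z)) \<le> \<bar>k\<bar> * A" if "z \<in> closed_segment x y" for z
    proof -
      have "cosh (k * z) \<le> cosh (k * x) + cosh (k * y)"
        using that cosh_between[of x z y k] cosh_between[of y z x k]
        by (auto simp: closed_segment_eq_real_ivl add.commute split: if_splits)
      then have "2 * cosh (k * z) \<le> A" unfolding A_def by (intro mult_left_mono) auto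
      with e[of z] have "exp (- k * z) \<le> A" by (rule order_trans)
      then show ?thesis by (simp add: abs_mult mult_left_mono)
    qed
  qed auto
  then have 2: "\<bar>exp (- k * x) - exp (- k * y)\<bar> \<le> A * (\<bar>k\<bar> * \<bar>x - y\<bar>)" by (simp add: ac_simps)
  from sqrt_interpolation[OF 1 2] show ?thesis by (simp add: A_def algebra_simps)
qed

lemma continuous_on_pair_holder:
  fixes u :: "real \<Rightarrow> real \<Rightarrow> real"
  assumes x: "\<And>s x y. s \<in> I \<Longrightarrow> \<bar>u s x - u s y\<bar> \<le> A * sqrt \<bar>x - y\<bar> * (cosh (k * x) + cosh (k * y))"
    and t: "\<And>s t x. s \<in> I \<Longrightarrow> t \<in> I \<Longrightarrow> \<bar>u s x - u t x\<bar> \<le> A * cosh (k * x) * \<bar>s - t\<bar> powr (1/4)"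
  shows "continuous_on (I \<times> UNIV) (\<lambda>(s, x). u s x)"
  unfolding continuous_on
proof (intro ballI, clarify)
  fix s x :: real assume s: "s \<in> I"
  define g where "g z = A * sqrt \<bar>snd z - x\<bar> * (cosh (k * snd z) + cosh (k * x)) + A * cosh (k * x) * \<bar>fst z - s\<bar> powr (1/4)" for z :: "real \<times> real"
  have "(g \<longlongrightarrow> A * sqrt \<bar>x - x\<bar> * (cosh (k * x) + cosh (k * x)) + A * cosh (k * x) * \<bar>s - s\<bar> powr (1/4)) (at (s, x) within I \<times> UNIV)"
    unfolding g_def
    by (intro tendsto_intros tendsto_powr' tendsto_fst[of id, simplified] tendsto_snd[of id, simplified])
      (auto simp: id_def intro!: tendsto_eq_intros)
  then have g0: "(g \<longlongrightarrow> 0) (at (s, x) within I \<times> UNIV)" by simp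
  have "((\<lambda>z. (\<lambda>(s, x). u s x) z - u s x) \<longlongrightarrow> 0) (at (s, x) within I \<times> UNIV)"
  proof (rule Lim_null_comparison[OF _ g0])
    show "\<forall>\<^sub>F z in at (s, x) within I \<times> UNIV. norm ((\<lambda>(s, x). u s x) z - u s x) \<le> g z"
      unfolding eventually_at
    proof (intro exI[of _ 1] conjI ballI impI)
      fix z :: "real \<times> real" assume "z \<in> I \<times> UNIV"
      then obtain s' x' where z: "z = (s', x')" "s' \<in> I" by (cases z) auto
      show "norm ((\<lambda>(s, x). u s x) z - u s x) \<le> g z"
        using x[OF z(2), of x' x] t[OF z(2) s, of x] by (simp add: z(1) g_def)
    qed simp
  qed
  then show "((\<lambda>(s, x). u s x) \<longlongrightarrow> u s x) (at (s, x) within I \<times> UNIV)"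
    by (rule LIM_zero_cancel)
qed

section \<open>Mild solutions\<close>

text \<open>The solution is parametrised by its source h, which is the unknown of the later fixed
  point identity. The first term is the explicit heat evolution of the datum
  \<open>exp (- k x)\<close>, so no convolution of initial data occurs and its regularity down to s
  = 0 is evident.\<close>

definition sol :: "real \<Rightarrow> (real \<Rightarrow> real \<Rightarrow> real) \<Rightarrow> real \<Rightarrow> real \<Rightarrow> real" where
  "sol k h s x = exp (k\<^sup>2 * s) * exp (- k * x) + duhamel 0 h s x"

definition sol_x :: "real \<Rightarrow> (real \<Rightarrow> real \<Rightarrow> real) \<Rightarrow> real \<Rightarrow> real \<Rightarrow> real" where
  "sol_x k h s x = - k * (exp (k\<^sup>2 * s) * exp (- k * x)) + duhamel 1 h s x"

definition sol_xx :: "real \<Rightarrow> (real \<Rightarrow> real \<Rightarrow> real) \<Rightarrow> real \<Rightarrow> real \<Rightarrow> real" where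
  "sol_xx k h s x = k\<^sup>2 * (exp (k\<^sup>2 * s) * exp (- k * x)) + duhamel 2 h s x"

text \<open>The argument of the power nonlinearity; in the original variables it is -w_y up to a
  positive factor. The nonlinearity sees the solution only through it.\<close>

definition flux :: "real \<Rightarrow> real \<Rightarrow> (real \<Rightarrow> real \<Rightarrow> real) \<Rightarrow> real \<Rightarrow> real \<Rightarrow> real" where
  "flux a k h s x = a * sol k h s x - sol_x k h s x"

lemma duhamel_diff:
  assumes "heat_source S k C f" "heat_source S k C' g" and s: "0 \<le> s" "s \<le> S" and n: "n \<le> 1"
  shows "duhamel n f s x - duhamel n g s x = duhamel n (\<lambda>r \<xi>. f r \<xi> - g r \<xi>) s x"
proof -
  interpret f: heat_source S k C f by fact
  interpret g: heat_source S k C' g by fact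
  have "heat_conv n (s - r) (f r) x - heat_conv n (s - r) (g r) x = heat_conv n (s - r) (\<lambda>\<xi>. f r \<xi> - g r \<xi>) x"
    if "r \<in> {0<..<s}" for r
  proof -
    have "integrable lborel (\<lambda>\<xi>. heat n (s - r) (x - \<xi>) * f r \<xi>)"
      using that s n by (intro heat_conv_integrable[OF _ f.h_bound]) auto
    moreover have "integrable lborel (\<lambda>\<xi>. heat n (s - r) (x - \<xi>) * g r \<xi>)"
      using that s n by (intro heat_conv_integrable[OF _ g.h_bound]) auto
    ultimately show ?thesis
      unfolding heat_conv_def by (subst Bochner_Integration.integral_diff[symmetric]) (auto simp: right_diff_distrib)
  qed
  then have "indicator {0<..<s} r * heat_conv n (s - r) (f r) x - indicator {0<..<s} r * heat_conv n (s - r) (g r) x =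
      indicator {0<..<s} r * heat_conv n (s - r) (\<lambda>\<xi>. f r \<xi> - g r \<xi>) x" for r
    by (cases "r \<in> {0<..<s}") auto
  then show ?thesis
    unfolding duhamel_def
    using Bochner_Integration.integral_diff[OF f.duhamel_source_bound(1)[OF s n] g.duhamel_source_bound(1)[OF s n], of x x]
    by simp
qed

section \<open>Weighted Hoelder estimates for mild solutions\<close>

context heat_source
begin

text \<open>Large enough for the sup, space and time estimates of both \<open>sol\<close> and
  \<open>sol_x\<close>. It is determined by S, k and C alone, so all sources with the same weighted
  sup bound share it.\<close>

definition A where
  "A = (1 + \<bar>k\<bar>) * exp (k\<^sup>2 * S) * (2 + 2 * sqrt \<bar>k\<bar> + 2 * k\<^sup>2 * (1 + S)) +
     12 * D * S powr (1/4) + 2 * D * (1 + S) + 4 * D * (1 + S) * S powr (1/4)"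

lemma A_nonneg: "A \<ge> 0"
  unfolding A_def using D_nonneg S_pos by (intro add_nonneg_nonneg mult_nonneg_nonneg) auto

lemma exp_time_holder:
  assumes s: "0 \<le> s" "s \<le> S" and t: "0 \<le> t" "t \<le> S"
  shows "\<bar>exp (k\<^sup>2 * s) - exp (k\<^sup>2 * t)\<bar> \<le> exp (k\<^sup>2 * S) * (k\<^sup>2 * (1 + S)) * \<bar>s - t\<bar> powr (1/4)"
proof -
  have "norm (exp (k\<^sup>2 * s) - exp (k\<^sup>2 * t)) \<le> (k\<^sup>2 * exp (k\<^sup>2 * S)) * norm (s - t)"
  proof (rule field_differentiable_bound[where S = "{0..S}" and f' = "\<lambda>z. k\<^sup>2 * exp (k\<^sup>2 * z)"])
    show "((\<lambda>z. exp (k\<^sup>2 * z)) has_field_derivative k\<^sup>2 * exp (k\<^sup>2 * z)) (at z within {0..S})" for z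
      by (auto intro!: derivative_eq_intros)
    show "norm (k\<^sup>2 * exp (k\<^sup>2 * z)) \<le> k\<^sup>2 * exp (k\<^sup>2 * S)" if "z \<in> {0..S}" for z
      using that by (simp add: mult_left_mono)
  qed (use s t in auto)
  also have "norm (s - t) \<le> (1 + S) * \<bar>s - t\<bar> powr (1/4)"
    using powr_lower_exponent[of "\<bar>s - t\<bar>" S "1/4" 1] s t by (cases "s = t") auto
  then have "(k\<^sup>2 * exp (k\<^sup>2 * S)) * norm (s - t) \<le> (k\<^sup>2 * exp (k\<^sup>2 * S)) * ((1 + S) * \<bar>s - t\<bar> powr (1/4))"
    by (intro mult_left_mono) auto
  finally show ?thesis by (simp add: ac_simps)
qed

lemma exp_part_estimates:
  assumes s: "0 \<le> s" "s \<le> S"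
  shows "\<bar>exp (k\<^sup>2 * s) * exp (- k * x)\<bar> \<le> exp (k\<^sup>2 * S) * 2 * cosh (k * x)"
    and "\<bar>exp (k\<^sup>2 * s) * exp (- k * x) - exp (k\<^sup>2 * s) * exp (- k * y)\<bar> \<le>
      exp (k\<^sup>2 * S) * (2 * sqrt \<bar>k\<bar>) * (sqrt \<bar>x - y\<bar> * (cosh (k * x) + cosh (k * y)))"
    and "0 \<le> t \<Longrightarrow> t \<le> S \<Longrightarrow> \<bar>exp (k\<^sup>2 * s) * exp (- k * x) - exp (k\<^sup>2 * t) * exp (- k * x)\<bar> \<le>
      exp (k\<^sup>2 * S) * (2 * k\<^sup>2 * (1 + S)) * (cosh (k * x) * \<bar>s - t\<bar> powr (1/4))"
proof -
  have es: "exp (k\<^sup>2 * s) \<le> exp (k\<^sup>2 * S)" using s by (simp add: mult_left_mono)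
  have ex: "exp (- k * x) \<le> 2 * cosh (k * x)" by (simp add: cosh_def)
  have "exp (k\<^sup>2 * s) * exp (- k * x) \<le> exp (k\<^sup>2 * S) * (2 * cosh (k * x))"
    by (intro mult_mono es ex) auto
  then show "\<bar>exp (k\<^sup>2 * s) * exp (- k * x)\<bar> \<le> exp (k\<^sup>2 * S) * 2 * cosh (k * x)" by simp
  have "\<bar>exp (k\<^sup>2 * s) * exp (- k * x) - exp (k\<^sup>2 * s) * exp (- k * y)\<bar> = exp (k\<^sup>2 * s) * \<bar>exp (- k * x) - exp (- k * y)\<bar>"
    by (simp add: abs_mult flip: right_diff_distrib)
  also have "\<dots> \<le> exp (k\<^sup>2 * S) * (2 * sqrt \<bar>k\<bar> * sqrt \<bar>x - y\<bar> * (cosh (k * x) + cosh (k * y)))"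
    by (intro mult_mono es exp_holder) auto
  finally show "\<bar>exp (k\<^sup>2 * s) * exp (- k * x) - exp (k\<^sup>2 * s) * exp (- k * y)\<bar> \<le>
      exp (k\<^sup>2 * S) * (2 * sqrt \<bar>k\<bar>) * (sqrt \<bar>x - y\<bar> * (cosh (k * x) + cosh (k * y)))" by (simp add: mult.assoc)
  assume t: "0 \<le> t" "t \<le> S"
  have "\<bar>exp (k\<^sup>2 * s) * exp (- k * x) - exp (k\<^sup>2 * t) * exp (- k * x)\<bar> = \<bar>exp (k\<^sup>2 * s) - exp (k\<^sup>2 * t)\<bar> * exp (- k * x)"
    by (simp add: abs_mult flip: left_diff_distrib)
  also have "\<dots> \<le> (exp (k\<^sup>2 * S) * (k\<^sup>2 * (1 + S)) * \<bar>s - t\<bar> powr (1/4)) * (2 * cosh (k * x))"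
    using S_pos by (intro mult_mono exp_time_holder s t ex) auto
  finally show "\<bar>exp (k\<^sup>2 * s) * exp (- k * x) - exp (k\<^sup>2 * t) * exp (- k * x)\<bar> \<le>
      exp (k\<^sup>2 * S) * (2 * k\<^sup>2 * (1 + S)) * (cosh (k * x) * \<bar>s - t\<bar> powr (1/4))" by (simp add: ac_simps)
qed

text \<open>One proof for two functions: \<kappa> = 1 with n = 0 is \<open>sol\<close>, \<kappa> = -
  k with n = 1 is \<open>sol_x\<close>.\<close>

lemma exp_plus_duhamel_estimates:
  assumes s: "0 \<le> s" "s \<le> S" and n: "n \<le> 1" and \<kappa>: "\<bar>\<kappa>\<bar> \<le> 1 + \<bar>k\<bar>"
  defines "u \<equiv> \<lambda>s x. \<kappa> * (exp (k\<^sup>2 * s) * exp (- k * x)) + duhamel n h s x"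
  shows "\<bar>u s x\<bar> \<le> A * cosh (k * x)"
    and "\<bar>u s x - u s y\<bar> \<le> A * sqrt \<bar>x - y\<bar> * (cosh (k * x) + cosh (k * y))"
    and "0 \<le> t \<Longrightarrow> t \<le> S \<Longrightarrow> \<bar>u s x - u t x\<bar> \<le> A * cosh (k * x) * \<bar>s - t\<bar> powr (1/4)"
proof -
  define E where "E = exp (k\<^sup>2 * S)"
  define D1 where "D1 = D * S powr (1/4)"
  define D2 where "D2 = D * (1 + S)"
  have nn: "E \<ge> 0" "D1 \<ge> 0" "D2 \<ge> 0" "D2 * S powr (1/4) \<ge> 0" using D_nonneg S_pos by (auto simp: E_def D1_def D2_def)
  have A: "A = (1 + \<bar>k\<bar>) * (E * 2) + (1 + \<bar>k\<bar>) * (E * (2 * sqrt \<bar>k\<bar>)) + (1 + \<bar>k\<bar>) * (E * (2 * k\<^sup>2 * (1 + S)))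
      + 12 * D1 + 2 * D2 + 4 * (D2 * S powr (1/4))"
    unfolding A_def E_def D1_def D2_def by (simp add: algebra_simps)
  have p: "0 \<le> (1 + \<bar>k\<bar>) * (E * 2)" "0 \<le> (1 + \<bar>k\<bar>) * (E * (2 * sqrt \<bar>k\<bar>))" "0 \<le> (1 + \<bar>k\<bar>) * (E * (2 * k\<^sup>2 * (1 + S)))"
    using nn S_pos by auto
  have comb: "\<bar>\<kappa> * v + w\<bar> \<le> A * W" if "\<bar>v\<bar> \<le> e * W" "\<bar>w\<bar> \<le> d * W" "(1 + \<bar>k\<bar>) * e + d \<le> A" "0 \<le> W" "0 \<le> e" for v w e d W
  proof -
    have "\<bar>\<kappa> * v + w\<bar> \<le> \<bar>\<kappa>\<bar> * \<bar>v\<bar> + \<bar>w\<bar>" by (metis abs_mult abs_triangle_ineq)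
    also have "\<dots> \<le> (1 + \<bar>k\<bar>) * (e * W) + d * W" using that \<kappa> by (intro add_mono mult_mono) auto
    also have "\<dots> = ((1 + \<bar>k\<bar>) * e + d) * W" by (simp add: algebra_simps)
    also have "\<dots> \<le> A * W" using that by (intro mult_right_mono) auto
    finally show ?thesis .
  qed
  note ee = exp_part_estimates[OF s, folded E_def]
  show "\<bar>u s x\<bar> \<le> A * cosh (k * x)"
    unfolding u_def
  proof (rule comb[OF ee(1)])
    have "s powr (1/4) \<le> S powr (1/4)" using s by (intro powr_mono2) auto
    then have "4 * D2 * s powr (1/4) \<le> 4 * D2 * S powr (1/4)" using nn by (intro mult_left_mono) auto
    then have "4 * D2 * s powr (1/4) * cosh (k * x) \<le> 4 * D2 * S powr (1/4) * cosh (k * x)" by (intro mult_right_mono) auto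
    then show "\<bar>duhamel n h s x\<bar> \<le> (4 * (D2 * S powr (1/4))) * cosh (k * x)"
      using duhamel_source_bound(2)[OF s n, of x] by (simp add: D2_def ac_simps)
    show "(1 + \<bar>k\<bar>) * (E * 2) + 4 * (D2 * S powr (1/4)) \<le> A" unfolding A using p nn by linarith
  qed (use nn in auto)
  have "u s x - u s y = \<kappa> * (exp (k\<^sup>2 * s) * exp (- k * x) - exp (k\<^sup>2 * s) * exp (- k * y)) + (duhamel n h s x - duhamel n h s y)"
    by (simp add: u_def algebra_simps)
  also have "\<bar>\<dots>\<bar> \<le> A * (sqrt \<bar>x - y\<bar> * (cosh (k * x) + cosh (k * y)))"
  proof (rule comb[OF ee(2)])
    show "\<bar>duhamel n h s x - duhamel n h s y\<bar> \<le> (4 * D1) * (sqrt \<bar>x - y\<bar> * (cosh (k * x) + cosh (k * y)))"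
      using duhamel_holder_space[OF s n, of x y] by (simp add: D1_def ac_simps)
    show "(1 + \<bar>k\<bar>) * (E * (2 * sqrt \<bar>k\<bar>)) + 4 * D1 \<le> A" unfolding A using p nn by linarith
  qed (use nn in auto)
  finally show "\<bar>u s x - u s y\<bar> \<le> A * sqrt \<bar>x - y\<bar> * (cosh (k * x) + cosh (k * y))" by (simp add: mult.assoc)
  assume t: "0 \<le> t" "t \<le> S"
  have "u s x - u t x = \<kappa> * (exp (k\<^sup>2 * s) * exp (- k * x) - exp (k\<^sup>2 * t) * exp (- k * x)) + (duhamel n h s x - duhamel n h t x)"
    by (simp add: u_def algebra_simps)
  also have "\<bar>\<dots>\<bar> \<le> A * (cosh (k * x) * \<bar>s - t\<bar> powr (1/4))"
  proof (rule comb[OF ee(3)[OF t]])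
    show "\<bar>duhamel n h s x - duhamel n h t x\<bar> \<le> (8 * D1 + 2 * D2) * (cosh (k * x) * \<bar>s - t\<bar> powr (1/4))"
      using duhamel_holder_time[OF s t n, of x] by (simp add: D1_def D2_def algebra_simps)
    show "(1 + \<bar>k\<bar>) * (E * (2 * k\<^sup>2 * (1 + S))) + (8 * D1 + 2 * D2) \<le> A" unfolding A using p nn by linarith
  qed (use nn S_pos in auto)
  finally show "\<bar>u s x - u t x\<bar> \<le> A * cosh (k * x) * \<bar>s - t\<bar> powr (1/4)" by (simp add: mult.assoc)
qed

lemma sol_estimates:
  assumes s: "0 \<le> s" "s \<le> S"
  shows "\<bar>sol k h s x\<bar> \<le> A * cosh (k * x)"
    and "\<bar>sol k h s x - sol k h s y\<bar> \<le> A * sqrt \<bar>x - y\<bar> * (cosh (k * x) + cosh (k * y))"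
    and "0 \<le> t \<Longrightarrow> t \<le> S \<Longrightarrow> \<bar>sol k h s x - sol k h t x\<bar> \<le> A * cosh (k * x) * \<bar>s - t\<bar> powr (1/4)"
  using exp_plus_duhamel_estimates[OF s, of 0 1] by (simp_all add: sol_def)

lemma sol_x_estimates:
  assumes s: "0 \<le> s" "s \<le> S"
  shows "\<bar>sol_x k h s x\<bar> \<le> A * cosh (k * x)"
    and "\<bar>sol_x k h s x - sol_x k h s y\<bar> \<le> A * sqrt \<bar>x - y\<bar> * (cosh (k * x) + cosh (k * y))"
    and "0 \<le> t \<Longrightarrow> t \<le> S \<Longrightarrow> \<bar>sol_x k h s x - sol_x k h t x\<bar> \<le> A * cosh (k * x) * \<bar>s - t\<bar> powr (1/4)"
  using exp_plus_duhamel_estimates[OF s, of 1 "- k"] by (simp_all add: sol_x_def)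

lemma flux_estimates:
  assumes s: "0 \<le> s" "s \<le> S"
  shows "\<bar>flux a k h s x\<bar> \<le> (\<bar>a\<bar> + 1) * A * cosh (k * x)"
    and "\<bar>flux a k h s x - flux a k h s y\<bar> \<le> (\<bar>a\<bar> + 1) * A * sqrt \<bar>x - y\<bar> * (cosh (k * x) + cosh (k * y))"
    and "0 \<le> t \<Longrightarrow> t \<le> S \<Longrightarrow> \<bar>flux a k h s x - flux a k h t x\<bar> \<le> (\<bar>a\<bar> + 1) * A * cosh (k * x) * \<bar>s - t\<bar> powr (1/4)"
proof -
  have c: "\<bar>a * u - v\<bar> \<le> (\<bar>a\<bar> + 1) * w" if "\<bar>u\<bar> \<le> w" "\<bar>v\<bar> \<le> w" for u v w :: real
  proof -
    have "\<bar>a * u - v\<bar> \<le> \<bar>a\<bar> * \<bar>u\<bar> + \<bar>v\<bar>" by (metis abs_mult abs_triangle_ineq4)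
    also have "\<dots> \<le> \<bar>a\<bar> * w + w" using that by (intro add_mono mult_left_mono) auto
    finally show ?thesis by (simp add: algebra_simps)
  qed
  have d: "a * u - v - (a * u' - v') = a * (u - u') - (v - v')" for u v u' v' :: real by (simp add: algebra_simps)
  show "\<bar>flux a k h s x\<bar> \<le> (\<bar>a\<bar> + 1) * A * cosh (k * x)"
    using c[OF sol_estimates(1)[OF s] sol_x_estimates(1)[OF s]] by (simp add: flux_def mult.assoc)
  show "\<bar>flux a k h s x - flux a k h s y\<bar> \<le> (\<bar>a\<bar> + 1) * A * sqrt \<bar>x - y\<bar> * (cosh (k * x) + cosh (k * y))"
    using c[OF sol_estimates(2)[OF s] sol_x_estimates(2)[OF s]] unfolding flux_def d by (simp add: mult.assoc)
  show "\<bar>flux a k h s x - flux a k h t x\<bar> \<le> (\<bar>a\<bar> + 1) * A * cosh (k * x) * \<bar>s - t\<bar> powr (1/4)" if "0 \<le> t" "t \<le> S"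
    using c[OF sol_estimates(3)[OF s that] sol_x_estimates(3)[OF s that]] unfolding flux_def d by (simp add: mult.assoc)
qed

lemma continuous_on_sol: "continuous_on ({0..S} \<times> UNIV) (\<lambda>(s, x). sol k h s x)"
  by (rule continuous_on_pair_holder[where A = A]) (use sol_estimates in auto)

lemma continuous_on_flux: "continuous_on ({0..S} \<times> UNIV) (\<lambda>(s, x). flux a k h s x)"
  by (rule continuous_on_pair_holder[where A = "(\<bar>a\<bar> + 1) * A"]) (use flux_estimates in auto)

lemma sol_deriv_space:
  assumes s: "0 \<le> s" "s \<le> S"
  shows "(sol k h s has_real_derivative sol_x k h s x) (at x)"
  unfolding sol_def[abs_def] sol_x_def
  by (auto intro!: derivative_eq_intros duhamel_0_deriv_space[OF s])

end

context holder_source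
begin

lemma sol_x_deriv_space:
  assumes s: "0 \<le> s" "s \<le> S"
  shows "(sol_x k h s has_real_derivative sol_xx k h s x) (at x)"
  unfolding sol_x_def[abs_def] sol_xx_def
  by (auto intro!: derivative_eq_intros duhamel_1_deriv_space[OF s, unfolded One_nat_def] simp: power2_eq_square)

lemma sol_deriv_time:
  assumes "s \<in> {0..S}"
  shows "((\<lambda>s. sol k h s x) has_real_derivative h s x + sol_xx k h s x) (at s within {0..S})"
  unfolding sol_def sol_xx_def
  by (auto intro!: derivative_eq_intros duhamel_deriv_time[OF assms])

end

section \<open>Global mild solutions for a Lipschitz nonlinearity\<close>

locale lipschitz_nonlinearity =
  fixes S k a L F0 :: real and F :: "real \<Rightarrow> real \<Rightarrow> real"
  assumes S_pos: "S > 0"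
    and F_cont: "continuous_on UNIV (\<lambda>(r, y). F r y)"
    and F_lipschitz: "\<And>r y z. 0 \<le> r \<Longrightarrow> r \<le> S \<Longrightarrow> \<bar>F r y - F r z\<bar> \<le> L * \<bar>y - z\<bar>"
    and F_0: "\<And>r. 0 \<le> r \<Longrightarrow> r \<le> S \<Longrightarrow> \<bar>F r 0\<bar> \<le> F0"
begin

lemma L_nonneg: "L \<ge> 0"
  using F_lipschitz[of 0 0 1] S_pos by simp

lemma F0_nonneg: "F0 \<ge> 0"
  using F_0[of 0] S_pos by simp

lemma F_comp_measurable:
  assumes [measurable]: "u \<in> borel_measurable (borel \<Otimes>\<^sub>M borel)"
  shows "(\<lambda>(r :: real, \<xi> :: real). F r (u (r, \<xi>))) \<in> borel_measurable (borel \<Otimes>\<^sub>M borel)"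
proof -
  have "(\<lambda>(r, y). F r y) \<in> borel_measurable borel" using F_cont by (rule borel_measurable_continuous_onI)
  moreover have "(\<lambda>z. (fst z, u z)) \<in> measurable (borel \<Otimes>\<^sub>M borel) (borel :: (real \<times> real) measure)"
    by measurable
  ultimately have "(\<lambda>z. (\<lambda>(r, y). F r y) (fst z, u z)) \<in> borel_measurable (borel \<Otimes>\<^sub>M borel)"
    by (rule measurable_compose[rotated])
  then show ?thesis by (simp add: split_def)
qed

lemma F_source:
  assumes "u \<in> borel_measurable (borel \<Otimes>\<^sub>M borel)"
    and u: "\<And>r \<xi>. 0 \<le> r \<Longrightarrow> r \<le> S \<Longrightarrow> \<bar>u (r, \<xi>)\<bar> \<le> N * cosh (k * \<xi>)"
  shows "heat_source S k (F0 + L * N) (\<lambda>r \<xi>. F r (u (r, \<xi>)))"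
proof
  show "\<bar>F r (u (r, \<xi>))\<bar> \<le> (F0 + L * N) * cosh (k * \<xi>)" if r: "0 \<le> r" "r \<le> S" for r \<xi>
  proof -
    have "\<bar>F r (u (r, \<xi>))\<bar> \<le> \<bar>F r 0\<bar> + \<bar>F r (u (r, \<xi>)) - F r 0\<bar>" by linarith
    also have "\<dots> \<le> F0 + L * \<bar>u (r, \<xi>)\<bar>" using F_lipschitz[OF r, of "u (r, \<xi>)" 0] F_0[OF r] by simp
    also have "\<dots> \<le> F0 * cosh (k * \<xi>) + L * (N * cosh (k * \<xi>))"
      using u[OF r] L_nonneg F0_nonneg mult_left_mono[OF cosh_real_ge_1[of "k * \<xi>"] F0_nonneg]
      by (intro add_mono mult_left_mono) auto
    finally show ?thesis by (simp add: algebra_simps)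
  qed
qed (use S_pos F_comp_measurable[OF assms(1)] in auto)

text \<open>The fixed point is sought for the flux divided by exp (M r) cosh (k x), in the Banach
  space of bounded continuous functions on the plane. A large M makes the map a contraction on the
  whole time interval at once, with no continuation in short steps.\<close>

lemma mild_solution_exists:
  obtains h C where "heat_source S k C h"
    "\<And>r x. 0 \<le> r \<Longrightarrow> r \<le> S \<Longrightarrow> h r x = F r (flux a k h r x)"
proof -
  define K0 where "K0 = 1032 * L * (1 + S) * exp (2 * k\<^sup>2 * S)"
  \<comment> \<open>The Lipschitz constant of the map is at most 4 (|a| + 1) K0 S^(1/4) M^(-1/4).
    With M = R^4 the last factor is 1 / R, and R is chosen to make the product at most 1/2.\<close>
  define R where "R = 8 * (\<bar>a\<bar> + 1) * K0 * S powr (1/4) + 1"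
  define M where "M = R ^ 4"
  have K0: "K0 \<ge> 0" using L_nonneg S_pos by (simp add: K0_def)
  have R: "R \<ge> 1" using K0 by (simp add: R_def)
  have M: "M > 0" "M powr (- (1/4)) = 1 / R"
    using R by (auto simp: M_def powr_minus_divide powr_powr simp flip: powr_numeral)
  have RM: "4 * (\<bar>a\<bar> + 1) * K0 * S powr (1/4) * M powr (- (1/4)) \<le> 1 / 2"
  proof -
    have "4 * (\<bar>a\<bar> + 1) * K0 * S powr (1/4) = (R - 1) / 2" by (simp add: R_def)
    then have "4 * (\<bar>a\<bar> + 1) * K0 * S powr (1/4) * M powr (- (1/4)) = (R - 1) / 2 * (1 / R)" by (simp only: M(2))
    also have "\<dots> \<le> 1 / 2" using R by (simp add: divide_simps)
    finally show ?thesis .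
  qed
  define P where "P B r x = exp (M * r) * cosh (k * x) * apply_bcontfun B (r, x)" for B :: "(real \<times> real) \<Rightarrow>\<^sub>C real" and r x
  define hh where "hh B r x = F r (P B r x)" for B r x
  \<comment> \<open>Clamps the time to [0, S], since the functions of the Banach space live on the
    whole plane.\<close>
  define cl where "cl r = max 0 (min S r)" for r :: real
  define G where "G B = (\<lambda>z. exp (- M * cl (fst z)) / cosh (k * snd z) * flux a k (hh B) (cl (fst z)) (snd z))" for B
  have cl: "0 \<le> cl r" "cl r \<le> S" "0 \<le> r \<Longrightarrow> r \<le> S \<Longrightarrow> cl r = r" for r using S_pos by (auto simp: cl_def)
  have Pm[measurable]: "(\<lambda>(r, x). P B r x) \<in> borel_measurable (borel \<Otimes>\<^sub>M borel)" for B
  proof -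
    have "continuous_on UNIV (\<lambda>z. P B (fst z) (snd z))"
      unfolding P_def prod.collapse by (intro continuous_intros continuous_on_apply_bcontfun)
    then have "(\<lambda>z. P B (fst z) (snd z)) \<in> borel_measurable borel" by (rule borel_measurable_continuous_onI)
    then show ?thesis by (simp add: borel_prod split_def)
  qed
  have Pb: "\<bar>P B r x\<bar> \<le> (exp (M * S) * norm B) * cosh (k * x)" if "0 \<le> r" "r \<le> S" for B r x
  proof -
    have "exp (M * r) * \<bar>apply_bcontfun B (r, x)\<bar> \<le> exp (M * S) * norm B"
      using that M norm_bounded[of B "(r, x)"] by (intro mult_mono) auto
    then show ?thesis by (simp add: P_def abs_mult mult_right_mono ac_simps)
  qed
  have src: "heat_source S k (F0 + L * (exp (M * S) * norm B)) (hh B)" for B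
    unfolding hh_def using F_source[of "\<lambda>(r, x). P B r x"] Pb by auto
  have Gc: "G B \<in> bcontfun" for B
  proof (rule bcontfun_normI)
    interpret heat_source S k "F0 + L * (exp (M * S) * norm B)" "hh B" by (rule src)
    have "continuous_on UNIV (\<lambda>z. (\<lambda>(s, x). flux a k (hh B) s x) (cl (fst z), snd z))"
      by (rule continuous_on_compose2[OF continuous_on_flux])
        (use S_pos in \<open>auto simp: cl_def intro!: continuous_intros\<close>)
    then have 1: "continuous_on UNIV (\<lambda>z. flux a k (hh B) (cl (fst z)) (snd z))" by simp
    have 2: "continuous_on UNIV (\<lambda>z :: real \<times> real. cl (fst z))" unfolding cl_def by (intro continuous_intros)
    show "continuous_on UNIV (G B)"
      unfolding G_def by (intro continuous_intros 1 2) auto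
    show "norm (G B z) \<le> (\<bar>a\<bar> + 1) * A" for z
    proof -
      have "norm (G B z) = exp (- M * cl (fst z)) / cosh (k * snd z) * \<bar>flux a k (hh B) (cl (fst z)) (snd z)\<bar>"
        by (simp add: G_def abs_mult)
      also have "\<dots> \<le> 1 / cosh (k * snd z) * ((\<bar>a\<bar> + 1) * A * cosh (k * snd z))"
        using M cl by (intro mult_mono divide_right_mono flux_estimates(1)) auto
      finally show ?thesis by simp
    qed
  qed
  define T where "T B = Bcontfun (G B)" for B
  have TG: "apply_bcontfun (T B) = G B" for B unfolding T_def by (rule Bcontfun_inverse[OF Gc])
  have contr: "dist (T B1) (T B2) \<le> (1 / 2) * dist B1 B2" for B1 B2
  proof (rule dist_bound)
    fix z :: "real \<times> real"
    define s where "s = cl (fst z)"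
    define x where "x = snd z"
    define \<delta> where "\<delta> = dist B1 B2"
    have s: "0 \<le> s" "s \<le> S" unfolding s_def by (rule cl)+
    define q where "q r \<xi> = hh B1 r \<xi> - hh B2 r \<xi>" for r \<xi>
    \<comment> \<open>The factor exp (M r) is kept at the running time r; the cruder constant with
      exp (M S) below serves only to place q in the locale.\<close>
    have qb: "\<bar>q r \<xi>\<bar> \<le> (L * exp (M * r) * \<delta>) * cosh (k * \<xi>)" if "0 \<le> r" "r \<le> S" for r \<xi>
    proof -
      have "\<bar>q r \<xi>\<bar> \<le> L * \<bar>P B1 r \<xi> - P B2 r \<xi>\<bar>" unfolding q_def hh_def by (rule F_lipschitz[OF that])
      also have "\<bar>P B1 r \<xi> - P B2 r \<xi>\<bar> = exp (M * r) * cosh (k * \<xi>) * dist (apply_bcontfun B1 (r, \<xi>)) (apply_bcontfun B2 (r, \<xi>))"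
        by (simp add: P_def dist_real_def abs_mult flip: right_diff_distrib)
      also have "L * \<dots> \<le> L * (exp (M * r) * cosh (k * \<xi>) * \<delta>)"
        unfolding \<delta>_def using L_nonneg by (intro mult_left_mono dist_bounded) auto
      finally show ?thesis by (simp add: ac_simps)
    qed
    interpret h1: heat_source S k "F0 + L * (exp (M * S) * norm B1)" "hh B1" by (rule src)
    interpret h2: heat_source S k "F0 + L * (exp (M * S) * norm B2)" "hh B2" by (rule src)
    have d0: "\<delta> \<ge> 0" by (simp add: \<delta>_def)
    interpret q: heat_source S k "L * exp (M * S) * \<delta>" q
    proof
      show "(\<lambda>(r, \<xi>). q r \<xi>) \<in> borel_measurable (borel \<Otimes>\<^sub>M borel)"
        using h1.h_meas h2.h_meas unfolding q_def split_def by measurable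
      show "\<bar>q r \<xi>\<bar> \<le> L * exp (M * S) * \<delta> * cosh (k * \<xi>)" if "0 \<le> r" "r \<le> S" for r \<xi>
        using that M L_nonneg d0
        by (intro order_trans[OF qb[OF that]] mult_right_mono mult_left_mono) auto
    qed (rule S_pos)
    have dq: "\<bar>duhamel n q s x\<bar> \<le> 4 * (K0 * \<delta> * exp (M * s) * M powr (- (1/4)) * cosh (k * x)) * S powr (1/4)" if n: "n \<le> 1" for n
    proof -
      have "\<bar>duhamel n q s x\<bar> \<le> 4 * (K0 * \<delta> * exp (M * s) * M powr (- (1/4)) * cosh (k * x)) * s powr (1/4)"
      proof (rule q.duhamel_bound(2)[OF s])
        fix r assume r: "0 < r" "r < s"
        define \<rho> where "\<rho> = s - r"
        have rho: "0 < \<rho>" "\<rho> \<le> S" "r = s - \<rho>" using r s by (auto simp: \<rho>_def)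
        \<comment> \<open>From (M \<rho>)^(1/4) \<le> exp (M \<rho>): a further singularity
          \<rho>^(-1/4) is traded for the small factor M^(-1/4). Together with the gradient
          singularity \<rho>^(-1/2) it remains integrable.\<close>
        have e: "exp (M * r) \<le> exp (M * s) * (M powr (- (1/4)) * \<rho> powr (- (1/4)))"
        proof -
          have "(M * \<rho>) powr (1/4) \<le> exp (M * \<rho>)"
          proof (cases "M * \<rho> \<le> 1")
            case True
            then have "(M * \<rho>) powr (1/4) \<le> 1" using M rho by (intro powr_le1) auto
            also have "1 \<le> exp (M * \<rho>)" using M rho by simp
            finally show ?thesis .
          next
            case False
            then have "(M * \<rho>) powr (1/4) \<le> (M * \<rho>) powr 1" by (intro powr_mono) auto
            also have "\<dots> = M * \<rho>" using False by simp
            also have "\<dots> \<le> exp (M * \<rho>)" using exp_ge_add_one_self[of "M * \<rho>"] by linarith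
            finally show ?thesis .
          qed
          then have "inverse (exp (M * \<rho>)) \<le> inverse ((M * \<rho>) powr (1/4))"
            using M rho by (intro le_imp_inverse_le) auto
          then have "exp (- (M * \<rho>)) \<le> M powr (- (1/4)) * \<rho> powr (- (1/4))"
            using M rho by (simp add: exp_minus powr_minus powr_mult)
          then have "exp (M * s) * exp (- (M * \<rho>)) \<le> exp (M * s) * (M powr (- (1/4)) * \<rho> powr (- (1/4)))"
            by (intro mult_left_mono) auto
          then show ?thesis unfolding rho(3) by (simp add: right_diff_distrib flip: exp_add)
        qed
        have "\<bar>heat_conv n \<rho> (q r) x\<bar> \<le> 1032 * (L * exp (M * r) * \<delta>) * \<rho> powr (- real n / 2) * (exp (2 * k\<^sup>2 * \<rho>) * cosh (k * x))"
          using r s n rho by (intro heat_conv_bound qb) auto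
        also have "\<dots> \<le> 1032 * (L * (exp (M * s) * (M powr (- (1/4)) * \<rho> powr (- (1/4)))) * \<delta>) * ((1 + S) * \<rho> powr (- (1/2))) * (exp (2 * k\<^sup>2 * S) * cosh (k * x))"
          using n rho L_nonneg d0 S_pos e
          by (intro mult_mono mult_right_mono mult_left_mono powr_lower_exponent mult_nonneg_nonneg) (auto simp: mult_left_mono)
        also have "\<dots> = (K0 * \<delta> * exp (M * s) * M powr (- (1/4)) * cosh (k * x)) * (\<rho> powr (- (1/4)) * \<rho> powr (- (1/2)))"
          by (simp add: K0_def ac_simps)
        also have "\<rho> powr (- (1/4)) * \<rho> powr (- (1/2)) = \<rho> powr (- (3/4))" by (simp flip: powr_add)
        finally show "\<bar>heat_conv n (s - r) (q r) x\<bar> \<le> (K0 * \<delta> * exp (M * s) * M powr (- (1/4)) * cosh (k * x)) * (s - r) powr (- (3/4))"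
          by (simp add: \<rho>_def)
      qed
      also have "\<dots> \<le> 4 * (K0 * \<delta> * exp (M * s) * M powr (- (1/4)) * cosh (k * x)) * S powr (1/4)"
        using s K0 d0 by (intro mult_left_mono powr_mono2) auto
      finally show ?thesis .
    qed
    define Y where "Y = 4 * K0 * S powr (1/4) * M powr (- (1/4)) * \<delta>"
    have dq': "\<bar>duhamel n q s x\<bar> \<le> exp (M * s) * cosh (k * x) * Y" if "n \<le> 1" for n
      using dq[OF that] by (simp add: Y_def ac_simps)
    have fd: "flux a k (hh B1) s x - flux a k (hh B2) s x = a * duhamel 0 q s x - duhamel 1 q s x"
    proof -
      have dd: "duhamel n (hh B1) s x - duhamel n (hh B2) s x = duhamel n q s x" if "n \<le> 1" for n
        unfolding q_def[abs_def] by (rule duhamel_diff[OF src src s that])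
      have "flux a k (hh B1) s x - flux a k (hh B2) s x =
          a * (duhamel 0 (hh B1) s x - duhamel 0 (hh B2) s x) - (duhamel 1 (hh B1) s x - duhamel 1 (hh B2) s x)"
        unfolding flux_def sol_def sol_x_def by (simp add: algebra_simps)
      then show ?thesis by (simp only: dd[of 0] dd[of 1] zero_le order_refl)
    qed
    have "\<bar>a * duhamel 0 q s x - duhamel 1 q s x\<bar> \<le> \<bar>a\<bar> * \<bar>duhamel 0 q s x\<bar> + \<bar>duhamel 1 q s x\<bar>"
      by (metis abs_mult abs_triangle_ineq4)
    also have "\<dots> \<le> \<bar>a\<bar> * (exp (M * s) * cosh (k * x) * Y) + exp (M * s) * cosh (k * x) * Y"
      by (intro add_mono mult_left_mono dq') auto
    also have "\<dots> = exp (M * s) * cosh (k * x) * ((\<bar>a\<bar> + 1) * Y)" by (simp add: algebra_simps)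
    also have "\<dots> \<le> exp (M * s) * cosh (k * x) * (1 / 2 * \<delta>)"
    proof (rule mult_left_mono)
      have "(\<bar>a\<bar> + 1) * Y = (4 * (\<bar>a\<bar> + 1) * K0 * S powr (1/4) * M powr (- (1/4))) * \<delta>" by (simp add: Y_def ac_simps)
      also have "\<dots> \<le> 1 / 2 * \<delta>" by (intro mult_right_mono RM d0)
      finally show "(\<bar>a\<bar> + 1) * Y \<le> 1 / 2 * \<delta>" .
    qed auto
    finally have fl: "\<bar>flux a k (hh B1) s x - flux a k (hh B2) s x\<bar> \<le> exp (M * s) * cosh (k * x) * (1 / 2 * \<delta>)"
      unfolding fd .
    have "dist (G B1 z) (G B2 z) = exp (- M * s) / cosh (k * x) * \<bar>flux a k (hh B1) s x - flux a k (hh B2) s x\<bar>"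
      unfolding G_def s_def[symmetric] x_def[symmetric] dist_real_def right_diff_distrib[symmetric]
      by (simp add: abs_mult)
    also have "\<dots> \<le> exp (- M * s) / cosh (k * x) * (exp (M * s) * cosh (k * x) * (1 / 2 * \<delta>))"
      by (intro mult_left_mono fl) auto
    also have "\<dots> = (exp (- M * s) * exp (M * s)) * (1 / 2 * \<delta>)" by simp
    also have "exp (- M * s) * exp (M * s) = 1" by (simp flip: exp_add)
    finally show "dist (apply_bcontfun (T B1) z) (apply_bcontfun (T B2) z) \<le> (1 / 2) * dist B1 B2"
      unfolding TG \<delta>_def by simp
  qed
  obtain B where B: "T B = B" using banach_fix_type[of "1 / 2" T] contr by auto
  have "hh B r x = F r (flux a k (hh B) r x)" if r: "0 \<le> r" "r \<le> S" for r x
  proof -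
    have "apply_bcontfun B (r, x) = exp (- M * r) / cosh (k * x) * flux a k (hh B) r x"
      using TG[of B] cl(3)[OF r] unfolding B by (simp add: G_def)
    then have "P B r x = (exp (M * r) * exp (- M * r)) * flux a k (hh B) r x" unfolding P_def by simp
    also have "exp (M * r) * exp (- M * r) = 1" by (simp flip: exp_add)
    finally show ?thesis unfolding hh_def by simp
  qed
  with src show ?thesis by (rule that)
qed

end

section \<open>The regularised power nonlinearity\<close>

text \<open>The truncation makes the function total, since the sign of the flux is known only after
  the comparison arguments; the shift keeps the base away from 0 and makes the function increasing
  in \<epsilon>.\<close>

definition reg_pow :: "real \<Rightarrow> real \<Rightarrow> real \<Rightarrow> real" where
  "reg_pow p \<epsilon> y = (max y 0 + \<epsilon>) powr p"

lemma reg_pow_mono_eps: "0 < p \<Longrightarrow> 0 < \<epsilon> \<Longrightarrow> \<epsilon> \<le> \<epsilon>' \<Longrightarrow> reg_pow p \<epsilon> y \<le> reg_pow p \<epsilon>' y"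
  unfolding reg_pow_def by (intro powr_mono2) auto

lemma reg_pow_nonneg: "0 \<le> reg_pow p \<epsilon> y"
  by (simp add: reg_pow_def)

lemma powr_lipschitz:
  fixes p e u v :: real
  assumes p: "0 < p" "p < 1" and e: "0 < e" "e \<le> u" "e \<le> v"
  shows "\<bar>u powr p - v powr p\<bar> \<le> p * e powr (p - 1) * \<bar>u - v\<bar>"
proof -
  have "norm (u powr p - v powr p) \<le> (p * e powr (p - 1)) * norm (u - v)"
  proof (rule field_differentiable_bound[where S = "{e..}" and f' = "\<lambda>z. p * z powr (p - 1)"])
    show "((\<lambda>z. z powr p) has_field_derivative p * z powr (p - 1)) (at z within {e..})" if "z \<in> {e..}" for z
      by (rule has_field_derivative_at_within, rule has_real_derivative_powr) (use that e in auto)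
    show "norm (p * z powr (p - 1)) \<le> p * e powr (p - 1)" if "z \<in> {e..}" for z
      using that e p by (auto simp: abs_mult intro!: mult_left_mono powr_mono2')
  qed (use e in auto)
  then show ?thesis by simp
qed

lemma reg_pow_lipschitz:
  assumes "0 < p" "p < 1" "0 < \<epsilon>"
  shows "\<bar>reg_pow p \<epsilon> y - reg_pow p \<epsilon> z\<bar> \<le> p * \<epsilon> powr (p - 1) * \<bar>y - z\<bar>"
proof -
  have "\<bar>reg_pow p \<epsilon> y - reg_pow p \<epsilon> z\<bar> \<le> p * \<epsilon> powr (p - 1) * \<bar>(max y 0 + \<epsilon>) - (max z 0 + \<epsilon>)\<bar>"
    unfolding reg_pow_def using assms by (intro powr_lipschitz) auto
  also have "\<dots> \<le> p * \<epsilon> powr (p - 1) * \<bar>y - z\<bar>"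
    using assms by (intro mult_left_mono) (auto simp: max_def)
  finally show ?thesis .
qed

text \<open>Subhomogeneity, from p < 1 and \<epsilon> \<le> e \<epsilon>. It makes a multiple of a
  solution by a factor at least one a supersolution.\<close>

lemma reg_pow_scale:
  assumes "0 < p" "p < 1" "0 < \<epsilon>" "1 \<le> e"
  shows "reg_pow p \<epsilon> (e * y) \<le> e * reg_pow p \<epsilon> y"
proof -
  have "max (e * y) 0 = e * max y 0" using assms by (auto simp: max_def mult_le_0_iff)
  then have "max (e * y) 0 + \<epsilon> \<le> e * (max y 0 + \<epsilon>)" using assms by (simp add: distrib_left)
  then have "reg_pow p \<epsilon> (e * y) \<le> (e * (max y 0 + \<epsilon>)) powr p"
    unfolding reg_pow_def using assms by (intro powr_mono2) auto
  also have "\<dots> = e powr p * reg_pow p \<epsilon> y" using assms by (simp add: powr_mult reg_pow_def)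
  also have "\<dots> \<le> e powr 1 * reg_pow p \<epsilon> y"
    using assms by (intro mult_right_mono powr_mono reg_pow_nonneg) auto
  finally show ?thesis using assms by simp
qed

lemma derivative_nonpos_if_antimono:
  fixes f :: "real \<Rightarrow> real"
  assumes f: "(f has_real_derivative l) (at x)" and mono: "\<And>h. 0 \<le> h \<Longrightarrow> f (x + h) \<le> f x"
  shows "l \<le> 0"
proof (rule ccontr)
  assume "\<not> l \<le> 0"
  then obtain d where "d > 0" "\<And>h. 0 < h \<Longrightarrow> h < d \<Longrightarrow> f x < f (x + h)"
    using has_real_derivative_pos_inc_right[OF f] by auto
  from this(2)[of "d / 2"] this(1) mono[of "d / 2"] show False by simp
qed

text \<open>A difference quotient with a fixed small step is uniformly close to every derivative by
  the common Hoelder bound, and the quotients converge with the functions; so the derivatives form a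
  Cauchy sequence.\<close>

lemma derivatives_converge:
  fixes f g :: "nat \<Rightarrow> real \<Rightarrow> real"
  assumes f: "\<And>n y. (f n has_real_derivative g n y) (at y)"
    and conv: "\<And>y. convergent (\<lambda>n. f n y)"
    and hol: "\<And>n y. \<bar>y - x\<bar> \<le> 1 \<Longrightarrow> \<bar>g n y - g n x\<bar> \<le> K * sqrt \<bar>y - x\<bar>"
    and K: "K > 0"
  shows "convergent (\<lambda>n. g n x)"
proof -
  have "Cauchy (\<lambda>n. g n x)"
  proof (rule metric_CauchyI)
    fix e :: real assume e: "e > 0"
    \<comment> \<open>The step for which the Hoelder bound K sqrt \<delta> is at most e / 3.\<close>
    define \<delta> where "\<delta> = min 1 ((e / (3 * K))\<^sup>2)"
    have \<delta>: "0 < \<delta>" "\<delta> \<le> 1" using e K by (auto simp: \<delta>_def)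
    have "sqrt \<delta> \<le> sqrt ((e / (3 * K))\<^sup>2)" unfolding \<delta>_def by (intro real_sqrt_le_mono) simp
    then have "sqrt \<delta> \<le> e / (3 * K)" using e K by simp
    then have sq: "K * sqrt \<delta> \<le> e / 3" using K by (simp add: field_simps)
    define q where "q n = (f n (x + \<delta>) - f n x) / \<delta>" for n
    have gq: "\<bar>g n x - q n\<bar> \<le> e / 3" for n
    proof -
      have "\<exists>z>x. z < x + \<delta> \<and> f n (x + \<delta>) - f n x = (x + \<delta> - x) * g n z"
        using \<delta> by (intro MVT2 f) auto
      then obtain z where z: "x < z" "z < x + \<delta>" "f n (x + \<delta>) - f n x = \<delta> * g n z" by auto
      have "q n = g n z" using z \<delta> by (simp add: q_def)
      moreover have "\<bar>g n z - g n x\<bar> \<le> K * sqrt \<bar>z - x\<bar>" using z \<delta> by (intro hol) auto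
      moreover have "K * sqrt \<bar>z - x\<bar> \<le> K * sqrt \<delta>" using z K by (intro mult_left_mono) auto
      ultimately show ?thesis using sq by (simp add: abs_minus_commute)
    qed
    obtain l l' where "(\<lambda>n. f n (x + \<delta>)) \<longlonglongrightarrow> l" "(\<lambda>n. f n x) \<longlonglongrightarrow> l'"
      using conv unfolding convergent_def by blast
    then have "q \<longlonglongrightarrow> (l - l') / \<delta>" unfolding q_def[abs_def] using \<delta> by (intro tendsto_intros) auto
    then have "convergent q" by (auto simp: convergent_def)
    then have "Cauchy q" by (rule convergent_Cauchy)
    moreover have "e / 3 > 0" using e by simp
    ultimately obtain N where N: "\<And>m n. m \<ge> N \<Longrightarrow> n \<ge> N \<Longrightarrow> dist (q m) (q n) < e / 3"
      unfolding Cauchy_def by blast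
    show "\<exists>M. \<forall>m\<ge>M. \<forall>n\<ge>M. dist (g m x) (g n x) < e"
    proof (intro exI[of _ N] allI impI)
      fix m n assume "m \<ge> N" "n \<ge> N"
      from N[OF this] gq[of m] gq[of n] show "dist (g m x) (g n x) < e"
        unfolding dist_real_def by linarith
    qed
  qed
  then show ?thesis by (rule Cauchy_convergent)
qed

lemma duhamel_at_0: "duhamel n h 0 x = 0"
  by (simp add: duhamel_def)

lemma sol_at_0: "sol k h 0 x = exp (- k * x)"
  by (simp add: sol_def duhamel_at_0)

lemma duhamel_convergence:
  fixes f :: "nat \<Rightarrow> real \<Rightarrow> real \<Rightarrow> real"
  assumes f: "\<And>m. heat_source S k C (f m)" and h: "heat_source S k C h"
    and lim: "\<And>r \<xi>. 0 \<le> r \<Longrightarrow> r \<le> S \<Longrightarrow> (\<lambda>m. f m r \<xi>) \<longlonglongrightarrow> h r \<xi>"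
    and s: "0 \<le> s" "s \<le> S" and n: "n \<le> 1"
  shows "(\<lambda>m. duhamel n (f m) s x) \<longlonglongrightarrow> duhamel n h s x"
proof -
  interpret f: heat_source S k C "f m" for m by (rule f)
  interpret h: heat_source S k C h by (rule h)
  define Bd where "Bd = h.D * (1 + S) * cosh (k * x)"
  show ?thesis
    unfolding duhamel_def
  proof (rule integral_dominated_convergence[where w = "\<lambda>r. Bd * (indicator {0<..<s} r * (s - r) powr (- (3/4)))"])
    show "integrable lborel (\<lambda>r. Bd * (indicator {0<..<s} r * (s - r) powr (- (3/4))))"
      using has_bochner_integral_powr_three_quarters[OF s(1)]
      by (intro integrable_mult_right) (simp add: has_bochner_integral_iff)
    show "AE r in lborel. norm (indicator {0<..<s} r * heat_conv n (s - r) (f m r) x) \<le> Bd * (indicator {0<..<s} r * (s - r) powr (- (3/4)))" for m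
    proof (rule AE_I2)
      fix r
      show "norm (indicator {0<..<s} r * heat_conv n (s - r) (f m r) x) \<le> Bd * (indicator {0<..<s} r * (s - r) powr (- (3/4)))"
        using f.heat_conv_source_bound'[of r s n m x] s n unfolding Bd_def
        by (cases "r \<in> {0<..<s}") simp_all
    qed
    show "AE r in lborel. (\<lambda>m. indicator {0<..<s} r * heat_conv n (s - r) (f m r) x) \<longlonglongrightarrow> indicator {0<..<s} r * heat_conv n (s - r) (h r) x"
    proof (rule AE_I2)
      fix r
      show "(\<lambda>m. indicator {0<..<s} r * heat_conv n (s - r) (f m r) x) \<longlonglongrightarrow> indicator {0<..<s} r * heat_conv n (s - r) (h r) x"
      proof (cases "r \<in> {0<..<s}")
        case True
        then have r: "0 \<le> r" "r \<le> S" "s - r > 0" using s by auto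
        have "(\<lambda>m. heat_conv n (s - r) (f m r) x) \<longlonglongrightarrow> heat_conv n (s - r) (h r) x"
          unfolding heat_conv_def
        proof (rule integral_dominated_convergence[where w = "\<lambda>\<xi>. \<bar>heat n (s - r) (x - \<xi>) * (C * cosh (k * \<xi>))\<bar>"])
          show "integrable lborel (\<lambda>\<xi>. \<bar>heat n (s - r) (x - \<xi>) * (C * cosh (k * \<xi>))\<bar>)"
            using h.C_nonneg n r by (intro integrable_abs heat_conv_integrable[of _ C k]) (auto simp: abs_mult)
          show "AE \<xi> in lborel. (\<lambda>m. heat n (s - r) (x - \<xi>) * f m r \<xi>) \<longlonglongrightarrow> heat n (s - r) (x - \<xi>) * h r \<xi>"
            using lim[OF r(1,2)] by (intro AE_I2 tendsto_mult_left)
          show "AE \<xi> in lborel. norm (heat n (s - r) (x - \<xi>) * f m r \<xi>) \<le> \<bar>heat n (s - r) (x - \<xi>) * (C * cosh (k * \<xi>))\<bar>" for m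
          proof (rule AE_I2)
            fix \<xi>
            have "\<bar>f m r \<xi>\<bar> \<le> \<bar>C * cosh (k * \<xi>)\<bar>" using f.h_bound[OF r(1,2), of m \<xi>] by auto
            then show "norm (heat n (s - r) (x - \<xi>) * f m r \<xi>) \<le> \<bar>heat n (s - r) (x - \<xi>) * (C * cosh (k * \<xi>))\<bar>"
              unfolding real_norm_def abs_mult[of "heat n (s - r) (x - \<xi>)"] by (intro mult_left_mono) auto
          qed
        qed measurable
        then show ?thesis by (rule tendsto_mult_left)
      qed simp
    qed
  qed measurable
qed

lemma heat_conv_0_nonneg:
  assumes "r > 0" "\<And>\<xi>. 0 \<le> g \<xi>"
  shows "0 \<le> heat_conv 0 r g x"
  unfolding heat_conv_def using assms heat_0_nonneg by (intro Bochner_Integration.integral_nonneg) auto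

lemma duhamel_0_nonneg:
  assumes "s \<le> S" "\<And>r \<xi>. 0 \<le> r \<Longrightarrow> r \<le> S \<Longrightarrow> 0 \<le> h r \<xi>"
  shows "0 \<le> duhamel 0 h s x"
  unfolding duhamel_def
proof (rule Bochner_Integration.integral_nonneg)
  show "0 \<le> indicator {0<..<s} r * heat_conv 0 (s - r) (h r) x" for r
    using assms by (cases "r \<in> {0<..<s}") (auto intro!: heat_conv_0_nonneg)
qed

section \<open>Regularised power problems\<close>

locale power_problem =
  fixes S a b p cM :: real and c :: "real \<Rightarrow> real"
  assumes S_pos: "S > 0" and a_pos: "a > 0" and b_pos: "b > 0" and p: "0 < p" "p < 1"
    and c_cont: "continuous_on UNIV c" and c_pos: "\<And>r. 0 < c r"
    and c_le: "\<And>r. 0 \<le> r \<Longrightarrow> r \<le> S \<Longrightarrow> c r \<le> cM"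
begin

lemma cM_pos: "cM > 0"
  using c_pos[of 0] c_le[of 0] S_pos by auto

definition lip where "lip \<epsilon> = cM * (p * \<epsilon> powr (p - 1))"

lemma lip_nonneg: "lip \<epsilon> \<ge> 0"
  using cM_pos p by (simp add: lip_def)

lemma reg_lipschitz_nonlinearity:
  assumes "\<epsilon> > 0"
  shows "lipschitz_nonlinearity S (lip \<epsilon>) (cM * \<epsilon> powr p) (\<lambda>r y. c r * reg_pow p \<epsilon> y)"
proof
  show "continuous_on UNIV (\<lambda>(r, y). c r * reg_pow p \<epsilon> y)"
    unfolding reg_pow_def split_def using assms
    by (intro continuous_intros continuous_on_compose2[OF c_cont]) (auto simp: add_nonneg_pos)
  show "\<bar>c r * reg_pow p \<epsilon> y - c r * reg_pow p \<epsilon> z\<bar> \<le> lip \<epsilon> * \<bar>y - z\<bar>" if "0 \<le> r" "r \<le> S" for r y z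
  proof -
    have "\<bar>c r * reg_pow p \<epsilon> y - c r * reg_pow p \<epsilon> z\<bar> = c r * \<bar>reg_pow p \<epsilon> y - reg_pow p \<epsilon> z\<bar>"
      using c_pos[of r] by (simp add: abs_mult flip: right_diff_distrib)
    also have "\<dots> \<le> cM * (p * \<epsilon> powr (p - 1) * \<bar>y - z\<bar>)"
      using c_le[OF that] c_pos[of r] cM_pos by (intro mult_mono reg_pow_lipschitz p assms) auto
    finally show ?thesis by (simp add: lip_def ac_simps)
  qed
  show "\<bar>c r * reg_pow p \<epsilon> 0\<bar> \<le> cM * \<epsilon> powr p" if "0 \<le> r" "r \<le> S" for r
    using c_le[OF that] c_pos[of r] by (simp add: reg_pow_def abs_mult mult_right_mono)
qed (rule S_pos)

text \<open>One mild solution is chosen for each \<epsilon>; nothing is known of the value when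
  \<epsilon> \<le> 0. Different \<epsilon> become related only through
  \<open>comparison\<close>.\<close>

definition src :: "real \<Rightarrow> real \<Rightarrow> real \<Rightarrow> real" where
  "src \<epsilon> = (SOME h. (\<exists>C. heat_source S b C h) \<and>
     (\<forall>r x. 0 \<le> r \<longrightarrow> r \<le> S \<longrightarrow> h r x = c r * reg_pow p \<epsilon> (flux a b h r x)))"

lemma src:
  assumes "\<epsilon> > 0"
  shows "\<exists>C. heat_source S b C (src \<epsilon>)"
    and "\<And>r x. 0 \<le> r \<Longrightarrow> r \<le> S \<Longrightarrow> src \<epsilon> r x = c r * reg_pow p \<epsilon> (flux a b (src \<epsilon>) r x)"
proof -
  interpret lipschitz_nonlinearity S b a "lip \<epsilon>" "cM * \<epsilon> powr p" "\<lambda>r y. c r * reg_pow p \<epsilon> y"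
    by (rule reg_lipschitz_nonlinearity[OF assms])
  have "\<exists>h. (\<exists>C. heat_source S b C h) \<and>
     (\<forall>r x. 0 \<le> r \<longrightarrow> r \<le> S \<longrightarrow> h r x = c r * reg_pow p \<epsilon> (flux a b h r x))"
    by (rule mild_solution_exists) blast
  from someI_ex[OF this, folded src_def]
  show "\<exists>C. heat_source S b C (src \<epsilon>)"
    and "\<And>r x. 0 \<le> r \<Longrightarrow> r \<le> S \<Longrightarrow> src \<epsilon> r x = c r * reg_pow p \<epsilon> (flux a b (src \<epsilon>) r x)"
    by blast+
qed

text \<open>The weighted sup bound alone makes the flux Hoelder continuous, and the regularised
  power passes this on to the source. The solution is therefore classical, with constants that still
  depend on \<epsilon>.\<close>

lemma src_holder:
  assumes "\<epsilon> > 0"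
  shows "\<exists>C H. holder_source S b C (src \<epsilon>) H"
proof -
  obtain C where "heat_source S b C (src \<epsilon>)" using src(1)[OF assms] by blast
  then interpret heat_source S b C "src \<epsilon>" .
  interpret F: lipschitz_nonlinearity S b a "lip \<epsilon>" "cM * \<epsilon> powr p" "\<lambda>r y. c r * reg_pow p \<epsilon> y"
    by (rule reg_lipschitz_nonlinearity[OF assms])
  have "holder_source S b C (src \<epsilon>) (lip \<epsilon> * ((\<bar>a\<bar> + 1) * A))"
  proof
    show "0 \<le> lip \<epsilon> * ((\<bar>a\<bar> + 1) * A)" using lip_nonneg A_nonneg by (intro mult_nonneg_nonneg) auto
    show "\<bar>src \<epsilon> r \<xi> - src \<epsilon> r \<zeta>\<bar> \<le> lip \<epsilon> * ((\<bar>a\<bar> + 1) * A) * sqrt \<bar>\<xi> - \<zeta>\<bar> * (cosh (b * \<xi>) + cosh (b * \<zeta>))"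
      if "0 \<le> r" "r \<le> S" for r \<xi> \<zeta>
    proof -
      have "\<bar>src \<epsilon> r \<xi> - src \<epsilon> r \<zeta>\<bar> \<le> lip \<epsilon> * \<bar>flux a b (src \<epsilon>) r \<xi> - flux a b (src \<epsilon>) r \<zeta>\<bar>"
        unfolding src(2)[OF assms that] by (rule F.F_lipschitz[OF that])
      also have "\<dots> \<le> lip \<epsilon> * ((\<bar>a\<bar> + 1) * A * sqrt \<bar>\<xi> - \<zeta>\<bar> * (cosh (b * \<xi>) + cosh (b * \<zeta>)))"
        by (intro mult_left_mono flux_estimates that lip_nonneg)
      finally show ?thesis by (simp add: mult.assoc)
    qed
    show "continuous_on {0..S} (\<lambda>r. src \<epsilon> r \<xi>)" for \<xi>
    proof -
      have "continuous_on {0..S} (\<lambda>r. (\<lambda>(s, x). flux a b (src \<epsilon>) s x) (r, \<xi>))"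
        by (rule continuous_on_compose2[OF continuous_on_flux]) (auto intro!: continuous_intros)
      then have "continuous_on {0..S} (\<lambda>r. (\<lambda>(r, y). c r * reg_pow p \<epsilon> y) (r, flux a b (src \<epsilon>) r \<xi>))"
        by (intro continuous_on_compose2[OF F.F_cont] continuous_intros) auto
      then show ?thesis by (rule continuous_on_eq) (use src(2)[OF assms] in auto)
    qed
  qed
  then show ?thesis by blast
qed

abbreviation "Z \<epsilon> \<equiv> sol b (src \<epsilon>)"
abbreviation "Zx \<epsilon> \<equiv> sol_x b (src \<epsilon>)"
abbreviation "Zxx \<epsilon> \<equiv> sol_xx b (src \<epsilon>)"
abbreviation "P \<epsilon> \<equiv> flux a b (src \<epsilon>)"

lemma Z_props:
  assumes "\<epsilon> > 0"
  shows "continuous_on ({0..S} \<times> UNIV) (\<lambda>(s, x). Z \<epsilon> s x)"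
    and "\<And>s x. 0 \<le> s \<Longrightarrow> s \<le> S \<Longrightarrow> (Z \<epsilon> s has_real_derivative Zx \<epsilon> s x) (at x)"
    and "\<And>s x. 0 \<le> s \<Longrightarrow> s \<le> S \<Longrightarrow> (Zx \<epsilon> s has_real_derivative Zxx \<epsilon> s x) (at x)"
    and "\<And>s x. 0 \<le> s \<Longrightarrow> s \<le> S \<Longrightarrow> ((\<lambda>s. Z \<epsilon> s x) has_real_derivative src \<epsilon> s x + Zxx \<epsilon> s x) (at s within {0..S})"
    and "\<exists>A\<ge>0. \<forall>s x. 0 \<le> s \<longrightarrow> s \<le> S \<longrightarrow> \<bar>Z \<epsilon> s x\<bar> \<le> A * cosh (b * x)"
proof -
  obtain C H where "holder_source S b C (src \<epsilon>) H" using src_holder[OF assms] by blast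
  then interpret holder_source S b C "src \<epsilon>" H .
  show "continuous_on ({0..S} \<times> UNIV) (\<lambda>(s, x). Z \<epsilon> s x)" by (rule continuous_on_sol)
  show "\<And>s x. 0 \<le> s \<Longrightarrow> s \<le> S \<Longrightarrow> (Z \<epsilon> s has_real_derivative Zx \<epsilon> s x) (at x)" by (rule sol_deriv_space)
  show "\<And>s x. 0 \<le> s \<Longrightarrow> s \<le> S \<Longrightarrow> (Zx \<epsilon> s has_real_derivative Zxx \<epsilon> s x) (at x)" by (rule sol_x_deriv_space)
  show "\<And>s x. 0 \<le> s \<Longrightarrow> s \<le> S \<Longrightarrow> ((\<lambda>s. Z \<epsilon> s x) has_real_derivative src \<epsilon> s x + Zxx \<epsilon> s x) (at s within {0..S})"
    by (rule sol_deriv_time) auto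
  show "\<exists>A\<ge>0. \<forall>s x. 0 \<le> s \<longrightarrow> s \<le> S \<longrightarrow> \<bar>Z \<epsilon> s x\<bar> \<le> A * cosh (b * x)"
    using A_nonneg sol_estimates(1) by blast
qed

text \<open>Covers translates, multiples and different \<epsilon> at once. If d is the difference of
  the two sides, the difference of the scaled fluxes is a d - d_x, of size at most (a + 1)(|d| +
  |d_x|), so the one-sided Lipschitz condition on the nonlinear terms becomes the differential
  inequality of \<open>parabolic_comparison\<close>.\<close>

lemma comparison:
  fixes \<alpha> \<beta> g h :: real
  assumes e: "\<epsilon>1 > 0" "\<epsilon>2 > 0"
    and K: "K \<ge> 0"
    and ineq: "\<And>s x. 0 \<le> s \<Longrightarrow> s \<le> S \<Longrightarrow>
      - K * \<bar>\<alpha> * P \<epsilon>2 s (x + h) - \<beta> * P \<epsilon>1 s (x + g)\<bar> \<le>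
        \<alpha> * reg_pow p \<epsilon>2 (P \<epsilon>2 s (x + h)) - \<beta> * reg_pow p \<epsilon>1 (P \<epsilon>1 s (x + g))"
    and init: "\<And>x. \<beta> * exp (- b * (x + g)) \<le> \<alpha> * exp (- b * (x + h))"
    and s: "0 \<le> s" "s \<le> S"
  shows "\<beta> * Z \<epsilon>1 s (x + g) \<le> \<alpha> * Z \<epsilon>2 s (x + h)"
proof -
  define d where "d s x = \<alpha> * Z \<epsilon>2 s (x + h) - \<beta> * Z \<epsilon>1 s (x + g)" for s x
  define dx where "dx s x = \<alpha> * Zx \<epsilon>2 s (x + h) - \<beta> * Zx \<epsilon>1 s (x + g)" for s x
  define dxx where "dxx s x = \<alpha> * Zxx \<epsilon>2 s (x + h) - \<beta> * Zxx \<epsilon>1 s (x + g)" for s x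
  define ds where "ds s x = \<alpha> * (src \<epsilon>2 s (x + h) + Zxx \<epsilon>2 s (x + h)) - \<beta> * (src \<epsilon>1 s (x + g) + Zxx \<epsilon>1 s (x + g))" for s x
  note p1 = Z_props[OF e(1)] and p2 = Z_props[OF e(2)]
  obtain A1 A2 where A: "A1 \<ge> 0" "A2 \<ge> 0"
    "\<And>s x. 0 \<le> s \<Longrightarrow> s \<le> S \<Longrightarrow> \<bar>Z \<epsilon>1 s x\<bar> \<le> A1 * cosh (b * x)"
    "\<And>s x. 0 \<le> s \<Longrightarrow> s \<le> S \<Longrightarrow> \<bar>Z \<epsilon>2 s x\<bar> \<le> A2 * cosh (b * x)"
    using p1(5) p2(5) by blast
  have sh: "(f has_real_derivative l) (at (x + v)) \<Longrightarrow> ((\<lambda>x. f (x + v)) has_real_derivative l) (at x)" for f l x and v :: real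
    by (simp add: DERIV_shift)
  have "0 \<le> d s x"
  proof (rule parabolic_comparison[where d = d and ds = ds and dx = dx and dxx = dxx and S = S and k = b and
        L = "cM * K * (a + 1)" and C = "\<bar>\<alpha>\<bar> * (A2 * exp \<bar>b * h\<bar>) + \<bar>\<beta>\<bar> * (A1 * exp \<bar>b * g\<bar>)"])
    have sub: "continuous_on ({0..S} \<times> UNIV) (\<lambda>(s, x). Z \<epsilon> s (x + v))" if "\<epsilon> > 0" for \<epsilon> v
    proof -
      have "continuous_on ({0..S} \<times> UNIV) (\<lambda>z. (\<lambda>(s, x). Z \<epsilon> s x) (fst z, snd z + v))"
        by (rule continuous_on_compose2[OF Z_props(1)[OF that]]) (auto intro!: continuous_intros)
      then show ?thesis by (simp add: split_def)
    qed
    show "continuous_on ({0..S} \<times> UNIV) (\<lambda>(s, x). d s x)"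
      using continuous_on_diff[OF continuous_on_mult_left[OF sub[OF e(2), of h], of \<alpha>] continuous_on_mult_left[OF sub[OF e(1), of g], of \<beta>]]
      by (simp add: d_def split_def)
    show "((\<lambda>s. d s x) has_real_derivative ds s x) (at s within {0..S})" if "0 < s" "s \<le> S" for s x
      unfolding d_def ds_def using that
      by (intro DERIV_diff DERIV_cmult p1(4) p2(4)) auto
    show "(d s has_real_derivative dx s x) (at x)" if "0 < s" "s \<le> S" for s x
      unfolding d_def[abs_def] dx_def using that
      by (intro DERIV_diff DERIV_cmult sh p1(2) p2(2)) auto
    show "(dx s has_real_derivative dxx s x) (at x)" if "0 < s" "s \<le> S" for s x
      unfolding dx_def[abs_def] dxx_def using that
      by (intro DERIV_diff DERIV_cmult sh p1(3) p2(3)) auto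
    show "dxx s x - (cM * K * (a + 1)) * (\<bar>d s x\<bar> + \<bar>dx s x\<bar>) \<le> ds s x" if s: "0 < s" "s \<le> S" for s x
    proof -
      have s': "0 \<le> s" using s by simp
      define u where "u = \<alpha> * P \<epsilon>2 s (x + h) - \<beta> * P \<epsilon>1 s (x + g)"
      have "u = a * d s x - dx s x" by (simp add: u_def flux_def d_def dx_def algebra_simps)
      then have "\<bar>u\<bar> \<le> \<bar>a * d s x\<bar> + \<bar>dx s x\<bar>" by (simp only: abs_triangle_ineq4)
      also have "\<dots> \<le> (a + 1) * (\<bar>d s x\<bar> + \<bar>dx s x\<bar>)"
        using a_pos by (simp add: abs_mult algebra_simps)
      finally have "c s * (K * \<bar>u\<bar>) \<le> cM * (K * ((a + 1) * (\<bar>d s x\<bar> + \<bar>dx s x\<bar>)))"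
        using K c_pos[of s] c_le[of s] s cM_pos by (intro mult_mono mult_left_mono) auto
      moreover have "c s * (- K * \<bar>u\<bar>) \<le> c s * (\<alpha> * reg_pow p \<epsilon>2 (P \<epsilon>2 s (x + h)) - \<beta> * reg_pow p \<epsilon>1 (P \<epsilon>1 s (x + g)))"
        unfolding u_def using ineq[of s x] s c_pos[of s] by (intro mult_left_mono) auto
      moreover have "ds s x = dxx s x + c s * (\<alpha> * reg_pow p \<epsilon>2 (P \<epsilon>2 s (x + h)) - \<beta> * reg_pow p \<epsilon>1 (P \<epsilon>1 s (x + g)))"
        unfolding ds_def dxx_def src(2)[OF e(1) s' s(2)] src(2)[OF e(2) s' s(2)] by (simp add: algebra_simps)
      ultimately show ?thesis by (simp add: mult.assoc)
    qed
    show "cM * K * (a + 1) \<ge> 0" using cM_pos K a_pos by simp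
    show "0 \<le> d 0 x" for x using init[of x] by (simp add: d_def sol_at_0)
    show "\<bar>d s x\<bar> \<le> (\<bar>\<alpha>\<bar> * (A2 * exp \<bar>b * h\<bar>) + \<bar>\<beta>\<bar> * (A1 * exp \<bar>b * g\<bar>)) * cosh (b * x)" if "0 \<le> s" "s \<le> S" for s x
    proof -
      have "\<bar>Z \<epsilon>2 s (x + h)\<bar> \<le> A2 * (exp \<bar>b * h\<bar> * cosh (b * x))"
        by (rule order_trans[OF A(4)[OF that] mult_left_mono[OF cosh_shift_le A(2)]])
      moreover have "\<bar>Z \<epsilon>1 s (x + g)\<bar> \<le> A1 * (exp \<bar>b * g\<bar> * cosh (b * x))"
        by (rule order_trans[OF A(3)[OF that] mult_left_mono[OF cosh_shift_le A(1)]])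
      ultimately have "\<bar>\<alpha>\<bar> * \<bar>Z \<epsilon>2 s (x + h)\<bar> + \<bar>\<beta>\<bar> * \<bar>Z \<epsilon>1 s (x + g)\<bar> \<le>
          \<bar>\<alpha>\<bar> * (A2 * (exp \<bar>b * h\<bar> * cosh (b * x))) + \<bar>\<beta>\<bar> * (A1 * (exp \<bar>b * g\<bar> * cosh (b * x)))"
        by (intro add_mono mult_left_mono) auto
      moreover have "\<bar>d s x\<bar> \<le> \<bar>\<alpha>\<bar> * \<bar>Z \<epsilon>2 s (x + h)\<bar> + \<bar>\<beta>\<bar> * \<bar>Z \<epsilon>1 s (x + g)\<bar>"
        unfolding d_def by (metis abs_mult abs_triangle_ineq4)
      ultimately show ?thesis by (simp add: algebra_simps)
    qed
  qed (use s in auto)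
  then show ?thesis by (simp add: d_def)
qed

end

section \<open>Monotonicity, gradient bounds and the limit\<close>

context power_problem
begin

lemma Z_antimono:
  assumes e: "\<epsilon> > 0" and s: "0 \<le> s" "s \<le> S" and h: "0 \<le> h"
  shows "Z \<epsilon> s (x + h) \<le> Z \<epsilon> s x"
proof -
  have "1 * Z \<epsilon> s (x + h) \<le> 1 * Z \<epsilon> s (x + 0)"
  proof (rule comparison[OF e e _ _ _ s])
    show "0 \<le> p * \<epsilon> powr (p - 1)" using p by simp
    show "- (p * \<epsilon> powr (p - 1)) * \<bar>1 * P \<epsilon> s (x + 0) - 1 * P \<epsilon> s (x + h)\<bar> \<le>
        1 * reg_pow p \<epsilon> (P \<epsilon> s (x + 0)) - 1 * reg_pow p \<epsilon> (P \<epsilon> s (x + h))" for s x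
      using reg_pow_lipschitz[OF p e, of "P \<epsilon> s (x + 0)" "P \<epsilon> s (x + h)"] by simp
    show "1 * exp (- b * (x + h)) \<le> 1 * exp (- b * (x + 0))" for x
      using h b_pos by simp
  qed
  then show ?thesis by simp
qed

text \<open>The nonlinear terms are compared in two moves: lower \<epsilon> at the same flux by
  monotonicity, then change the flux with the Lipschitz constant of the smaller \<epsilon>.\<close>

lemma Z_mono_eps:
  assumes e: "\<epsilon>1 > 0" "\<epsilon>1 \<le> \<epsilon>2" and s: "0 \<le> s" "s \<le> S"
  shows "Z \<epsilon>1 s x \<le> Z \<epsilon>2 s x"
proof -
  have e2: "\<epsilon>2 > 0" using e by simp
  have "1 * Z \<epsilon>1 s (x + 0) \<le> 1 * Z \<epsilon>2 s (x + 0)"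
  proof (rule comparison[OF e(1) e2 _ _ _ s])
    show "0 \<le> p * \<epsilon>1 powr (p - 1)" using p by simp
    show "- (p * \<epsilon>1 powr (p - 1)) * \<bar>1 * P \<epsilon>2 s (x + 0) - 1 * P \<epsilon>1 s (x + 0)\<bar> \<le>
        1 * reg_pow p \<epsilon>2 (P \<epsilon>2 s (x + 0)) - 1 * reg_pow p \<epsilon>1 (P \<epsilon>1 s (x + 0))" for s x
      using reg_pow_lipschitz[OF p e(1), of "P \<epsilon>2 s x" "P \<epsilon>1 s x"]
        reg_pow_mono_eps[OF p(1) e, of "P \<epsilon>2 s x"] by simp
  qed simp
  then show ?thesis by simp
qed

text \<open>The right-hand side has the same initial values and is a supersolution by
  \<open>reg_pow_scale\<close>. It says that exp (b x) times the solution is nondecreasing in x,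
  which bounds the derivative from below.\<close>

lemma Z_scale:
  assumes e: "\<epsilon> > 0" and s: "0 \<le> s" "s \<le> S" and h: "0 \<le> h"
  shows "Z \<epsilon> s x \<le> exp (b * h) * Z \<epsilon> s (x + h)"
proof -
  have "1 * Z \<epsilon> s (x + 0) \<le> exp (b * h) * Z \<epsilon> s (x + h)"
  proof (rule comparison[OF e e _ _ _ s])
    show "0 \<le> p * \<epsilon> powr (p - 1)" using p by simp
    show "- (p * \<epsilon> powr (p - 1)) * \<bar>exp (b * h) * P \<epsilon> s (x + h) - 1 * P \<epsilon> s (x + 0)\<bar> \<le>
        exp (b * h) * reg_pow p \<epsilon> (P \<epsilon> s (x + h)) - 1 * reg_pow p \<epsilon> (P \<epsilon> s (x + 0))" for s x
    proof -
      have "reg_pow p \<epsilon> (exp (b * h) * P \<epsilon> s (x + h)) \<le> exp (b * h) * reg_pow p \<epsilon> (P \<epsilon> s (x + h))"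
        using h b_pos by (intro reg_pow_scale p e) auto
      then show ?thesis
        using reg_pow_lipschitz[OF p e, of "exp (b * h) * P \<epsilon> s (x + h)" "P \<epsilon> s x"] by simp
    qed
    show "1 * exp (- b * (x + 0)) \<le> exp (b * h) * exp (- b * (x + h))" for x
      by (simp add: algebra_simps flip: exp_add)
  qed
  then show ?thesis by simp
qed

lemma src_nonneg:
  assumes "\<epsilon> > 0" "0 \<le> r" "r \<le> S"
  shows "0 \<le> src \<epsilon> r x"
  unfolding src(2)[OF assms] using c_pos[of r] by (simp add: reg_pow_nonneg)

lemma Z_lower:
  assumes e: "\<epsilon> > 0" and s: "0 \<le> s" "s \<le> S"
  shows "exp (b\<^sup>2 * s) * exp (- b * x) \<le> Z \<epsilon> s x"
proof -
  have "0 \<le> duhamel 0 (src \<epsilon>) s x" by (rule duhamel_0_nonneg[OF s(2) src_nonneg[OF e]])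
  then show ?thesis by (simp add: sol_def)
qed

text \<open>Infinitesimal form of the two monotonicity statements: Z decreases in x, while exp (b x)
  Z increases, so Zx lies between -b Z and 0.\<close>

lemma P_bounds:
  assumes e: "\<epsilon> > 0" and s: "0 \<le> s" "s \<le> S"
  shows "a * Z \<epsilon> s x \<le> P \<epsilon> s x" "P \<epsilon> s x \<le> (a + b) * Z \<epsilon> s x"
proof -
  have "Zx \<epsilon> s x \<le> 0"
    by (rule derivative_nonpos_if_antimono[OF Z_props(2)[OF e s]]) (rule Z_antimono[OF e s])
  then show "a * Z \<epsilon> s x \<le> P \<epsilon> s x" by (simp add: flux_def)
  have "((\<lambda>y. - (exp (b * y) * Z \<epsilon> s y)) has_real_derivative - (exp (b * x) * (b * Z \<epsilon> s x + Zx \<epsilon> s x))) (at x)"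
    by (auto intro!: derivative_eq_intros Z_props(2)[OF e s] simp: algebra_simps)
  then have "- (exp (b * x) * (b * Z \<epsilon> s x + Zx \<epsilon> s x)) \<le> 0"
  proof (rule derivative_nonpos_if_antimono)
    fix h :: real assume "0 \<le> h"
    then have "exp (b * x) * Z \<epsilon> s x \<le> exp (b * x) * (exp (b * h) * Z \<epsilon> s (x + h))"
      by (intro mult_left_mono Z_scale[OF e s]) auto
    then show "- (exp (b * (x + h)) * Z \<epsilon> s (x + h)) \<le> - (exp (b * x) * Z \<epsilon> s x)"
      by (simp add: distrib_left exp_add)
  qed
  then have "0 \<le> b * Z \<epsilon> s x + Zx \<epsilon> s x" by (simp add: zero_le_mult_iff)
  then show "P \<epsilon> s x \<le> (a + b) * Z \<epsilon> s x" by (simp add: flux_def algebra_simps)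
qed

lemma P_nonneg:
  assumes e: "\<epsilon> > 0" and s: "0 \<le> s" "s \<le> S"
  shows "0 \<le> P \<epsilon> s x"
proof -
  have "0 \<le> a * Z \<epsilon> s x" using a_pos order_trans[OF _ Z_lower[OF e s]] by (intro mult_nonneg_nonneg) auto
  with P_bounds(1)[OF e s] show ?thesis by (rule order_trans[rotated])
qed

text \<open>The power is at most one plus its base, the flux at most (a + b) Z, and Z for \<epsilon>
  \<le> 1 lies below the solution with \<epsilon> = 1. So a bound for that single solution serves
  all \<epsilon>.\<close>

lemma src_uniform: "\<exists>C. \<forall>\<epsilon>. 0 < \<epsilon> \<and> \<epsilon> \<le> 1 \<longrightarrow> heat_source S b C (src \<epsilon>)"
proof -
  obtain A where A: "A \<ge> 0" "\<And>s x. 0 \<le> s \<Longrightarrow> s \<le> S \<Longrightarrow> \<bar>Z 1 s x\<bar> \<le> A * cosh (b * x)"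
    using Z_props(5)[of 1] by auto
  have "heat_source S b (cM * (2 + (a + b) * A)) (src \<epsilon>)" if e: "0 < \<epsilon>" "\<epsilon> \<le> 1" for \<epsilon>
  proof
    obtain C where "heat_source S b C (src \<epsilon>)" using src(1)[OF e(1)] by blast
    then show "(\<lambda>(r, \<xi>). src \<epsilon> r \<xi>) \<in> borel_measurable (borel \<Otimes>\<^sub>M borel)" by (rule heat_source.h_meas)
    show "\<bar>src \<epsilon> r x\<bar> \<le> cM * (2 + (a + b) * A) * cosh (b * x)" if r: "0 \<le> r" "r \<le> S" for r x
    proof -
      have P0: "0 \<le> P \<epsilon> r x" by (rule P_nonneg[OF e(1) r])
      have "reg_pow p \<epsilon> (P \<epsilon> r x) \<le> 1 + (P \<epsilon> r x + \<epsilon>)"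
      proof (cases "P \<epsilon> r x + \<epsilon> \<le> 1")
        case True
        then have "(P \<epsilon> r x + \<epsilon>) powr p \<le> 1" using P0 e p by (intro powr_le1) auto
        then show ?thesis using P0 e unfolding reg_pow_def by (simp add: max_absorb1)
      next
        case False
        then have "(P \<epsilon> r x + \<epsilon>) powr p \<le> (P \<epsilon> r x + \<epsilon>) powr 1" using p by (intro powr_mono) auto
        then show ?thesis using P0 e False unfolding reg_pow_def by (simp add: max_absorb1)
      qed
      also have "\<dots> \<le> 2 + (a + b) * Z 1 r x"
        using P_bounds(2)[OF e(1) r, of x] mult_left_mono[OF Z_mono_eps[OF e r, of x], of "a + b"] a_pos b_pos e by linarith
      also have "\<dots> \<le> 2 * cosh (b * x) + (a + b) * (A * cosh (b * x))"
        using A(2)[OF r, of x] a_pos b_pos cosh_real_ge_1[of "b * x"] by (intro add_mono mult_left_mono) auto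
      finally have "c r * reg_pow p \<epsilon> (P \<epsilon> r x) \<le> cM * (2 * cosh (b * x) + (a + b) * (A * cosh (b * x)))"
        using c_le[OF r] c_pos[of r] cM_pos by (intro mult_mono reg_pow_nonneg) auto
      then show ?thesis
        using src_nonneg[OF e(1) r, of x] unfolding src(2)[OF e(1) r] by (simp add: algebra_simps)
    qed
  qed (rule S_pos)
  then show ?thesis by blast
qed

text \<open>The source of the limit is the pointwise limit of the regularised sources; it inherits
  their common bound C. Dominated convergence in the potentials then identifies the limits of the
  solutions and fluxes with those built from this source, which closes the equation.\<close>

lemma limit_solution:
  obtains h C where "heat_source S b C h"
    "\<And>r x. 0 \<le> r \<Longrightarrow> r \<le> S \<Longrightarrow> h r x = c r * flux a b h r x powr p"
    "\<And>s x. 0 \<le> s \<Longrightarrow> s \<le> S \<Longrightarrow> exp (b\<^sup>2 * s) * exp (- b * x) \<le> sol b h s x"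
    "\<And>s x. 0 \<le> s \<Longrightarrow> s \<le> S \<Longrightarrow> a * sol b h s x \<le> flux a b h s x"
    "\<And>s x y. 0 \<le> s \<Longrightarrow> s \<le> S \<Longrightarrow> 0 \<le> y \<Longrightarrow> sol b h s (x + y) \<le> sol b h s x"
proof -
  define e where "e n = inverse (real (Suc n))" for n
  have e: "0 < e n" "e n \<le> 1" "m \<le> n \<Longrightarrow> e n \<le> e m" for m n
    by (auto simp: e_def field_simps)
  have e0: "e \<longlonglongrightarrow> 0" unfolding e_def by (rule LIMSEQ_inverse_real_of_nat)
  obtain C where C: "\<And>n. heat_source S b C (src (e n))" using src_uniform e by blast
  interpret h0: heat_source S b C "src (e 0)" by (rule C)
  define A where "A = h0.A"
  have convZ: "convergent (\<lambda>n. Z (e n) s x)" if s: "0 \<le> s" "s \<le> S" for s x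
  proof (rule Bseq_monoseq_convergent)
    show "monoseq (\<lambda>n. Z (e n) s x)"
      unfolding monoseq_def using Z_mono_eps[OF e(1) e(3) s] by blast
    show "Bseq (\<lambda>n. Z (e n) s x)"
    proof (rule BseqI')
      show "norm (Z (e n) s x) \<le> A * cosh (b * x)" for n
        using heat_source.sol_estimates(1)[OF C s, of n x] by (simp add: A_def)
    qed
  qed
  have convZx: "convergent (\<lambda>n. Zx (e n) s x)" if s: "0 \<le> s" "s \<le> S" for s x
  proof (rule derivatives_converge[where f = "\<lambda>n. Z (e n) s" and K = "A * (cosh (b * x) * exp \<bar>b\<bar> + cosh (b * x)) + 1"])
    show "(Z (e n) s has_real_derivative Zx (e n) s y) (at y)" for n y by (rule Z_props(2)[OF e(1) s])
    show "convergent (\<lambda>n. Z (e n) s y)" for y by (rule convZ[OF s])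
    have A0: "A \<ge> 0" unfolding A_def by (rule h0.A_nonneg)
    then show "0 < A * (cosh (b * x) * exp \<bar>b\<bar> + cosh (b * x)) + 1" by (intro add_nonneg_pos mult_nonneg_nonneg) auto
    show "\<bar>Zx (e n) s y - Zx (e n) s x\<bar> \<le> (A * (cosh (b * x) * exp \<bar>b\<bar> + cosh (b * x)) + 1) * sqrt \<bar>y - x\<bar>"
      if "\<bar>y - x\<bar> \<le> 1" for n y
    proof -
      have "cosh (b * y) \<le> exp \<bar>b * (y - x)\<bar> * cosh (b * x)" using cosh_shift_le[of b x "y - x"] by simp
      also have "\<dots> \<le> exp \<bar>b\<bar> * cosh (b * x)"
        using that by (intro mult_right_mono) (auto simp: abs_mult intro: mult_left_le)
      finally have "A * sqrt \<bar>y - x\<bar> * (cosh (b * y) + cosh (b * x)) \<le> A * sqrt \<bar>y - x\<bar> * (cosh (b * x) * exp \<bar>b\<bar> + cosh (b * x))"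
        using A0 by (intro mult_left_mono) (auto simp: mult.commute)
      moreover have "\<bar>Zx (e n) s y - Zx (e n) s x\<bar> \<le> A * sqrt \<bar>y - x\<bar> * (cosh (b * y) + cosh (b * x))"
        using heat_source.sol_x_estimates(2)[OF C s, of n y x] by (simp add: A_def)
      moreover have "0 \<le> sqrt \<bar>y - x\<bar>" by simp
      moreover have "(A * (cosh (b * x) * exp \<bar>b\<bar> + cosh (b * x)) + 1) * sqrt \<bar>y - x\<bar> =
          A * sqrt \<bar>y - x\<bar> * (cosh (b * x) * exp \<bar>b\<bar> + cosh (b * x)) + sqrt \<bar>y - x\<bar>"
        by (simp add: algebra_simps)
      ultimately show ?thesis by linarith
    qed
  qed
  have convP: "(\<lambda>n. P (e n) s x) \<longlonglongrightarrow> lim (\<lambda>n. P (e n) s x)" if s: "0 \<le> s" "s \<le> S" for s x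
    unfolding convergent_LIMSEQ_iff[symmetric] flux_def[abs_def]
    by (intro convergent_diff convergent_mult convergent_const convZ[OF s] convZx[OF s])
  have convsrc: "(\<lambda>n. src (e n) r x) \<longlonglongrightarrow> c r * max (lim (\<lambda>n. P (e n) r x)) 0 powr p" if r: "0 \<le> r" "r \<le> S" for r x
  proof -
    \<comment> \<open>At this stage the limit flux might vanish; continuity of the power at 0 is
      used, which holds because p > 0 and the bases are nonnegative.\<close>
    have "(\<lambda>n. c r * (max (P (e n) r x) 0 + e n) powr p) \<longlonglongrightarrow> c r * (max (lim (\<lambda>n. P (e n) r x)) 0 + 0) powr p"
    proof (intro tendsto_intros tendsto_powr' convP[OF r] e0 tendsto_max)
      show "max (lim (\<lambda>n. P (e n) r x)) 0 + 0 \<noteq> 0 \<or> 0 < p \<and> (\<forall>\<^sub>F n in sequentially. 0 \<le> max (P (e n) r x) 0 + e n)"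
        using p(1) less_imp_le[OF e(1)] by (auto intro!: always_eventually add_nonneg_nonneg)
    qed
    then show ?thesis using src(2)[OF e(1) r] by (simp add: reg_pow_def)
  qed
  define h where "h r x = lim (\<lambda>n. src (e n) r x)" for r x
  have hlim: "(\<lambda>n. src (e n) r x) \<longlonglongrightarrow> h r x" if "0 \<le> r" "r \<le> S" for r x
    unfolding h_def using convsrc[OF that, of x] by (simp add: limI)
  have h: "heat_source S b C h"
  proof
    have "(\<lambda>z. src (e n) (fst z) (snd z)) \<in> borel_measurable (borel \<Otimes>\<^sub>M borel)" for n
      using heat_source.h_meas[OF C, of n] by (simp add: split_def)
    then have "(\<lambda>z. lim (\<lambda>n. src (e n) (fst z) (snd z))) \<in> borel_measurable (borel \<Otimes>\<^sub>M borel)"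
      by (rule borel_measurable_lim_metric)
    then show "(\<lambda>(r, \<xi>). h r \<xi>) \<in> borel_measurable (borel \<Otimes>\<^sub>M borel)" by (simp add: h_def split_def)
    show "\<bar>h r \<xi>\<bar> \<le> C * cosh (b * \<xi>)" if "0 \<le> r" "r \<le> S" for r \<xi>
      using tendsto_rabs[OF hlim[OF that]] by (rule LIMSEQ_le_const2) (use heat_source.h_bound[OF C that] in auto)
  qed (rule S_pos)
  have dl: "(\<lambda>m. duhamel n (src (e m)) s x) \<longlonglongrightarrow> duhamel n h s x" if "0 \<le> s" "s \<le> S" "n \<le> 1" for n s x
    by (rule duhamel_convergence[OF C h hlim that])
  have Zl: "(\<lambda>n. Z (e n) s x) \<longlonglongrightarrow> sol b h s x" if "0 \<le> s" "s \<le> S" for s x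
    unfolding sol_def by (intro tendsto_intros dl that) simp
  have Zxl: "(\<lambda>n. Zx (e n) s x) \<longlonglongrightarrow> sol_x b h s x" if "0 \<le> s" "s \<le> S" for s x
    unfolding sol_x_def by (intro tendsto_intros dl that) simp
  have Pl: "(\<lambda>n. P (e n) s x) \<longlonglongrightarrow> flux a b h s x" if "0 \<le> s" "s \<le> S" for s x
    unfolding flux_def by (intro tendsto_intros Zl Zxl that)
  have P0: "0 \<le> flux a b h s x" if "0 \<le> s" "s \<le> S" for s x
    using Pl[OF that] by (rule LIMSEQ_le_const) (use P_nonneg[OF e(1) that] in auto)
  show ?thesis
  proof (rule that[OF h])
    show "h r x = c r * flux a b h r x powr p" if r: "0 \<le> r" "r \<le> S" for r x
    proof -
      have "h r x = c r * max (lim (\<lambda>n. P (e n) r x)) 0 powr p"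
        by (rule LIMSEQ_unique[OF hlim[OF r] convsrc[OF r]])
      also have "lim (\<lambda>n. P (e n) r x) = flux a b h r x" using Pl[OF r] by (rule limI)
      finally show ?thesis using P0[OF r, of x] by (simp add: max_absorb1)
    qed
    show "exp (b\<^sup>2 * s) * exp (- b * x) \<le> sol b h s x" if s: "0 \<le> s" "s \<le> S" for s x
      using Zl[OF s] by (rule LIMSEQ_le_const) (use Z_lower[OF e(1) s] in auto)
    show "a * sol b h s x \<le> flux a b h s x" if s: "0 \<le> s" "s \<le> S" for s x
      using tendsto_mult_left[OF Zl[OF s]] Pl[OF s] by (rule LIMSEQ_le) (use P_bounds(1)[OF e(1) s] in auto)
    show "sol b h s (x + y) \<le> sol b h s x" if s: "0 \<le> s" "s \<le> S" and y: "0 \<le> y" for s x y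
      using Zl[OF s] Zl[OF s] by (rule LIMSEQ_le) (use Z_antimono[OF e(1) s y] in auto)
  qed
qed

end

section \<open>Classical regularity\<close>

lemma integral_pos_lborel:
  fixes f :: "real \<Rightarrow> real"
  assumes f: "integrable lborel f" and nn: "\<And>x. 0 \<le> f x" and pos: "\<And>x. x \<in> {u<..<v} \<Longrightarrow> 0 < f x" and uv: "u < v"
  shows "0 < (\<integral>x. f x \<partial>lborel)"
proof -
  have "(\<integral>x. f x \<partial>lborel) \<noteq> 0"
  proof
    assume "(\<integral>x. f x \<partial>lborel) = 0"
    then have "AE x in lborel. f x = 0" using integral_nonneg_eq_0_iff_AE[OF f] nn by auto
    then have "AE x in lborel. x \<notin> {u<..<v}"
    proof eventually_elim
      case (elim x) then show ?case using pos[of x] by fastforce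
    qed
    then have "{u<..<v} \<in> null_sets lborel" by (subst AE_iff_null_sets) auto
    then show False using uv by (simp add: null_sets_def)
  qed
  moreover have "0 \<le> (\<integral>x. f x \<partial>lborel)" using nn by (intro Bochner_Integration.integral_nonneg)
  ultimately show ?thesis by simp
qed

text \<open>A product of two weights is absorbed into the weight with the summed frequency; this is
  how 2b and 3b arise.\<close>

lemma cosh_mult_le:
  fixes u v :: real
  assumes "0 \<le> u * v"
  shows "cosh u * cosh v \<le> cosh (u + v)"
proof -
  have "0 \<le> sinh u * sinh v"
    using assms by (auto simp: zero_le_mult_iff)
  then show ?thesis by (simp add: cosh_add)
qed

lemma cosh_mono_freq:
  fixes k l x :: real
  assumes "0 \<le> k" "k \<le> l"
  shows "cosh (k * x) \<le> cosh (l * x)"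
proof -
  have "0 \<le> (k * x) * ((l - k) * x)"
  proof -
    have "(k * x) * ((l - k) * x) = k * (l - k) * (x * x)" by simp
    also have "0 \<le> \<dots>"
      by (rule mult_nonneg_nonneg[OF mult_nonneg_nonneg zero_le_square]) (use assms in auto)
    finally show ?thesis .
  qed
  from cosh_mult_le[OF this] have 1: "cosh (k * x) * cosh ((l - k) * x) \<le> cosh (l * x)"
    by (simp add: algebra_simps)
  have "cosh (k * x) * 1 \<le> cosh (k * x) * cosh ((l - k) * x)"
    by (intro mult_left_mono) (auto intro: cosh_real_ge_1)
  from order_trans[OF this 1] show ?thesis by simp
qed

text \<open>Turns the lower bound by the linear evolution into a strict one at positive
  times.\<close>

lemma (in heat_source) duhamel_0_pos:
  assumes h: "\<And>r \<xi>. 0 \<le> r \<Longrightarrow> r \<le> S \<Longrightarrow> 0 < h r \<xi>" and s: "0 < s" "s \<le> S"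
  shows "0 < duhamel 0 h s x"
  unfolding duhamel_def
proof (rule integral_pos_lborel[where u = 0 and v = s])
  have pos: "0 < heat_conv 0 (s - r) (h r) x" if "0 < r" "r < s" for r
    unfolding heat_conv_def
  proof (rule integral_pos_lborel[where u = 0 and v = 1])
    show "integrable lborel (\<lambda>\<xi>. heat 0 (s - r) (x - \<xi>) * h r \<xi>)"
      using that s by (intro heat_conv_integrable[OF _ h_bound]) auto
    show "0 \<le> heat 0 (s - r) (x - \<xi>) * h r \<xi>" for \<xi>
      using that s h[of r \<xi>] heat_0_pos[of "s - r" "x - \<xi>"] by (intro mult_nonneg_nonneg) auto
    show "0 < heat 0 (s - r) (x - \<xi>) * h r \<xi>" for \<xi>
      using that s h[of r \<xi>] heat_0_pos[of "s - r" "x - \<xi>"] by (intro mult_pos_pos) auto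
  qed simp
  show "integrable lborel (\<lambda>r. indicator {0<..<s} r * heat_conv 0 (s - r) (h r) x)"
    using s by (intro duhamel_source_bound(1)) auto
  show "0 \<le> indicator {0<..<s} r * heat_conv 0 (s - r) (h r) x" for r
    using pos[of r] by (cases "r \<in> {0<..<s}") auto
  show "0 < indicator {0<..<s} r * heat_conv 0 (s - r) (h r) x" if "r \<in> {0<..<s}" for r
    using pos[of r] that by auto
qed (rule s(1))

lemma weighted_holder_combine:
  fixes u :: "real \<Rightarrow> real \<Rightarrow> real"
  assumes x: "\<And>s x y. 0 \<le> s \<Longrightarrow> s \<le> S \<Longrightarrow> \<bar>u s x - u s y\<bar> \<le> A * sqrt \<bar>x - y\<bar> * (cosh (k * x) + cosh (k * y))"
    and t: "\<And>s t x. 0 \<le> s \<Longrightarrow> s \<le> S \<Longrightarrow> 0 \<le> t \<Longrightarrow> t \<le> S \<Longrightarrow> \<bar>u s x - u t x\<bar> \<le> A * cosh (k * x) * \<bar>s - t\<bar> powr (1/4)"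
    and A: "0 \<le> A" "A \<le> A'" and k: "0 \<le> k" "k \<le> k'"
    and st: "0 \<le> s" "s \<le> S" "0 \<le> t" "t \<le> S"
  shows "\<bar>u s x - u t y\<bar> \<le> A' * (cosh (k' * x) + cosh (k' * y)) * (\<bar>s - t\<bar> powr (1/4) + \<bar>x - y\<bar> powr (1/2))"
proof -
  have "\<bar>u s x - u t y\<bar> \<le> \<bar>u s x - u s y\<bar> + \<bar>u s y - u t y\<bar>" by linarith
  also have "\<dots> \<le> A * sqrt \<bar>x - y\<bar> * (cosh (k * x) + cosh (k * y)) + A * cosh (k * y) * \<bar>s - t\<bar> powr (1/4)"
    by (intro add_mono x t st)
  also have "\<dots> \<le> A * sqrt \<bar>x - y\<bar> * (cosh (k * x) + cosh (k * y)) + A * (cosh (k * x) + cosh (k * y)) * \<bar>s - t\<bar> powr (1/4)"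
    using A by (intro add_left_mono mult_right_mono mult_left_mono) auto
  also have "\<dots> = A * (cosh (k * x) + cosh (k * y)) * (\<bar>s - t\<bar> powr (1/4) + \<bar>x - y\<bar> powr (1/2))"
    by (simp add: powr_half_sqrt algebra_simps)
  also have "\<dots> \<le> A' * (cosh (k' * x) + cosh (k' * y)) * (\<bar>s - t\<bar> powr (1/4) + \<bar>x - y\<bar> powr (1/2))"
    using A by (intro mult_right_mono mult_mono add_mono cosh_mono_freq k) auto
  finally show ?thesis .
qed

context power_problem
begin

text \<open>The weight grows with each use of the derivative of the power. The flux is controlled
  with weight b, its power is Hoelder continuous with weight 2b, and the space derivative of the
  source is bounded with weight 3b; the single k in the conclusion is 3b.\<close>

lemma classical_solution:
  obtains u ux uxx :: "real \<Rightarrow> real \<Rightarrow> real" and k K :: real where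
    "\<And>s x. 0 \<le> s \<Longrightarrow> s \<le> S \<Longrightarrow> (u s has_real_derivative ux s x) (at x)"
    "\<And>s x. 0 \<le> s \<Longrightarrow> s \<le> S \<Longrightarrow> (ux s has_real_derivative uxx s x) (at x)"
    "\<And>s x. 0 \<le> s \<Longrightarrow> s \<le> S \<Longrightarrow> ((\<lambda>s. u s x) has_real_derivative
       uxx s x + c s * (a * u s x - ux s x) powr p) (at s within {0..S})"
    "\<And>x. u 0 x = exp (- b * x)"
    "\<And>s x. 0 < s \<Longrightarrow> s \<le> S \<Longrightarrow> exp (b\<^sup>2 * s) * exp (- b * x) < u s x"
    "\<And>s x. 0 \<le> s \<Longrightarrow> s \<le> S \<Longrightarrow> 0 < u s x"
    "\<And>s x. 0 \<le> s \<Longrightarrow> s \<le> S \<Longrightarrow> ux s x \<le> 0"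
    "\<And>s x y. 0 \<le> s \<Longrightarrow> s \<le> S \<Longrightarrow> 0 \<le> y \<Longrightarrow> u s (x + y) \<le> u s x"
    "\<And>s x. 0 \<le> s \<Longrightarrow> s \<le> S \<Longrightarrow> u s x \<le> K * cosh (b * x)"
    "\<And>v s t x y. v \<in> {u, ux, uxx} \<Longrightarrow> 0 \<le> s \<Longrightarrow> s \<le> S \<Longrightarrow> 0 \<le> t \<Longrightarrow> t \<le> S \<Longrightarrow>
       \<bar>v s x - v t y\<bar> \<le> K * (cosh (k * x) + cosh (k * y)) * (\<bar>s - t\<bar> powr (1/4) + \<bar>x - y\<bar> powr (1/2))"
    "K \<ge> 0"
proof -
  obtain h C where hs: "heat_source S b C h"
    and heq: "\<And>r x. 0 \<le> r \<Longrightarrow> r \<le> S \<Longrightarrow> h r x = c r * flux a b h r x powr p"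
    and low: "\<And>s x. 0 \<le> s \<Longrightarrow> s \<le> S \<Longrightarrow> exp (b\<^sup>2 * s) * exp (- b * x) \<le> sol b h s x"
    and fl: "\<And>s x. 0 \<le> s \<Longrightarrow> s \<le> S \<Longrightarrow> a * sol b h s x \<le> flux a b h s x"
    and anti: "\<And>s x y. 0 \<le> s \<Longrightarrow> s \<le> S \<Longrightarrow> 0 \<le> y \<Longrightarrow> sol b h s (x + y) \<le> sol b h s x"
    by (rule limit_solution) blast
  interpret h: heat_source S b C h by (rule hs)
  define A where "A = h.A"
  have A: "A \<ge> 0" unfolding A_def by (rule h.A_nonneg)
  \<comment> \<open>Dominates the derivative of the power: with m the reciprocal of a exp (- b x),
    m^(1 - p) \<le> 1 + m, and m \<le> (2 / a) cosh (b x).\<close>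
  define W where "W = 1 + 2 / a"
  have W: "W > 0" using a_pos by (simp add: W_def add_pos_pos)
  have spos: "0 < sol b h s x" if "0 \<le> s" "s \<le> S" for s x
    by (rule less_le_trans[OF _ low[OF that]]) simp
  have Plow: "a * exp (- b * x) \<le> flux a b h s x" if s: "0 \<le> s" "s \<le> S" for s x
  proof -
    have "1 * exp (- b * x) \<le> exp (b\<^sup>2 * s) * exp (- b * x)" using s by (intro mult_right_mono) auto
    from order_trans[OF this low[OF s]] have "exp (- b * x) \<le> sol b h s x" by simp
    then have "a * exp (- b * x) \<le> a * sol b h s x" using a_pos by (intro mult_left_mono) auto
    then show ?thesis using fl[OF s, of x] by simp
  qed
  have Ppos: "0 < flux a b h s x" if s: "0 \<le> s" "s \<le> S" for s x
    by (rule less_le_trans[OF _ Plow[OF s]]) (use a_pos in simp)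
  have pw: "(a * exp (- b * x)) powr (p - 1) \<le> W * cosh (b * x)" for x
  proof -
    define m where "m = inverse (a * exp (- b * x))"
    have m: "m > 0" "m = exp (b * x) / a" using a_pos by (auto simp: m_def exp_minus field_simps)
    have "(a * exp (- b * x)) powr (p - 1) = m powr (1 - p)"
    proof -
      have "m = (a * exp (- b * x)) powr (- 1)"
        unfolding m_def powr_minus using a_pos by (subst powr_one) auto
      then have "m powr (1 - p) = (a * exp (- b * x)) powr (- 1 * (1 - p))" by (simp only: powr_powr)
      then show ?thesis by simp
    qed
    also have "\<dots> \<le> 1 + m"
    proof (cases "m \<le> 1")
      case True
      then have "m powr (1 - p) \<le> 1" using m p by (intro powr_le1) auto
      then show ?thesis using m by simp
    next
      case False
      then have "m powr (1 - p) \<le> m powr 1" using p by (intro powr_mono) auto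
      then show ?thesis using False by simp
    qed
    also have "m \<le> 2 / a * cosh (b * x)"
    proof -
      have "exp (b * x) \<le> 2 * cosh (b * x)" by (simp add: cosh_def)
      then show ?thesis using a_pos unfolding m(2) by (simp add: field_simps)
    qed
    also have "1 + 2 / a * cosh (b * x) \<le> W * cosh (b * x)"
      using cosh_real_ge_1[of "b * x"] by (simp add: W_def algebra_simps)
    finally show ?thesis by simp
  qed
  \<comment> \<open>Collects the bound cM for c, the Lipschitz constant p W of the power, the
    Hoelder constant of the flux, and a factor 2 from squaring a sum of two weights.\<close>
  define H where "H = cM * (p * W * ((\<bar>a\<bar> + 1) * A) * 2)"
  have hol: "\<bar>h r \<xi> - h r \<zeta>\<bar> \<le> H * sqrt \<bar>\<xi> - \<zeta>\<bar> * (cosh (2 * b * \<xi>) + cosh (2 * b * \<zeta>))"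
    if r: "0 \<le> r" "r \<le> S" for r \<xi> \<zeta>
  proof -
    define cs where "cs = cosh (b * \<xi>) + cosh (b * \<zeta>)"
    have cs: "cs \<ge> 0" by (simp add: cs_def)
    define m where "m = min (a * exp (- b * \<xi>)) (a * exp (- b * \<zeta>))"
    have m0: "0 < m" using a_pos by (simp add: m_def)
    have mp: "m powr (p - 1) \<le> W * cs"
    proof -
      have "m powr (p - 1) \<le> (a * exp (- b * \<xi>)) powr (p - 1) + (a * exp (- b * \<zeta>)) powr (p - 1)"
        unfolding m_def min_def by auto
      also have "\<dots> \<le> W * cs" using pw[of \<xi>] pw[of \<zeta>] by (simp add: cs_def algebra_simps)
      finally show ?thesis .
    qed
    have "\<bar>flux a b h r \<xi> powr p - flux a b h r \<zeta> powr p\<bar> \<le> p * m powr (p - 1) * \<bar>flux a b h r \<xi> - flux a b h r \<zeta>\<bar>"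
      using Plow[OF r, of \<xi>] Plow[OF r, of \<zeta>] by (intro powr_lipschitz p m0) (auto simp: m_def)
    also have "\<dots> \<le> p * (W * cs) * ((\<bar>a\<bar> + 1) * A * sqrt \<bar>\<xi> - \<zeta>\<bar> * cs)"
      using p W cs h.flux_estimates(2)[OF r, of a \<xi> \<zeta>]
      by (intro mult_mono mp) (auto simp: cs_def A_def)
    also have "\<dots> = (p * W * ((\<bar>a\<bar> + 1) * A) * sqrt \<bar>\<xi> - \<zeta>\<bar>) * (cs * cs)" by simp
    also have "\<dots> \<le> (p * W * ((\<bar>a\<bar> + 1) * A) * sqrt \<bar>\<xi> - \<zeta>\<bar>) * (2 * (cosh (2 * b * \<xi>) + cosh (2 * b * \<zeta>)))"
    proof (rule mult_left_mono)
      have sq: "cosh (b * z) * cosh (b * z) \<le> cosh (2 * b * z)" for z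
        using cosh_mult_le[OF zero_le_square[of "b * z"]] by (simp add: mult.assoc)
      have "0 \<le> (cosh (b * \<xi>) - cosh (b * \<zeta>)) * (cosh (b * \<xi>) - cosh (b * \<zeta>))" by simp
      then have "cs * cs \<le> 2 * (cosh (b * \<xi>) * cosh (b * \<xi>) + cosh (b * \<zeta>) * cosh (b * \<zeta>))"
        by (simp add: cs_def algebra_simps)
      then show "cs * cs \<le> 2 * (cosh (2 * b * \<xi>) + cosh (2 * b * \<zeta>))" by (rule order_trans[OF _ mult_left_mono[OF add_mono[OF sq sq]]]) simp
    qed (use p W A in auto)
    finally have "c r * \<bar>flux a b h r \<xi> powr p - flux a b h r \<zeta> powr p\<bar> \<le>
        cM * ((p * W * ((\<bar>a\<bar> + 1) * A) * sqrt \<bar>\<xi> - \<zeta>\<bar>) * (2 * (cosh (2 * b * \<xi>) + cosh (2 * b * \<zeta>))))"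
      using c_le[OF r] c_pos[of r] cM_pos by (intro mult_mono) auto
    moreover have "\<bar>h r \<xi> - h r \<zeta>\<bar> = c r * \<bar>flux a b h r \<xi> powr p - flux a b h r \<zeta> powr p\<bar>"
      unfolding heq[OF r] using c_pos[of r] by (simp add: abs_mult flip: right_diff_distrib)
    ultimately show ?thesis by (simp add: H_def algebra_simps)
  qed
  have hcont: "continuous_on {0..S} (\<lambda>r. h r \<xi>)" for \<xi>
  proof -
    have "continuous_on {0..S} (\<lambda>r. (\<lambda>(s, x). flux a b h s x) (r, \<xi>))"
      by (rule continuous_on_compose2[OF h.continuous_on_flux]) (auto intro!: continuous_intros)
    then have "continuous_on {0..S} (\<lambda>r. c r * flux a b h r \<xi> powr p)"
      by (intro continuous_intros continuous_on_subset[OF c_cont]) (auto simp: less_imp_neq[OF Ppos, symmetric])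
    then show ?thesis by (rule continuous_on_eq) (simp add: heq)
  qed
  \<comment> \<open>The same source read with the larger weight: this gives access to the second
    derivative of the potential, while \<open>sol\<close> keeps the datum with rate b.\<close>
  interpret q: holder_source S "2 * b" C h H
  proof
    show "\<bar>h r \<xi>\<bar> \<le> C * cosh (2 * b * \<xi>)" if r: "0 \<le> r" "r \<le> S" for r \<xi>
      using h.h_bound[OF r, of \<xi>] mult_left_mono[OF cosh_mono_freq[of b "2 * b" \<xi>] h.C_nonneg] b_pos by simp
    show "0 \<le> H" using cM_pos p W A by (simp add: H_def)
  qed (use S_pos h.h_meas hol hcont in auto)
  have dx: "(sol b h s has_real_derivative sol_x b h s x) (at x)" if s: "0 \<le> s" "s \<le> S" for s x
    by (rule h.sol_deriv_space[OF s])
  have dxx: "(sol_x b h s has_real_derivative sol_xx b h s x) (at x)" if s: "0 \<le> s" "s \<le> S" for s x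
    unfolding sol_x_def[abs_def] sol_xx_def
    by (auto intro!: derivative_eq_intros q.duhamel_1_deriv_space[OF s, unfolded One_nat_def] simp: power2_eq_square)
  have dt: "((\<lambda>s. sol b h s x) has_real_derivative h s x + sol_xx b h s x) (at s within {0..S})" if s: "0 \<le> s" "s \<le> S" for s x
    unfolding sol_def sol_xx_def using s
    by (auto intro!: derivative_eq_intros q.duhamel_deriv_time)
  define Px where "Px s x = a * sol_x b h s x - sol_xx b h s x" for s x
  have dP: "(flux a b h s has_real_derivative Px s x) (at x)" if s: "0 \<le> s" "s \<le> S" for s x
    unfolding flux_def[abs_def] Px_def by (intro DERIV_diff DERIV_cmult dx dxx s)
  \<comment> \<open>The space derivative of the source by the chain rule. It grows like cosh (b x)
    from the power times cosh (2 b x) from \<open>Px\<close>, hence the weight 3b.\<close>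
  define g where "g r x = c r * (p * flux a b h r x powr (p - 1) * Px r x)" for r x
  have dh: "(h r has_real_derivative g r x) (at x)" if r: "0 \<le> r" "r \<le> S" for r x
  proof -
    have "((\<lambda>x. flux a b h r x powr p) has_real_derivative p * flux a b h r x powr (p - 1) * Px r x) (at x)"
      by (rule DERIV_chain2[OF has_real_derivative_powr[OF Ppos[OF r]] dP[OF r]])
    from DERIV_cmult[OF this, of "c r"] have "((\<lambda>x. c r * flux a b h r x powr p) has_real_derivative g r x) (at x)"
      by (simp add: g_def)
    moreover have "(\<lambda>x. c r * flux a b h r x powr p) = h r" using heq[OF r] by auto
    ultimately show ?thesis by simp
  qed
  define N where "N = a * A + (b\<^sup>2 * (exp (b\<^sup>2 * S) * 2) + 4 * q.B * S powr (1/4))"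
  have Pxb: "\<bar>Px s x\<bar> \<le> N * cosh (2 * b * x)" if s: "0 \<le> s" "s \<le> S" for s x
  proof -
    have cm: "cosh (b * x) \<le> cosh (2 * b * x)" using b_pos by (intro cosh_mono_freq) auto
    have "\<bar>sol_x b h s x\<bar> \<le> A * cosh (2 * b * x)"
      using h.sol_x_estimates(1)[OF s, of x] mult_left_mono[OF cm A] by (simp add: A_def)
    then have 1: "a * \<bar>sol_x b h s x\<bar> \<le> a * (A * cosh (2 * b * x))" using a_pos by (intro mult_left_mono) auto
    have "\<bar>exp (b\<^sup>2 * s) * exp (- b * x)\<bar> \<le> exp (b\<^sup>2 * S) * 2 * cosh (2 * b * x)"
      by (rule order_trans[OF h.exp_part_estimates(1)[OF s] mult_left_mono[OF cm]]) simp
    then have 2: "b\<^sup>2 * \<bar>exp (b\<^sup>2 * s) * exp (- b * x)\<bar> \<le> b\<^sup>2 * (exp (b\<^sup>2 * S) * 2 * cosh (2 * b * x))"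
      by (intro mult_left_mono) auto
    have "\<bar>duhamel 2 h s x\<bar> \<le> 4 * (q.B * cosh (2 * b * x)) * s powr (1/4)" by (rule q.duhamel_2_bound(2)[OF s])
    also have "\<dots> \<le> 4 * (q.B * cosh (2 * b * x)) * S powr (1/4)"
      using s q.B_nonneg by (intro mult_left_mono powr_mono2) auto
    finally have 3: "\<bar>duhamel 2 h s x\<bar> \<le> 4 * (q.B * cosh (2 * b * x)) * S powr (1/4)" .
    have "\<bar>sol_xx b h s x\<bar> \<le> b\<^sup>2 * \<bar>exp (b\<^sup>2 * s) * exp (- b * x)\<bar> + \<bar>duhamel 2 h s x\<bar>"
      unfolding sol_xx_def by (rule order_trans[OF abs_triangle_ineq]) (simp add: abs_mult)
    moreover have "\<bar>Px s x\<bar> \<le> a * \<bar>sol_x b h s x\<bar> + \<bar>sol_xx b h s x\<bar>"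
      unfolding Px_def using a_pos by (rule_tac order_trans[OF abs_triangle_ineq4]) (simp add: abs_mult)
    ultimately have "\<bar>Px s x\<bar> \<le> a * (A * cosh (2 * b * x)) + (b\<^sup>2 * (exp (b\<^sup>2 * S) * 2 * cosh (2 * b * x)) + 4 * (q.B * cosh (2 * b * x)) * S powr (1/4))"
      using 1 2 3 by linarith
    then show ?thesis by (simp add: N_def algebra_simps)
  qed
  have N: "N \<ge> 0"
    using a_pos A q.B_nonneg by (simp add: N_def)
  interpret g: heat_source S "3 * b" "cM * (p * W * N)" g
  proof
    show "(\<lambda>(r, \<xi>). g r \<xi>) \<in> borel_measurable (borel \<Otimes>\<^sub>M borel)"
    proof -
      have [measurable]: "c \<in> borel_measurable borel" using c_cont by (rule borel_measurable_continuous_onI)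
      show ?thesis
        unfolding g_def Px_def flux_def sol_def sol_x_def sol_xx_def split_def by measurable
    qed
    show "\<bar>g r x\<bar> \<le> cM * (p * W * N) * cosh (3 * b * x)" if r: "0 \<le> r" "r \<le> S" for r x
    proof -
      have "flux a b h r x powr (p - 1) \<le> (a * exp (- b * x)) powr (p - 1)"
        using Plow[OF r, of x] a_pos p by (intro powr_mono2') auto
      also have "\<dots> \<le> W * cosh (b * x)" by (rule pw)
      finally have f: "flux a b h r x powr (p - 1) \<le> W * cosh (b * x)" .
      have "(b * x) * (2 * b * x) = 2 * ((b * x) * (b * x))" by simp
      also have "0 \<le> \<dots>" by (rule mult_nonneg_nonneg[OF _ zero_le_square]) simp
      finally have nn: "0 \<le> (b * x) * (2 * b * x)" .
      have e: "b * x + 2 * b * x = 3 * b * x" by simp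
      from cosh_mult_le[OF nn] have c3: "cosh (b * x) * cosh (2 * b * x) \<le> cosh (3 * b * x)"
        unfolding e .
      have "\<bar>g r x\<bar> = c r * (p * flux a b h r x powr (p - 1) * \<bar>Px r x\<bar>)"
        using c_pos[of r] p by (simp add: g_def abs_mult)
      also have "\<dots> \<le> cM * (p * (W * cosh (b * x)) * (N * cosh (2 * b * x)))"
        using c_le[OF r] c_pos[of r] cM_pos p W by (intro mult_mono f Pxb[OF r]) auto
      also have "\<dots> = cM * (p * W * N) * (cosh (b * x) * cosh (2 * b * x))" by simp
      also have "\<dots> \<le> cM * (p * W * N) * cosh (3 * b * x)"
        using cM_pos p W N by (intro mult_left_mono c3) auto
      finally show ?thesis .
    qed
  qed (rule S_pos)
  \<comment> \<open>One derivative is moved from the kernel to the source, so the second derivative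
    of the solution becomes a gradient potential, to which the Hoelder estimates for n = 1 apply
    down to s = 0.\<close>
  have d21: "duhamel 2 h s x = duhamel 1 g s x" if s: "0 \<le> s" "s \<le> S" for s x
    unfolding duhamel_def
  proof (rule Bochner_Integration.integral_cong)
    fix r :: real
    show "indicator {0<..<s} r * heat_conv 2 (s - r) (h r) x = indicator {0<..<s} r * heat_conv 1 (s - r) (g r) x"
    proof (cases "r \<in> {0<..<s}")
      case True
      then have r: "0 \<le> r" "r \<le> S" "s - r > 0" using s by auto
      have "heat_conv (Suc 1) (s - r) (h r) x = heat_conv 1 (s - r) (g r) x"
        by (rule heat_conv_by_parts[OF _ g.h_bound[OF r(1,2)] dh[OF r(1,2)] h.h_bound[OF r(1,2)] r(3)]) auto
      then show ?thesis by (simp add: numeral_2_eq_2)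
    qed simp
  qed simp
  define D3 where "D3 = 4 * g.D * S powr (1/4) + (8 * g.D * S powr (1/4) + 2 * g.D * (1 + S))"
  define K1 where "K1 = b\<^sup>2 * exp (b\<^sup>2 * S) * (2 * sqrt \<bar>b\<bar> + 2 * b\<^sup>2 * (1 + S)) + D3"
  have D3: "4 * g.D * S powr (1/4) \<le> D3" "8 * g.D * S powr (1/4) + 2 * g.D * (1 + S) \<le> D3" "D3 \<ge> 0"
    using g.D_nonneg S_pos by (auto simp: D3_def)
  have K1: "K1 \<ge> 0" using D3 S_pos by (simp add: K1_def)
  have cm3: "cosh (b * x) \<le> cosh (3 * b * x)" for x using b_pos by (intro cosh_mono_freq) auto
  have xx_x: "\<bar>sol_xx b h s x - sol_xx b h s y\<bar> \<le> K1 * sqrt \<bar>x - y\<bar> * (cosh (3 * b * x) + cosh (3 * b * y))"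
    if s: "0 \<le> s" "s \<le> S" for s x y
  proof -
    define V where "V = sqrt \<bar>x - y\<bar> * (cosh (3 * b * x) + cosh (3 * b * y))"
    have V: "V \<ge> 0" by (simp add: V_def)
    have "sqrt \<bar>x - y\<bar> * (cosh (b * x) + cosh (b * y)) \<le> V"
      unfolding V_def by (intro mult_left_mono add_mono cm3) auto
    then have "exp (b\<^sup>2 * S) * (2 * sqrt \<bar>b\<bar>) * (sqrt \<bar>x - y\<bar> * (cosh (b * x) + cosh (b * y))) \<le> exp (b\<^sup>2 * S) * (2 * sqrt \<bar>b\<bar>) * V"
      by (intro mult_left_mono) auto
    with h.exp_part_estimates(2)[OF s, of x y]
    have "\<bar>exp (b\<^sup>2 * s) * exp (- b * x) - exp (b\<^sup>2 * s) * exp (- b * y)\<bar> \<le> exp (b\<^sup>2 * S) * (2 * sqrt \<bar>b\<bar>) * V" by linarith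
    then have 1: "b\<^sup>2 * \<bar>exp (b\<^sup>2 * s) * exp (- b * x) - exp (b\<^sup>2 * s) * exp (- b * y)\<bar> \<le> b\<^sup>2 * (exp (b\<^sup>2 * S) * (2 * sqrt \<bar>b\<bar>) * V)"
      by (intro mult_left_mono) auto
    have "\<bar>duhamel 1 g s x - duhamel 1 g s y\<bar> \<le> (4 * g.D * S powr (1/4)) * V"
      using g.duhamel_holder_space[OF s, of 1 x y] by (simp add: V_def ac_simps)
    also have "\<dots> \<le> D3 * V" using D3 V by (intro mult_right_mono) auto
    finally have 2: "\<bar>duhamel 2 h s x - duhamel 2 h s y\<bar> \<le> D3 * V" unfolding d21[OF s] .
    have "sol_xx b h s x - sol_xx b h s y = b\<^sup>2 * (exp (b\<^sup>2 * s) * exp (- b * x) - exp (b\<^sup>2 * s) * exp (- b * y)) + (duhamel 2 h s x - duhamel 2 h s y)"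
      by (simp add: sol_xx_def algebra_simps)
    then have "\<bar>sol_xx b h s x - sol_xx b h s y\<bar> \<le> b\<^sup>2 * \<bar>exp (b\<^sup>2 * s) * exp (- b * x) - exp (b\<^sup>2 * s) * exp (- b * y)\<bar> + \<bar>duhamel 2 h s x - duhamel 2 h s y\<bar>"
      by (simp add: order_trans[OF abs_triangle_ineq] abs_mult)
    also have "\<dots> \<le> (b\<^sup>2 * exp (b\<^sup>2 * S) * (2 * sqrt \<bar>b\<bar>) + D3) * V" using 1 2 by (simp add: algebra_simps)
    also have "\<dots> \<le> K1 * V" using V S_pos by (intro mult_right_mono) (auto simp: K1_def mult_left_mono)
    finally show ?thesis by (simp add: V_def mult.assoc)
  qed
  have xx_t: "\<bar>sol_xx b h s x - sol_xx b h t x\<bar> \<le> K1 * cosh (3 * b * x) * \<bar>s - t\<bar> powr (1/4)"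
    if s: "0 \<le> s" "s \<le> S" and t: "0 \<le> t" "t \<le> S" for s t x
  proof -
    define V where "V = cosh (3 * b * x) * \<bar>s - t\<bar> powr (1/4)"
    have V: "V \<ge> 0" by (simp add: V_def)
    have "cosh (b * x) * \<bar>s - t\<bar> powr (1/4) \<le> V"
      unfolding V_def by (intro mult_right_mono cm3) auto
    then have "exp (b\<^sup>2 * S) * (2 * b\<^sup>2 * (1 + S)) * (cosh (b * x) * \<bar>s - t\<bar> powr (1/4)) \<le> exp (b\<^sup>2 * S) * (2 * b\<^sup>2 * (1 + S)) * V"
      using S_pos by (intro mult_left_mono) auto
    with h.exp_part_estimates(3)[OF s t, of x]
    have "\<bar>exp (b\<^sup>2 * s) * exp (- b * x) - exp (b\<^sup>2 * t) * exp (- b * x)\<bar> \<le> exp (b\<^sup>2 * S) * (2 * b\<^sup>2 * (1 + S)) * V" by linarith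
    then have 1: "b\<^sup>2 * \<bar>exp (b\<^sup>2 * s) * exp (- b * x) - exp (b\<^sup>2 * t) * exp (- b * x)\<bar> \<le> b\<^sup>2 * (exp (b\<^sup>2 * S) * (2 * b\<^sup>2 * (1 + S)) * V)"
      by (intro mult_left_mono) auto
    have "\<bar>duhamel 1 g s x - duhamel 1 g t x\<bar> \<le> (8 * g.D * S powr (1/4) + 2 * g.D * (1 + S)) * V"
      using g.duhamel_holder_time[OF s t, of 1 x] by (simp add: V_def mult.assoc)
    also have "\<dots> \<le> D3 * V" using D3 V by (intro mult_right_mono) auto
    finally have 2: "\<bar>duhamel 2 h s x - duhamel 2 h t x\<bar> \<le> D3 * V" unfolding d21[OF s] d21[OF t] .
    have "sol_xx b h s x - sol_xx b h t x = b\<^sup>2 * (exp (b\<^sup>2 * s) * exp (- b * x) - exp (b\<^sup>2 * t) * exp (- b * x)) + (duhamel 2 h s x - duhamel 2 h t x)"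
      by (simp add: sol_xx_def algebra_simps)
    then have "\<bar>sol_xx b h s x - sol_xx b h t x\<bar> \<le> b\<^sup>2 * \<bar>exp (b\<^sup>2 * s) * exp (- b * x) - exp (b\<^sup>2 * t) * exp (- b * x)\<bar> + \<bar>duhamel 2 h s x - duhamel 2 h t x\<bar>"
      by (simp add: order_trans[OF abs_triangle_ineq] abs_mult)
    also have "\<dots> \<le> (b\<^sup>2 * exp (b\<^sup>2 * S) * (2 * b\<^sup>2 * (1 + S)) + D3) * V" using 1 2 by (simp add: algebra_simps)
    also have "\<dots> \<le> K1 * V" using V S_pos by (intro mult_right_mono) (auto simp: K1_def mult_left_mono)
    finally show ?thesis by (simp add: V_def mult.assoc)
  qed
  show ?thesis
  proof (rule that[of "sol b h" "sol_x b h" "sol_xx b h" "A + K1" "3 * b"])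
    show "((\<lambda>s. sol b h s x) has_real_derivative sol_xx b h s x + c s * (a * sol b h s x - sol_x b h s x) powr p) (at s within {0..S})"
      if s: "0 \<le> s" "s \<le> S" for s x
      using dt[OF s, of x] heq[OF s, of x] by (simp add: flux_def add.commute)
    show "exp (b\<^sup>2 * s) * exp (- b * x) < sol b h s x" if s: "0 < s" "s \<le> S" for s x
    proof -
      have "0 < duhamel 0 h s x"
      proof (rule h.duhamel_0_pos[OF _ s])
        show "0 < h r \<xi>" if r: "0 \<le> r" "r \<le> S" for r \<xi>
          using c_pos[of r] Ppos[OF r, of \<xi>] unfolding heq[OF r] by simp
      qed
      then show ?thesis by (simp add: sol_def)
    qed
    show "sol_x b h s x \<le> 0" if s: "0 \<le> s" "s \<le> S" for s x
      using fl[OF s, of x] by (simp add: flux_def)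
    show "sol b h s x \<le> (A + K1) * cosh (b * x)" if s: "0 \<le> s" "s \<le> S" for s x
    proof -
      have "sol b h s x \<le> A * cosh (b * x)" using h.sol_estimates(1)[OF s, of x] by (simp add: A_def)
      also have "\<dots> \<le> (A + K1) * cosh (b * x)" using K1 by (intro mult_right_mono) auto
      finally show ?thesis .
    qed
    show "\<bar>v s x - v t y\<bar> \<le> (A + K1) * (cosh (3 * b * x) + cosh (3 * b * y)) * (\<bar>s - t\<bar> powr (1/4) + \<bar>x - y\<bar> powr (1/2))"
      if v: "v \<in> {sol b h, sol_x b h, sol_xx b h}" and st: "0 \<le> s" "s \<le> S" "0 \<le> t" "t \<le> S" for v s t x y
    proof -
      consider "v = sol b h" | "v = sol_x b h" | "v = sol_xx b h" using v by blast
      then show ?thesis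
      proof cases
        case 1
        show ?thesis unfolding 1
          by (rule weighted_holder_combine[where A = A and k = b and S = S])
            (use h.sol_estimates(2,3) A K1 b_pos st in \<open>auto simp: A_def\<close>)
      next
        case 2
        show ?thesis unfolding 2
          by (rule weighted_holder_combine[where A = A and k = b and S = S])
            (use h.sol_x_estimates(2,3) A K1 b_pos st in \<open>auto simp: A_def\<close>)
      next
        case 3
        show ?thesis unfolding 3
          by (rule weighted_holder_combine[where A = K1 and k = "3 * b" and S = S])
            (use xx_x xx_t A K1 b_pos st in auto)
      qed
    qed
    show "A + K1 \<ge> 0" using A K1 by simp
  qed (use dx dxx spos anti sol_at_0 in auto)
qed

end

section \<open>Return to the original variables\<close>

text \<open>Chain rule along a curve with asymmetric hypotheses: the s-derivative is assumed only at
  the point, within I, while the x-derivative is jointly continuous. This fits one-sided time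
  derivatives at the ends of I.\<close>

lemma has_real_derivative_two_variables:
  fixes u ux :: "real \<Rightarrow> real \<Rightarrow> real"
  assumes us: "((\<lambda>s. u s (\<theta> t)) has_real_derivative us) (at (\<sigma> t) within I)"
    and ux: "\<And>s x. s \<in> I \<Longrightarrow> (u s has_real_derivative ux s x) (at x)"
    and cont: "continuous_on (I \<times> UNIV) (\<lambda>(s, x). ux s x)"
    and \<sigma>: "(\<sigma> has_real_derivative \<sigma>') (at t within J)" "\<sigma> ` J \<subseteq> I" "\<sigma> t \<in> I"
    and \<theta>: "(\<theta> has_real_derivative \<theta>') (at t within J)"
  shows "((\<lambda>t. u (\<sigma> t) (\<theta> t)) has_real_derivative us * \<sigma>' + ux (\<sigma> t) (\<theta> t) * \<theta>') (at t within J)"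
proof -
  have "((\<lambda>(s, x). u s x) has_derivative (\<lambda>(ts, tx). us * ts + blinfun_apply (ux (\<sigma> t) (\<theta> t) *\<^sub>R id_blinfun) tx))
      (at (\<sigma> t, \<theta> t) within I \<times> UNIV)"
  proof (rule has_derivative_partialsI[where fy = "\<lambda>s x. ux s x *\<^sub>R id_blinfun"])
    show "((\<lambda>s. u s (\<theta> t)) has_derivative (\<lambda>ts. us * ts)) (at (\<sigma> t) within I)"
      using us by (simp add: has_field_derivative_def)
    show "(u s has_derivative blinfun_apply (ux s x *\<^sub>R id_blinfun)) (at x within UNIV)" if "s \<in> I" for s x
    proof -
      have "blinfun_apply (ux s x *\<^sub>R id_blinfun) = (*) (ux s x)" by (auto simp: blinfun.scaleR_left)
      then show ?thesis using ux[OF that, of x] by (simp add: has_field_derivative_def)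
    qed
    have "continuous (at (\<sigma> t, \<theta> t) within I \<times> UNIV) (\<lambda>z. (\<lambda>(s, x). ux s x) z *\<^sub>R (id_blinfun :: real \<Rightarrow>\<^sub>L real))"
      using cont \<sigma>(3) unfolding continuous_on_eq_continuous_within
      by (intro continuous_intros) auto
    then show "continuous (at (\<sigma> t, \<theta> t) within I \<times> UNIV) (\<lambda>(s, x). ux s x *\<^sub>R (id_blinfun :: real \<Rightarrow>\<^sub>L real))"
      by (simp add: split_def)
  qed auto
  then have "((\<lambda>(s, x). u s x) has_derivative (\<lambda>(ts, tx). us * ts + ux (\<sigma> t) (\<theta> t) * tx))
      (at (\<sigma> t, \<theta> t) within I \<times> UNIV)"
    by (simp add: blinfun.scaleR_left)
  then have g: "((\<lambda>(s, x). u s x) has_derivative (\<lambda>(ts, tx). us * ts + ux (\<sigma> t) (\<theta> t) * tx))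
      (at (\<sigma> t, \<theta> t) within (\<lambda>t. (\<sigma> t, \<theta> t)) ` J)"
    by (rule has_derivative_subset) (use \<sigma>(2) in auto)
  have "((\<lambda>t. (\<sigma> t, \<theta> t)) has_derivative (\<lambda>h. (\<sigma>' * h, \<theta>' * h))) (at t within J)"
    using \<sigma>(1) \<theta> by (intro has_derivative_Pair) (auto simp: has_field_derivative_def)
  from has_derivative_in_compose[OF this g]
  have "((\<lambda>t. u (\<sigma> t) (\<theta> t)) has_derivative (\<lambda>h. us * (\<sigma>' * h) + ux (\<sigma> t) (\<theta> t) * (\<theta>' * h))) (at t within J)"
    by simp
  also have "(\<lambda>h. us * (\<sigma>' * h) + ux (\<sigma> t) (\<theta> t) * (\<theta>' * h)) = (*) (us * \<sigma>' + ux (\<sigma> t) (\<theta> t) * \<theta>')"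
    by (auto simp: algebra_simps)
  finally show ?thesis unfolding has_field_derivative_def .
qed

text \<open>The form is stable under differentiation: the exponent drops by one and g is replaced by
  c g + g', so a second application yields the second derivative.\<close>

lemma has_real_derivative_powr_ln:
  assumes g: "(g has_real_derivative g') (at (ln y + d))" and y: "y > 0"
  shows "((\<lambda>z. A * z powr c * g (ln z + d)) has_real_derivative A * y powr (c - 1) * (c * g (ln y + d) + g')) (at y)"
proof -
  have l: "((\<lambda>z. ln z + d) has_real_derivative inverse y) (at y)"
    using y by (auto intro!: derivative_eq_intros simp: divide_inverse)
  have 1: "((\<lambda>z. g (ln z + d)) has_real_derivative g' * inverse y) (at y)"
    by (rule DERIV_chain2[OF g l])
  have 2: "((\<lambda>z. A * z powr c) has_real_derivative A * (c * y powr (c - 1))) (at y)"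
    by (intro DERIV_cmult has_real_derivative_powr y)
  have "y powr c * inverse y = y powr (c - 1)" using y by (simp add: powr_diff divide_inverse)
  then have e: "A * (c * y powr (c - 1)) * g (ln y + d) + g' * inverse y * (A * y powr c) =
      A * y powr (c - 1) * (c * g (ln y + d) + g')"
    by (simp add: algebra_simps)
  show ?thesis using DERIV_mult[OF 2 1] unfolding e .
qed

section \<open>Hoelder classes with \<gamma> = 1/2 on rectangles\<close>

definition rect_holder :: "real \<Rightarrow> (real \<Rightarrow> real \<Rightarrow> real) \<Rightarrow> bool" where
  "rect_holder T u \<longleftrightarrow> (\<forall>l r. 0 < l \<longrightarrow> l \<le> r \<longrightarrow> (\<exists>C\<ge>0. \<forall>t\<in>{0..T}. \<forall>s\<in>{0..T}. \<forall>y\<in>{l..r}. \<forall>z\<in>{l..r}.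
     \<bar>u t y - u s z\<bar> \<le> C * (\<bar>t - s\<bar> powr (1/4) + \<bar>y - z\<bar> powr (1/2))))"

lemma rect_holderI:
  assumes "\<And>l r. 0 < l \<Longrightarrow> l \<le> r \<Longrightarrow> \<exists>C\<ge>0. \<forall>t\<in>{0..T}. \<forall>s\<in>{0..T}. \<forall>y\<in>{l..r}. \<forall>z\<in>{l..r}.
     \<bar>u t y - u s z\<bar> \<le> C * (\<bar>t - s\<bar> powr (1/4) + \<bar>y - z\<bar> powr (1/2))"
  shows "rect_holder T u"
  using assms unfolding rect_holder_def by blast

lemma rect_holderD:
  assumes "rect_holder T u" "0 < l" "l \<le> r"
  obtains C where "C \<ge> 0" "\<And>t s y z. t \<in> {0..T} \<Longrightarrow> s \<in> {0..T} \<Longrightarrow> y \<in> {l..r} \<Longrightarrow> z \<in> {l..r} \<Longrightarrow>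
     \<bar>u t y - u s z\<bar> \<le> C * (\<bar>t - s\<bar> powr (1/4) + \<bar>y - z\<bar> powr (1/2))"
  using assms unfolding rect_holder_def by meson

text \<open>A rectangle has finite parabolic diameter, so comparison with one corner gives the sup
  bound that products require.\<close>

lemma rect_holder_bounded:
  assumes u: "rect_holder T u" and lr: "0 < l" "l \<le> r" and T: "T \<ge> 0"
  obtains M where "M \<ge> 0" "\<And>t y. t \<in> {0..T} \<Longrightarrow> y \<in> {l..r} \<Longrightarrow> \<bar>u t y\<bar> \<le> M"
proof -
  obtain C where C: "C \<ge> 0" "\<And>t s y z. t \<in> {0..T} \<Longrightarrow> s \<in> {0..T} \<Longrightarrow> y \<in> {l..r} \<Longrightarrow> z \<in> {l..r} \<Longrightarrow>
     \<bar>u t y - u s z\<bar> \<le> C * (\<bar>t - s\<bar> powr (1/4) + \<bar>y - z\<bar> powr (1/2))" using rect_holderD[OF u lr] by blast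
  define M where "M = \<bar>u 0 l\<bar> + C * (T powr (1/4) + (r - l) powr (1/2))"
  have "\<bar>u t y\<bar> \<le> M" if ty: "t \<in> {0..T}" "y \<in> {l..r}" for t y
  proof -
    have "\<bar>u t y - u 0 l\<bar> \<le> C * (\<bar>t - 0\<bar> powr (1/4) + \<bar>y - l\<bar> powr (1/2))"
      using ty lr T by (intro C(2)) auto
    also have "\<dots> \<le> C * (T powr (1/4) + (r - l) powr (1/2))"
      using ty C(1) by (intro mult_left_mono add_mono powr_mono2) auto
    finally show ?thesis unfolding M_def by linarith
  qed
  moreover have "M \<ge> 0" using C(1) by (simp add: M_def)
  ultimately show ?thesis using that by blast
qed

lemma rect_holder_cong:
  assumes "rect_holder T u" "\<And>t y. t \<in> {0..T} \<Longrightarrow> y > 0 \<Longrightarrow> v t y = u t y"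
  shows "rect_holder T v"
proof (rule rect_holderI)
  fix l r :: real assume lr: "0 < l" "l \<le> r"
  obtain C where C: "C \<ge> 0" "\<And>t s y z. t \<in> {0..T} \<Longrightarrow> s \<in> {0..T} \<Longrightarrow> y \<in> {l..r} \<Longrightarrow> z \<in> {l..r} \<Longrightarrow>
     \<bar>u t y - u s z\<bar> \<le> C * (\<bar>t - s\<bar> powr (1/4) + \<bar>y - z\<bar> powr (1/2))" using rect_holderD[OF assms(1) lr] by blast
  have "v t y = u t y" if "t \<in> {0..T}" "y \<in> {l..r}" for t y using that lr by (intro assms(2)) auto
  then show "\<exists>C\<ge>0. \<forall>t\<in>{0..T}. \<forall>s\<in>{0..T}. \<forall>y\<in>{l..r}. \<forall>z\<in>{l..r}.
     \<bar>v t y - v s z\<bar> \<le> C * (\<bar>t - s\<bar> powr (1/4) + \<bar>y - z\<bar> powr (1/2))" using C by auto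
qed

lemma rect_holder_const: "rect_holder T (\<lambda>t y. c)"
  by (rule rect_holderI) (auto intro!: exI[of _ 0])

lemma rect_holder_add:
  assumes u: "rect_holder T u" and v: "rect_holder T v"
  shows "rect_holder T (\<lambda>t y. u t y + v t y)"
proof (rule rect_holderI)
  fix l r :: real assume lr: "0 < l" "l \<le> r"
  obtain C where C: "C \<ge> 0" "\<And>t s y z. t \<in> {0..T} \<Longrightarrow> s \<in> {0..T} \<Longrightarrow> y \<in> {l..r} \<Longrightarrow> z \<in> {l..r} \<Longrightarrow>
     \<bar>u t y - u s z\<bar> \<le> C * (\<bar>t - s\<bar> powr (1/4) + \<bar>y - z\<bar> powr (1/2))" using rect_holderD[OF u lr] by blast
  obtain D where D: "D \<ge> 0" "\<And>t s y z. t \<in> {0..T} \<Longrightarrow> s \<in> {0..T} \<Longrightarrow> y \<in> {l..r} \<Longrightarrow> z \<in> {l..r} \<Longrightarrow>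
     \<bar>v t y - v s z\<bar> \<le> D * (\<bar>t - s\<bar> powr (1/4) + \<bar>y - z\<bar> powr (1/2))" using rect_holderD[OF v lr] by blast
  show "\<exists>C\<ge>0. \<forall>t\<in>{0..T}. \<forall>s\<in>{0..T}. \<forall>y\<in>{l..r}. \<forall>z\<in>{l..r}.
     \<bar>u t y + v t y - (u s z + v s z)\<bar> \<le> C * (\<bar>t - s\<bar> powr (1/4) + \<bar>y - z\<bar> powr (1/2))"
  proof (intro exI[of _ "C + D"] conjI ballI)
    fix t s y z assume *: "t \<in> {0..T}" "s \<in> {0..T}" "y \<in> {l..r}" "z \<in> {l..r}"
    have "\<bar>u t y + v t y - (u s z + v s z)\<bar> \<le> \<bar>u t y - u s z\<bar> + \<bar>v t y - v s z\<bar>" by linarith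
    also have "\<dots> \<le> C * (\<bar>t - s\<bar> powr (1/4) + \<bar>y - z\<bar> powr (1/2)) + D * (\<bar>t - s\<bar> powr (1/4) + \<bar>y - z\<bar> powr (1/2))"
      by (intro add_mono C(2) D(2) *)
    finally show "\<bar>u t y + v t y - (u s z + v s z)\<bar> \<le> (C + D) * (\<bar>t - s\<bar> powr (1/4) + \<bar>y - z\<bar> powr (1/2))"
      by (simp only: distrib_right)
  qed (use C D in simp)
qed

lemma rect_holder_mult:
  assumes T: "T \<ge> 0" and u: "rect_holder T u" and v: "rect_holder T v"
  shows "rect_holder T (\<lambda>t y. u t y * v t y)"
proof (rule rect_holderI)
  fix l r :: real assume lr: "0 < l" "l \<le> r"
  obtain C where C: "C \<ge> 0" "\<And>t s y z. t \<in> {0..T} \<Longrightarrow> s \<in> {0..T} \<Longrightarrow> y \<in> {l..r} \<Longrightarrow> z \<in> {l..r} \<Longrightarrow>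
     \<bar>u t y - u s z\<bar> \<le> C * (\<bar>t - s\<bar> powr (1/4) + \<bar>y - z\<bar> powr (1/2))" using rect_holderD[OF u lr] by blast
  obtain D where D: "D \<ge> 0" "\<And>t s y z. t \<in> {0..T} \<Longrightarrow> s \<in> {0..T} \<Longrightarrow> y \<in> {l..r} \<Longrightarrow> z \<in> {l..r} \<Longrightarrow>
     \<bar>v t y - v s z\<bar> \<le> D * (\<bar>t - s\<bar> powr (1/4) + \<bar>y - z\<bar> powr (1/2))" using rect_holderD[OF v lr] by blast
  obtain M where M: "M \<ge> 0" "\<And>t y. t \<in> {0..T} \<Longrightarrow> y \<in> {l..r} \<Longrightarrow> \<bar>u t y\<bar> \<le> M" using rect_holder_bounded[OF u lr T] by blast
  obtain N where N: "N \<ge> 0" "\<And>t y. t \<in> {0..T} \<Longrightarrow> y \<in> {l..r} \<Longrightarrow> \<bar>v t y\<bar> \<le> N" using rect_holder_bounded[OF v lr T] by blast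
  show "\<exists>C\<ge>0. \<forall>t\<in>{0..T}. \<forall>s\<in>{0..T}. \<forall>y\<in>{l..r}. \<forall>z\<in>{l..r}.
     \<bar>u t y * v t y - u s z * v s z\<bar> \<le> C * (\<bar>t - s\<bar> powr (1/4) + \<bar>y - z\<bar> powr (1/2))"
  proof (intro exI[of _ "M * D + N * C"] conjI ballI)
    fix t s y z assume *: "t \<in> {0..T}" "s \<in> {0..T}" "y \<in> {l..r}" "z \<in> {l..r}"
    define d where "d = \<bar>t - s\<bar> powr (1/4) + \<bar>y - z\<bar> powr (1/2)"
    have "u t y * v t y - u s z * v s z = u t y * (v t y - v s z) + v s z * (u t y - u s z)"
      by (simp add: algebra_simps)
    then have "\<bar>u t y * v t y - u s z * v s z\<bar> \<le> \<bar>u t y\<bar> * \<bar>v t y - v s z\<bar> + \<bar>v s z\<bar> * \<bar>u t y - u s z\<bar>"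
      by (metis abs_mult abs_triangle_ineq)
    also have "\<dots> \<le> M * (D * d) + N * (C * d)"
      unfolding d_def by (intro add_mono mult_mono C(2) D(2) M N *) auto
    finally show "\<bar>u t y * v t y - u s z * v s z\<bar> \<le> (M * D + N * C) * (\<bar>t - s\<bar> powr (1/4) + \<bar>y - z\<bar> powr (1/2))"
      by (simp add: d_def algebra_simps)
  qed (use C D M N in simp)
qed

lemma rect_holder_time:
  assumes T: "T \<ge> 0" and g: "\<And>t. t \<in> {0..T} \<Longrightarrow> (g has_real_derivative g' t) (at t within {0..T})"
    and b: "\<And>t. t \<in> {0..T} \<Longrightarrow> \<bar>g' t\<bar> \<le> M"
  shows "rect_holder T (\<lambda>t y. g t)"
proof (rule rect_holderI)
  have M: "M \<ge> 0" using b[of 0] T by auto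
  fix l r :: real
  show "\<exists>C\<ge>0. \<forall>t\<in>{0..T}. \<forall>s\<in>{0..T}. \<forall>y\<in>{l..r}. \<forall>z\<in>{l..r}.
     \<bar>g t - g s\<bar> \<le> C * (\<bar>t - s\<bar> powr (1/4) + \<bar>y - z\<bar> powr (1/2))"
  proof (intro exI[of _ "M * (1 + T)"] conjI ballI)
    fix t s y z assume *: "t \<in> {0..T}" "s \<in> {0..T}"
    have "norm (g t - g s) \<le> M * norm (t - s)"
      by (rule field_differentiable_bound[where S = "{0..T}" and f' = g']) (use g b * in auto)
    also have "\<dots> \<le> M * ((1 + T) * \<bar>t - s\<bar> powr (1/4))"
      using M powr_lower_exponent[of "\<bar>t - s\<bar>" T "1/4" 1] * by (intro mult_left_mono) (cases "t = s"; auto)+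
    also have "\<dots> \<le> M * ((1 + T) * (\<bar>t - s\<bar> powr (1/4) + \<bar>y - z\<bar> powr (1/2)))"
      using M T by (intro mult_left_mono) auto
    finally show "\<bar>g t - g s\<bar> \<le> M * (1 + T) * (\<bar>t - s\<bar> powr (1/4) + \<bar>y - z\<bar> powr (1/2))" by (simp add: mult.assoc)
  qed (use M T in simp)
qed

lemma rect_holder_powr: "rect_holder T (\<lambda>t y. y powr c)"
proof (rule rect_holderI)
  fix l r :: real assume lr: "0 < l" "l \<le> r"
  define M where "M = \<bar>c\<bar> * (l powr (c - 1) + r powr (c - 1))"
  have M: "M \<ge> 0" by (simp add: M_def)
  show "\<exists>C\<ge>0. \<forall>t\<in>{0..T}. \<forall>s\<in>{0..T}. \<forall>y\<in>{l..r}. \<forall>z\<in>{l..r}.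
     \<bar>y powr c - z powr c\<bar> \<le> C * (\<bar>t - s\<bar> powr (1/4) + \<bar>y - z\<bar> powr (1/2))"
  proof (intro exI[of _ "M * (1 + r)"] conjI ballI)
    fix t s y z assume *: "y \<in> {l..r}" "z \<in> {l..r}"
    have "norm (y powr c - z powr c) \<le> M * norm (y - z)"
    proof (rule field_differentiable_bound[where S = "{l..r}" and f' = "\<lambda>x. c * x powr (c - 1)"])
      show "((\<lambda>x. x powr c) has_field_derivative c * x powr (c - 1)) (at x within {l..r})" if "x \<in> {l..r}" for x
        by (rule has_field_derivative_at_within, rule has_real_derivative_powr) (use that lr in auto)
      show "norm (c * x powr (c - 1)) \<le> M" if x: "x \<in> {l..r}" for x
      proof -
        have "x powr (c - 1) \<le> l powr (c - 1) + r powr (c - 1)"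
        proof (cases "c \<ge> 1")
          case True
          then have "x powr (c - 1) \<le> r powr (c - 1)" using x lr by (intro powr_mono2) auto
          then show ?thesis by (simp add: add_increasing)
        next
          case False
          then have "x powr (c - 1) \<le> l powr (c - 1)" using x lr by (intro powr_mono2') auto
          then show ?thesis by (simp add: add_increasing2)
        qed
        then show ?thesis by (simp add: M_def abs_mult mult_left_mono)
      qed
    qed (use * in auto)
    also have "\<dots> \<le> M * ((1 + r) * \<bar>y - z\<bar> powr (1/2))"
      using M powr_lower_exponent[of "\<bar>y - z\<bar>" r "1/2" 1] * lr by (intro mult_left_mono) (cases "y = z"; auto)+
    also have "\<dots> \<le> M * ((1 + r) * (\<bar>t - s\<bar> powr (1/4) + \<bar>y - z\<bar> powr (1/2)))"
      using M lr by (intro mult_left_mono) auto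
    finally show "\<bar>y powr c - z powr c\<bar> \<le> M * (1 + r) * (\<bar>t - s\<bar> powr (1/4) + \<bar>y - z\<bar> powr (1/2))" by (simp add: mult.assoc)
  qed (use M lr in simp)
qed

text \<open>The power is Lipschitz only away from 0; a positive lower bound on each rectangle, with
  no uniformity in the rectangle, is enough for a local class.\<close>

lemma rect_holder_powr_comp:
  assumes p: "0 < p" "p < 1" and u: "rect_holder T u"
    and low: "\<And>l r. 0 < l \<Longrightarrow> l \<le> r \<Longrightarrow> \<exists>m>0. \<forall>t\<in>{0..T}. \<forall>y\<in>{l..r}. m \<le> u t y"
  shows "rect_holder T (\<lambda>t y. u t y powr p)"
proof (rule rect_holderI)
  fix l r :: real assume lr: "0 < l" "l \<le> r"
  obtain C where C: "C \<ge> 0" "\<And>t s y z. t \<in> {0..T} \<Longrightarrow> s \<in> {0..T} \<Longrightarrow> y \<in> {l..r} \<Longrightarrow> z \<in> {l..r} \<Longrightarrow>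
     \<bar>u t y - u s z\<bar> \<le> C * (\<bar>t - s\<bar> powr (1/4) + \<bar>y - z\<bar> powr (1/2))" using rect_holderD[OF u lr] by blast
  obtain m where m: "m > 0" "\<And>t y. t \<in> {0..T} \<Longrightarrow> y \<in> {l..r} \<Longrightarrow> m \<le> u t y" using low[OF lr] by blast
  show "\<exists>C\<ge>0. \<forall>t\<in>{0..T}. \<forall>s\<in>{0..T}. \<forall>y\<in>{l..r}. \<forall>z\<in>{l..r}.
     \<bar>u t y powr p - u s z powr p\<bar> \<le> C * (\<bar>t - s\<bar> powr (1/4) + \<bar>y - z\<bar> powr (1/2))"
  proof (intro exI[of _ "p * m powr (p - 1) * C"] conjI ballI)
    fix t s y z assume *: "t \<in> {0..T}" "s \<in> {0..T}" "y \<in> {l..r}" "z \<in> {l..r}"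
    have "\<bar>u t y powr p - u s z powr p\<bar> \<le> p * m powr (p - 1) * \<bar>u t y - u s z\<bar>"
      using * by (intro powr_lipschitz p m)
    also have "\<dots> \<le> p * m powr (p - 1) * (C * (\<bar>t - s\<bar> powr (1/4) + \<bar>y - z\<bar> powr (1/2)))"
      using p by (intro mult_left_mono C(2) *) auto
    finally show "\<bar>u t y powr p - u s z powr p\<bar> \<le> p * m powr (p - 1) * C * (\<bar>t - s\<bar> powr (1/4) + \<bar>y - z\<bar> powr (1/2))"
      by (simp add: mult.assoc)
  qed (use C p in simp)
qed

lemma ln_lipschitz:
  fixes l y z :: real
  assumes "0 < l" "l \<le> y" "l \<le> z"
  shows "\<bar>ln y - ln z\<bar> \<le> \<bar>y - z\<bar> / l"
proof -
  have "norm (ln y - ln z) \<le> (1 / l) * norm (y - z)"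
  proof (rule field_differentiable_bound[where S = "{l..}" and f' = "\<lambda>x. inverse x"])
    show "(ln has_field_derivative inverse x) (at x within {l..})" if "x \<in> {l..}" for x
      using that assms by (auto intro!: derivative_eq_intros simp: divide_inverse)
    show "norm (inverse x) \<le> 1 / l" if "x \<in> {l..}" for x
      using that assms by (simp add: field_simps)
  qed (use assms in auto)
  then show ?thesis by simp
qed

lemma cosh_le_exp_abs: "cosh z \<le> exp \<bar>z\<bar>" for z :: real
  using cosh_shift_le[of 1 0 z] by simp

lemma ln_abs_bound:
  fixes l r y :: real
  assumes "0 < l" "y \<in> {l..r}"
  shows "\<bar>ln y\<bar> \<le> \<bar>ln l\<bar> + \<bar>ln r\<bar>"
proof -
  have "ln l \<le> ln y" "ln y \<le> ln r" using assms by auto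
  then show ?thesis by linarith
qed

lemma powr_half_add_le:
  fixes u v :: real
  assumes "0 \<le> u" "0 \<le> v"
  shows "(u + v) powr (1/2) \<le> u powr (1/2) + v powr (1/2)"
  using sqrt_add_le_add_sqrt[OF assms] assms by (simp add: powr_half_sqrt)

text \<open>The weights are bounded on a rectangle because the logarithm is. Time enters both
  arguments: the drift \<beta> (T - t) contributes |t - s|^(1/2), which is weakened to exponent 1/4
  at the price of 1 + T.\<close>

lemma rect_holder_log_coordinates:
  fixes v :: "real \<Rightarrow> real \<Rightarrow> real"
  assumes T: "T \<ge> 0" and \<xi>: "\<xi> > 0" and K: "K \<ge> 0"
    and v: "\<And>s t x y. 0 \<le> s \<Longrightarrow> s \<le> \<xi> * T \<Longrightarrow> 0 \<le> t \<Longrightarrow> t \<le> \<xi> * T \<Longrightarrow>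
       \<bar>v s x - v t y\<bar> \<le> K * (cosh (k * x) + cosh (k * y)) * (\<bar>s - t\<bar> powr (1/4) + \<bar>x - y\<bar> powr (1/2))"
  shows "rect_holder T (\<lambda>t y. v (\<xi> * (T - t)) (ln y + \<beta> * (T - t)))"
proof (rule rect_holderI)
  fix l r :: real assume lr: "0 < l" "l \<le> r"
  define X where "X = \<bar>ln l\<bar> + \<bar>ln r\<bar> + \<bar>\<beta>\<bar> * T"
  define a1 where "a1 = \<xi> powr (1/4) + \<bar>\<beta>\<bar> powr (1/2) * (1 + T)"
  define a2 where "a2 = (1 / l) powr (1/2)"
  define E where "E = K * (2 * exp (\<bar>k\<bar> * X))"
  have E: "E \<ge> 0" using K by (simp add: E_def)
  have a: "a1 \<ge> 0" "a2 \<ge> 0" using T by (auto simp: a1_def a2_def)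
  show "\<exists>C\<ge>0. \<forall>t\<in>{0..T}. \<forall>s\<in>{0..T}. \<forall>y\<in>{l..r}. \<forall>z\<in>{l..r}.
     \<bar>v (\<xi> * (T - t)) (ln y + \<beta> * (T - t)) - v (\<xi> * (T - s)) (ln z + \<beta> * (T - s))\<bar> \<le>
       C * (\<bar>t - s\<bar> powr (1/4) + \<bar>y - z\<bar> powr (1/2))"
  proof (intro exI[of _ "E * (a1 + a2)"] conjI ballI)
    fix t s y z assume *: "t \<in> {0..T}" "s \<in> {0..T}" "y \<in> {l..r}" "z \<in> {l..r}"
    define p where "p t y = ln y + \<beta> * (T - t)" for t y
    have xb: "cosh (k * p t y) \<le> exp (\<bar>k\<bar> * X)" if "t \<in> {0..T}" "y \<in> {l..r}" for t y
    proof -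
      have "\<bar>p t y\<bar> \<le> \<bar>ln y\<bar> + \<bar>\<beta>\<bar> * \<bar>T - t\<bar>" unfolding p_def abs_mult[symmetric] by (rule abs_triangle_ineq)
      also have "\<dots> \<le> (\<bar>ln l\<bar> + \<bar>ln r\<bar>) + \<bar>\<beta>\<bar> * T"
        using that lr by (intro add_mono ln_abs_bound mult_left_mono) auto
      finally have "\<bar>k * p t y\<bar> \<le> \<bar>k\<bar> * X" unfolding abs_mult X_def by (intro mult_left_mono) auto
      then show ?thesis using cosh_le_exp_abs[of "k * p t y"] by (meson exp_le_cancel_iff order_trans)
    qed
    have s1: "\<bar>\<xi> * (T - t) - \<xi> * (T - s)\<bar> = \<xi> * \<bar>t - s\<bar>"
      using \<xi> by (simp add: abs_mult abs_minus_commute flip: right_diff_distrib)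
    have s2: "\<bar>p t y - p s z\<bar> \<le> \<bar>y - z\<bar> / l + \<bar>\<beta>\<bar> * \<bar>t - s\<bar>"
    proof -
      have "p t y - p s z = (ln y - ln z) + \<beta> * (s - t)" by (simp add: p_def algebra_simps)
      also have "\<bar>\<dots>\<bar> \<le> \<bar>ln y - ln z\<bar> + \<bar>\<beta>\<bar> * \<bar>s - t\<bar>" unfolding abs_mult[symmetric] by (rule abs_triangle_ineq)
      also have "\<dots> \<le> \<bar>y - z\<bar> / l + \<bar>\<beta>\<bar> * \<bar>s - t\<bar>" using ln_lipschitz[of l y z] * lr by auto
      finally show ?thesis by (simp add: abs_minus_commute)
    qed
    have h: "\<bar>t - s\<bar> powr (1/2) \<le> (1 + T) * \<bar>t - s\<bar> powr (1/4)"
      using powr_lower_exponent[of "\<bar>t - s\<bar>" T "1/4" "1/2"] * by (cases "t = s") auto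
    have "\<bar>p t y - p s z\<bar> powr (1/2) \<le> (\<bar>y - z\<bar> / l + \<bar>\<beta>\<bar> * \<bar>t - s\<bar>) powr (1/2)"
      using s2 by (intro powr_mono2) auto
    also have "\<dots> \<le> (\<bar>y - z\<bar> / l) powr (1/2) + (\<bar>\<beta>\<bar> * \<bar>t - s\<bar>) powr (1/2)"
      using lr by (intro powr_half_add_le) auto
    also have "(\<bar>y - z\<bar> / l) powr (1/2) = a2 * \<bar>y - z\<bar> powr (1/2)"
      using lr powr_mult[of "1 / l" "\<bar>y - z\<bar>" "1/2"] by (simp add: a2_def)
    also have "(\<bar>\<beta>\<bar> * \<bar>t - s\<bar>) powr (1/2) = \<bar>\<beta>\<bar> powr (1/2) * \<bar>t - s\<bar> powr (1/2)" by (simp add: powr_mult)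
    also have "\<bar>\<beta>\<bar> powr (1/2) * \<bar>t - s\<bar> powr (1/2) \<le> \<bar>\<beta>\<bar> powr (1/2) * ((1 + T) * \<bar>t - s\<bar> powr (1/4))"
      by (intro mult_left_mono h) auto
    finally have q: "\<bar>p t y - p s z\<bar> powr (1/2) \<le> a2 * \<bar>y - z\<bar> powr (1/2) + \<bar>\<beta>\<bar> powr (1/2) * ((1 + T) * \<bar>t - s\<bar> powr (1/4))"
      by simp
    have "\<bar>v (\<xi> * (T - t)) (p t y) - v (\<xi> * (T - s)) (p s z)\<bar> \<le>
        K * (cosh (k * p t y) + cosh (k * p s z)) * (\<bar>\<xi> * (T - t) - \<xi> * (T - s)\<bar> powr (1/4) + \<bar>p t y - p s z\<bar> powr (1/2))"
      using * \<xi> by (intro v) auto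
    also have "\<dots> \<le> E * (\<xi> powr (1/4) * \<bar>t - s\<bar> powr (1/4) + (a2 * \<bar>y - z\<bar> powr (1/2) + \<bar>\<beta>\<bar> powr (1/2) * ((1 + T) * \<bar>t - s\<bar> powr (1/4))))"
    proof (intro mult_mono add_mono q)
      show "K * (cosh (k * p t y) + cosh (k * p s z)) \<le> E"
        using xb[of t y] xb[of s z] * K unfolding E_def by (intro mult_left_mono) auto
      show "\<bar>\<xi> * (T - t) - \<xi> * (T - s)\<bar> powr (1/4) \<le> \<xi> powr (1/4) * \<bar>t - s\<bar> powr (1/4)"
        unfolding s1 using \<xi> by (simp add: powr_mult)
    qed (use E in auto)
    also have "\<dots> = E * (a1 * \<bar>t - s\<bar> powr (1/4) + a2 * \<bar>y - z\<bar> powr (1/2))"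
      by (simp add: a1_def algebra_simps)
    also have "\<dots> \<le> E * ((a1 + a2) * (\<bar>t - s\<bar> powr (1/4) + \<bar>y - z\<bar> powr (1/2)))"
      using a E by (intro mult_left_mono) (auto simp: algebra_simps)
    finally show "\<bar>v (\<xi> * (T - t)) (ln y + \<beta> * (T - t)) - v (\<xi> * (T - s)) (ln z + \<beta> * (T - s))\<bar> \<le>
       E * (a1 + a2) * (\<bar>t - s\<bar> powr (1/4) + \<bar>y - z\<bar> powr (1/2))" by (simp add: p_def mult.assoc)
  qed (use E a in simp)
qed

text \<open>A compact set projects to a compact set of positive y, whose minimum is positive and
  whose maximum is finite; these are the sides of the rectangle.\<close>

lemma rect_holder_imp_parabolic_holder_on:
  assumes u: "rect_holder T u" and K: "compact K" "K \<subseteq> {0..T} \<times> {0<..}"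
  shows "parabolic_holder_on (1/2) K u"
proof (cases "K = {}")
  case True
  then show ?thesis by (simp add: parabolic_holder_on_def)
next
  case False
  have c: "compact (snd ` K)" using K(1) by (intro compact_continuous_image continuous_intros)
  obtain l where l: "l \<in> snd ` K" "\<And>y. y \<in> snd ` K \<Longrightarrow> l \<le> y"
    using compact_attains_inf[OF c] False by auto
  obtain r where r: "r \<in> snd ` K" "\<And>y. y \<in> snd ` K \<Longrightarrow> y \<le> r"
    using compact_attains_sup[OF c] False by auto
  have lr: "0 < l" "l \<le> r" using l r K(2) by auto
  obtain C where C: "C \<ge> 0" "\<And>t s y z. t \<in> {0..T} \<Longrightarrow> s \<in> {0..T} \<Longrightarrow> y \<in> {l..r} \<Longrightarrow> z \<in> {l..r} \<Longrightarrow>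
     \<bar>u t y - u s z\<bar> \<le> C * (\<bar>t - s\<bar> powr (1/4) + \<bar>y - z\<bar> powr (1/2))" using rect_holderD[OF u lr] by blast
  have in_rect: "t \<in> {0..T} \<and> y \<in> {l..r}" if "(t, y) \<in> K" for t y
    using that K(2) l(2)[of y] r(2)[of y] by force
  show ?thesis
    unfolding parabolic_holder_on_def
  proof (intro exI[of _ C] ballI, clarify)
    fix t y s z assume "(t, y) \<in> K" "(s, z) \<in> K"
    then show "\<bar>u t y - u s z\<bar> \<le> C * (\<bar>t - s\<bar> powr (1 / 2 / 2) + \<bar>y - z\<bar> powr (1 / 2))"
      using C(2)[of t s y z] in_rect by auto
  qed
qed

section \<open>The change of variables\<close>

theorem theorem3p1:
  fixes T lam \<mu> \<sigma> p1 p2 q1 \<xi> :: real and f :: "real \<Rightarrow> real"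
  assumes "T > 0" and "lam > 0" and "\<mu> > 0" and "\<sigma> > 0"
    and "0 < p1" and "p1 < 1" and "0 < p2" and "p2 < 1" and "p1 > p2"
    and "\<xi> = \<mu>\<^sup>2 / (2 * \<sigma>\<^sup>2)"
    and "q1 < 0" and "1 / p1 + 1 / q1 = 1"
    and "\<And>t. t \<in> {0..T} \<Longrightarrow> f t = exp (- \<xi> * (T - t))"
  shows "\<exists>\<gamma> w w_t w_y w_yy.
    0 < \<gamma> \<and> \<gamma> < 1 \<and>
    C_parabolic \<gamma> {0..T} {0<..} w w_t w_y w_yy \<and>
    (\<forall>t\<in>{0..T}. \<forall>y>0.
       w_y t y \<le> 0 \<and>
       w_t t y - lam * w t y + lam * y * w_y t y + \<xi> * y\<^sup>2 * w_yy t y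
         + lam * f t * ((- w_y t y) powr p2 / p2) = 0) \<and>
    (\<forall>y>0. w T y = - (y powr q1 / q1)) \<and>
    (\<forall>t\<in>{0..T}. \<forall>y>0. w t y > 0) \<and>
    (\<forall>t\<in>{0..<T}. \<forall>y>0.
       w t y > - exp ((q1 - 1) * (lam + \<xi> * q1) * (T - t)) * (y powr q1 / q1)) \<and>
    (\<forall>t\<in>{0..T}. \<forall>y>0.
       - exp ((q1 - 1) * (lam + \<xi> * q1) * (T - t)) * (y powr q1 / q1) > 0) \<and>
    (\<forall>t\<in>{0..T}. strict_antimono_on {0<..} (w t)) \<and>
    (\<exists>\<eta>>0. \<exists>C>0. \<forall>t\<in>{0..T}. \<forall>y>0. w t y \<le> C * (1 + y powr (- \<eta>)))"
proof -
  note T = \<open>T > 0\<close> and lam = \<open>lam > 0\<close> and p2 = \<open>0 < p2\<close> \<open>p2 < 1\<close>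
  have xi: "\<xi> > 0" using assms by simp
  \<comment> \<open>The solution of (a + 1) p2 = a: with w of order y^(-a), the term (-w_y)^p2 is
    again of order y^(-a), and the equation becomes translation invariant in the logarithm of
    y.\<close>
  define a where "a = p2 / (1 - p2)"
  define Q where "Q = - q1"
  define b where "b = Q - a"
  define S where "S = \<xi> * T"
  \<comment> \<open>\<beta> cancels the first order term -\<beta> + lam - \<xi> (2 a + 1), and
    \<kappa> cancels the zeroth order term -\<kappa> - lam (a + 1) + \<xi> a (a + 1).\<close>
  define \<beta> where "\<beta> = lam - \<xi> * (2 * a + 1)"
  define \<kappa> where "\<kappa> = (a + 1) * (\<xi> * a - lam)"
  \<comment> \<open>The coefficient left on the power is lam f E^(p2 - 1) / (\<xi> p2). With T - t =
    s / \<xi> this is c0 exp (m s): -\<xi> stems from f, and (p2 - 1) \<kappa> from the prefactor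
    E.\<close>
  define m where "m = (- \<xi> + (p2 - 1) * \<kappa>) / \<xi>"
  define c0 where "c0 = Q powr (1 - p2) * lam / (\<xi> * p2)"
  define c where "c s = c0 * exp (m * s)" for s
  have a: "a > 0" using p2 by (simp add: a_def)
  have Q: "Q > 0" using \<open>q1 < 0\<close> by (simp add: Q_def)
  have ap: "(a + 1) * p2 = a" using p2 by (simp add: a_def field_simps)
  have b: "b > 0"
  proof -
    \<comment> \<open>The conjugacy relation gives Q = p1 / (1 - p1), and x / (1 - x) is increasing
      on (0, 1).\<close>
    have "1 / q1 = 1 - 1 / p1" using \<open>1 / p1 + 1 / q1 = 1\<close> by simp
    then have "q1 * (p1 - 1) = p1" using \<open>q1 < 0\<close> \<open>0 < p1\<close> by (simp add: field_simps)
    then have "Q = p1 / (1 - p1)" using \<open>p1 < 1\<close> by (simp add: Q_def field_simps)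
    moreover have "p2 / (1 - p2) < p1 / (1 - p1)" using assms by (simp add: field_simps)
    ultimately show ?thesis by (simp add: b_def a_def)
  qed
  have c0: "c0 > 0" using Q lam xi p2 by (simp add: c0_def)
  have S: "S > 0" using T xi by (simp add: S_def)
  have mx: "m * \<xi> = - \<xi> + (p2 - 1) * \<kappa>" using xi by (simp add: m_def)
  have pp: "power_problem S a b p2 (c0 * exp (\<bar>m\<bar> * S)) c"
  proof
    show "continuous_on UNIV c" unfolding c_def by (intro continuous_intros)
    show "0 < c r" for r using c0 by (simp add: c_def)
    show "c r \<le> c0 * exp (\<bar>m\<bar> * S)" if "0 \<le> r" "r \<le> S" for r
    proof -
      have "m * r \<le> \<bar>m\<bar> * S" using that by (intro mult_mono) auto
      then show ?thesis using c0 by (simp add: c_def)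
    qed
  qed (use S a b p2 in auto)
  obtain u ux uxx :: "real \<Rightarrow> real \<Rightarrow> real" and k K :: real where
    ux: "\<And>s x. 0 \<le> s \<Longrightarrow> s \<le> S \<Longrightarrow> (u s has_real_derivative ux s x) (at x)" and
    uxx: "\<And>s x. 0 \<le> s \<Longrightarrow> s \<le> S \<Longrightarrow> (ux s has_real_derivative uxx s x) (at x)" and
    us: "\<And>s x. 0 \<le> s \<Longrightarrow> s \<le> S \<Longrightarrow> ((\<lambda>s. u s x) has_real_derivative
       uxx s x + c s * (a * u s x - ux s x) powr p2) (at s within {0..S})" and
    u0: "\<And>x. u 0 x = exp (- b * x)" and
    ulow: "\<And>s x. 0 < s \<Longrightarrow> s \<le> S \<Longrightarrow> exp (b\<^sup>2 * s) * exp (- b * x) < u s x" and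
    upos: "\<And>s x. 0 \<le> s \<Longrightarrow> s \<le> S \<Longrightarrow> 0 < u s x" and
    ux0: "\<And>s x. 0 \<le> s \<Longrightarrow> s \<le> S \<Longrightarrow> ux s x \<le> 0" and
    umono: "\<And>s x y. 0 \<le> s \<Longrightarrow> s \<le> S \<Longrightarrow> 0 \<le> y \<Longrightarrow> u s (x + y) \<le> u s x" and
    ub: "\<And>s x. 0 \<le> s \<Longrightarrow> s \<le> S \<Longrightarrow> u s x \<le> K * cosh (b * x)" and
    uh: "\<And>v s t x y. v \<in> {u, ux, uxx} \<Longrightarrow> 0 \<le> s \<Longrightarrow> s \<le> S \<Longrightarrow> 0 \<le> t \<Longrightarrow> t \<le> S \<Longrightarrow>
       \<bar>v s x - v t y\<bar> \<le> K * (cosh (k * x) + cosh (k * y)) * (\<bar>s - t\<bar> powr (1/4) + \<bar>x - y\<bar> powr (1/2))" and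
    K: "K \<ge> 0"
    by (rule power_problem.classical_solution[OF pp]) blast
  define \<tau> where "\<tau> t = \<xi> * (T - t)" for t
  define X where "X t y = ln y + \<beta> * (T - t)" for t y
  define E where "E t = exp (\<kappa> * (T - t)) / Q" for t
  define P where "P t y = a * u (\<tau> t) (X t y) - ux (\<tau> t) (X t y)" for t y
  define w where "w t y = E t * y powr (- a) * u (\<tau> t) (X t y)" for t y
  define w_y where "w_y t y = - (E t * y powr (- a - 1) * P t y)" for t y
  define w_yy where "w_yy t y = E t * y powr (- a - 2) *
    (uxx (\<tau> t) (X t y) - (2 * a + 1) * ux (\<tau> t) (X t y) + a * (a + 1) * u (\<tau> t) (X t y))" for t y
  \<comment> \<open>Obtained by solving the equation for the time derivative. The equation then
    holds by definition, and the content moves to the proof that w really has this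
    derivative.\<close>
  define w_t where "w_t t y = lam * w t y - lam * y * w_y t y - \<xi> * y\<^sup>2 * w_yy t y
    - lam * exp (- \<xi> * (T - t)) * ((- w_y t y) powr p2 / p2)" for t y
  have tau: "0 \<le> \<tau> t" "\<tau> t \<le> S" if "t \<in> {0..T}" for t
    using that xi by (auto simp: \<tau>_def S_def)
  have E: "E t > 0" for t using Q by (simp add: E_def)
  have Plow: "a * exp (- b * X t y) \<le> P t y" if t: "t \<in> {0..T}" for t y
  proof -
    have "exp (- b * X t y) \<le> u (\<tau> t) (X t y)"
    proof (cases "\<tau> t = 0")
      case True
      then show ?thesis by (simp add: u0)
    next
      case False
      then have "0 < \<tau> t" using tau[OF t] by simp
      from ulow[OF this tau(2)[OF t], of "X t y"]
      have "exp (b\<^sup>2 * \<tau> t) * exp (- b * X t y) < u (\<tau> t) (X t y)" .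
      moreover have "1 * exp (- b * X t y) \<le> exp (b\<^sup>2 * \<tau> t) * exp (- b * X t y)"
        using tau[OF t] by (intro mult_right_mono) auto
      ultimately show ?thesis by linarith
    qed
    then have "a * exp (- b * X t y) \<le> a * u (\<tau> t) (X t y)" using a by (intro mult_left_mono) auto
    then show ?thesis using ux0[OF tau[OF t], of "X t y"] by (simp add: P_def)
  qed
  have Ppos: "P t y > 0" if "t \<in> {0..T}" for t y
    by (rule less_le_trans[OF _ Plow[OF that]]) (use a in simp)
  have w_y_neg: "w_y t y < 0" if "t \<in> {0..T}" "y > 0" for t y
    using E[of t] Ppos[OF that(1), of y] that by (simp add: w_y_def)
  have powy: "y * y powr (- a - 1) = y powr (- a)" "y\<^sup>2 * y powr (- a - 2) = y powr (- a)" if "y > 0" for y :: real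
    using that by (simp_all add: powr_mult_base flip: powr_numeral powr_add)
  have nonlin: "lam * exp (- \<xi> * (T - t)) * ((- w_y t y) powr p2 / p2) =
      E t * y powr (- a) * (\<xi> * (c (\<tau> t) * P t y powr p2))" if t: "t \<in> {0..T}" and y: "y > 0" for t y
  proof -
    have "(- w_y t y) powr p2 = E t powr p2 * y powr ((- a - 1) * p2) * P t y powr p2"
      unfolding w_y_def using E[of t] Ppos[OF t, of y] by (simp add: powr_mult powr_powr)
    also have "(- a - 1) * p2 = - a" using ap by (simp add: algebra_simps)
    also have "E t powr p2 = exp (\<kappa> * (T - t) * p2) / Q powr p2"
      unfolding E_def using Q by (simp add: powr_divide exp_powr_real)
    finally have w: "(- w_y t y) powr p2 = exp (\<kappa> * (T - t) * p2) / Q powr p2 * y powr (- a) * P t y powr p2" .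
    have q: "\<xi> * c0 / Q = lam / p2 / Q powr p2"
      using Q xi p2 by (simp add: c0_def powr_diff field_simps)
    have ex: "exp (- \<xi> * (T - t)) * exp (\<kappa> * (T - t) * p2) = exp (\<kappa> * (T - t)) * exp (m * \<tau> t)"
    proof -
      have "m * \<tau> t = (- \<xi> + (p2 - 1) * \<kappa>) * (T - t)" unfolding \<tau>_def mx[symmetric] by simp
      then have "- \<xi> * (T - t) + \<kappa> * (T - t) * p2 = \<kappa> * (T - t) + m * \<tau> t" by (simp add: algebra_simps)
      then show ?thesis by (simp only: exp_add[symmetric])
    qed
    have "lam * exp (- \<xi> * (T - t)) * ((- w_y t y) powr p2 / p2) =
        (exp (- \<xi> * (T - t)) * exp (\<kappa> * (T - t) * p2)) * (lam / p2 / Q powr p2) * y powr (- a) * P t y powr p2"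
      unfolding w by (simp add: ac_simps)
    also have "\<dots> = (exp (\<kappa> * (T - t)) * exp (m * \<tau> t)) * (\<xi> * c0 / Q) * y powr (- a) * P t y powr p2"
      unfolding ex q ..
    also have "\<dots> = E t * y powr (- a) * (\<xi> * (c (\<tau> t) * P t y powr p2))"
      unfolding E_def c_def by (simp add: ac_simps)
    finally show ?thesis .
  qed
  have ux_cont: "continuous_on ({0..S} \<times> UNIV) (\<lambda>(s, x). ux s x)"
  \<comment> \<open>The factor 2 comes from the time estimate, where both weights sit at the same
    point; the space estimate is relaxed to match.\<close>
  proof (rule continuous_on_pair_holder[where A = "2 * K" and k = k])
    show "\<bar>ux s x - ux s y\<bar> \<le> 2 * K * sqrt \<bar>x - y\<bar> * (cosh (k * x) + cosh (k * y))" if "s \<in> {0..S}" for s x y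
    proof -
      have "\<bar>ux s x - ux s y\<bar> \<le> K * (cosh (k * x) + cosh (k * y)) * sqrt \<bar>x - y\<bar>"
        using uh[of ux s s x y] that by (simp add: powr_half_sqrt)
      also have "\<dots> \<le> 2 * (K * (cosh (k * x) + cosh (k * y)) * sqrt \<bar>x - y\<bar>)" using K by simp
      finally show ?thesis by (simp add: ac_simps)
    qed
    show "\<bar>ux s x - ux t x\<bar> \<le> 2 * K * cosh (k * x) * \<bar>s - t\<bar> powr (1/4)" if "s \<in> {0..S}" "t \<in> {0..S}" for s t x
      using uh[of ux s t x x] that by simp
  qed
  have dwt: "((\<lambda>s. w s y) has_real_derivative w_t t y) (at t within {0..T})" if t: "t \<in> {0..T}" and y: "y > 0" for t y
  proof -
    define us' where "us' = uxx (\<tau> t) (X t y) + c (\<tau> t) * P t y powr p2"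
    have dE: "((\<lambda>t. E t * y powr (- a)) has_real_derivative - \<kappa> * (E t * y powr (- a))) (at t within {0..T})"
      unfolding E_def using Q by (auto intro!: derivative_eq_intros)
    have du: "((\<lambda>t. u (\<tau> t) (X t y)) has_real_derivative us' * (- \<xi>) + ux (\<tau> t) (X t y) * (- \<beta>)) (at t within {0..T})"
    proof (rule has_real_derivative_two_variables[where u = u and ux = ux and \<sigma> = \<tau> and \<theta> = "\<lambda>t. X t y" and I = "{0..S}"])
      show "((\<lambda>s. u s (X t y)) has_real_derivative us') (at (\<tau> t) within {0..S})"
        unfolding us'_def P_def by (rule us[OF tau[OF t]])
      show "(\<tau> has_real_derivative - \<xi>) (at t within {0..T})"
        unfolding \<tau>_def[abs_def] by (auto intro!: derivative_eq_intros)
      show "((\<lambda>t. X t y) has_real_derivative - \<beta>) (at t within {0..T})"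
        unfolding X_def by (auto intro!: derivative_eq_intros)
      show "\<tau> ` {0..T} \<subseteq> {0..S}" "\<tau> t \<in> {0..S}" using tau t by auto
    qed (use ux ux_cont in auto)
    have "((\<lambda>s. w s y) has_real_derivative - \<kappa> * (E t * y powr (- a)) * u (\<tau> t) (X t y) +
        (us' * (- \<xi>) + ux (\<tau> t) (X t y) * (- \<beta>)) * (E t * y powr (- a))) (at t within {0..T})"
      unfolding w_def by (rule DERIV_mult[OF dE du])
    also have "- \<kappa> * (E t * y powr (- a)) * u (\<tau> t) (X t y) +
        (us' * (- \<xi>) + ux (\<tau> t) (X t y) * (- \<beta>)) * (E t * y powr (- a)) = w_t t y"
    proof -
      define e where "e = E t * y powr (- a)"
      have 1: "w t y = e * u (\<tau> t) (X t y)" by (simp add: w_def e_def)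
      have 2: "y * w_y t y = - (e * P t y)" using powy(1)[OF y] by (simp add: w_y_def e_def algebra_simps)
      have 3: "y\<^sup>2 * w_yy t y = e * (uxx (\<tau> t) (X t y) - (2 * a + 1) * ux (\<tau> t) (X t y) + a * (a + 1) * u (\<tau> t) (X t y))"
        unfolding w_yy_def e_def powy(2)[OF y, symmetric] by (simp add: ac_simps)
      have 4: "w_t t y = lam * w t y - lam * (y * w_y t y) - \<xi> * (y\<^sup>2 * w_yy t y) - e * (\<xi> * (c (\<tau> t) * P t y powr p2))"
        unfolding w_t_def nonlin[OF t y] e_def by (simp add: mult.assoc)
      \<comment> \<open>All terms now carry the common factor e, and the choices of \<kappa> and
        \<beta> make the terms in u and ux cancel.\<close>
      show ?thesis
        unfolding 4 1 2 3 e_def[symmetric] us'_def \<kappa>_def \<beta>_def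
        by (simp add: P_def algebra_simps)
    qed
    finally show ?thesis .
  qed
  have dwy: "(w t has_real_derivative w_y t y) (at y)" if t: "t \<in> {0..T}" and y: "y > 0" for t y
  proof -
    have "(w t has_real_derivative E t * y powr (- a - 1) * (- a * u (\<tau> t) (X t y) + ux (\<tau> t) (X t y))) (at y)"
      unfolding w_def[abs_def] X_def by (rule has_real_derivative_powr_ln[OF ux[OF tau[OF t]] y])
    also have "E t * y powr (- a - 1) * (- a * u (\<tau> t) (X t y) + ux (\<tau> t) (X t y)) = w_y t y"
      by (simp add: w_y_def P_def algebra_simps)
    finally show ?thesis .
  qed
  have dwyy: "(w_y t has_real_derivative w_yy t y) (at y)" if t: "t \<in> {0..T}" and y: "y > 0" for t y
  proof -
    have "((\<lambda>x. ux (\<tau> t) x - a * u (\<tau> t) x) has_real_derivative uxx (\<tau> t) (X t y) - a * ux (\<tau> t) (X t y)) (at (ln y + \<beta> * (T - t)))"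
      unfolding X_def by (intro DERIV_diff DERIV_cmult ux uxx tau t)
    from has_real_derivative_powr_ln[OF this y, where A = "E t" and c = "- a - 1"]
    have "((\<lambda>z. E t * z powr (- a - 1) * (ux (\<tau> t) (X t z) - a * u (\<tau> t) (X t z))) has_real_derivative
        E t * y powr (- a - 1 - 1) * ((- a - 1) * (ux (\<tau> t) (X t y) - a * u (\<tau> t) (X t y)) +
          (uxx (\<tau> t) (X t y) - a * ux (\<tau> t) (X t y)))) (at y)"
      unfolding X_def .
    also have "(\<lambda>z. E t * z powr (- a - 1) * (ux (\<tau> t) (X t z) - a * u (\<tau> t) (X t z))) = w_y t"
      by (auto simp: w_y_def P_def algebra_simps)
    also have "- a - 1 - 1 = - a - 2" by simp
    also have "(- a - 1) * (ux (\<tau> t) (X t y) - a * u (\<tau> t) (X t y)) + (uxx (\<tau> t) (X t y) - a * ux (\<tau> t) (X t y)) =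
        uxx (\<tau> t) (X t y) - (2 * a + 1) * ux (\<tau> t) (X t y) + a * (a + 1) * u (\<tau> t) (X t y)"
      by (simp add: algebra_simps)
    finally show ?thesis unfolding w_yy_def .
  qed
  have T0: "T \<ge> 0" using T by simp
  note rh = rect_holder_add rect_holder_mult[OF T0] rect_holder_const
  have hu: "rect_holder T (\<lambda>t y. v (\<tau> t) (X t y))" if "v \<in> {u, ux, uxx}" for v
    unfolding \<tau>_def X_def by (rule rect_holder_log_coordinates[OF T0 xi K]) (rule uh[OF that], auto simp: S_def)
  have hexp: "rect_holder T (\<lambda>t y. exp (l * (T - t)))" for l
  proof (rule rect_holder_time[OF T0, where g' = "\<lambda>t. - l * exp (l * (T - t))" and M = "\<bar>l\<bar> * exp (\<bar>l\<bar> * T)"])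
    show "((\<lambda>t. exp (l * (T - t))) has_real_derivative - l * exp (l * (T - t))) (at t within {0..T})" for t
      by (auto intro!: derivative_eq_intros)
    show "\<bar>- l * exp (l * (T - t))\<bar> \<le> \<bar>l\<bar> * exp (\<bar>l\<bar> * T)" if "t \<in> {0..T}" for t
    proof -
      have "l * (T - t) \<le> \<bar>l\<bar> * T" using that by (intro mult_mono) auto
      then show ?thesis by (simp add: abs_mult mult_left_mono)
    qed
  qed
  have hE: "rect_holder T (\<lambda>t y. E t)"
    using rect_holder_mult[OF T0 hexp[of \<kappa>] rect_holder_const[of T "1 / Q"]] by (simp add: E_def)
  have hP: "rect_holder T P"
    using rect_holder_add[OF rect_holder_mult[OF T0 rect_holder_const[of T a] hu[of u]] rect_holder_mult[OF T0 rect_holder_const[of T "- 1"] hu[of ux]]]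
    by (simp add: P_def[abs_def])
  have hPp: "rect_holder T (\<lambda>t y. P t y powr p2)"
  proof (rule rect_holder_powr_comp[OF p2 hP])
    fix l r :: real assume lr: "0 < l" "l \<le> r"
    show "\<exists>m>0. \<forall>t\<in>{0..T}. \<forall>y\<in>{l..r}. m \<le> P t y"
    \<comment> \<open>The lower bound for P decreases in X, so the witness is its value at an upper
      bound for X on the rectangle.\<close>
    proof (intro exI[of _ "a * exp (- b * (\<bar>ln r\<bar> + \<bar>\<beta>\<bar> * T))"] conjI ballI)
      fix t y assume t: "t \<in> {0..T}" and y: "y \<in> {l..r}"
      have "ln y \<le> ln r" using y lr by auto
      moreover have "\<beta> * (T - t) \<le> \<bar>\<beta>\<bar> * T" using t by (intro mult_mono) auto
      ultimately have "X t y \<le> \<bar>ln r\<bar> + \<bar>\<beta>\<bar> * T" unfolding X_def by linarith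
      then have "b * X t y \<le> b * (\<bar>ln r\<bar> + \<bar>\<beta>\<bar> * T)" using b by (intro mult_left_mono) auto
      then have "a * exp (- b * (\<bar>ln r\<bar> + \<bar>\<beta>\<bar> * T)) \<le> a * exp (- b * X t y)" using a by simp
      with Plow[OF t, of y] show "a * exp (- b * (\<bar>ln r\<bar> + \<bar>\<beta>\<bar> * T)) \<le> P t y" by linarith
    qed (use a in simp)
  qed
  have hw: "rect_holder T w"
    unfolding w_def[abs_def] by (intro rh hE rect_holder_powr hu) auto
  have hw_y: "rect_holder T w_y"
    using rect_holder_mult[OF T0 rect_holder_const[of T "- 1"] rect_holder_mult[OF T0 rect_holder_mult[OF T0 hE rect_holder_powr] hP]]
    by (simp add: w_y_def[abs_def])
  have hw_yy: "rect_holder T w_yy"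
  proof -
    have "rect_holder T (\<lambda>t y. E t * y powr (- a - 2) *
      (uxx (\<tau> t) (X t y) + (- (2 * a + 1)) * ux (\<tau> t) (X t y) + a * (a + 1) * u (\<tau> t) (X t y)))"
      by (intro rh hE rect_holder_powr hu) auto
    then show ?thesis by (rule rect_holder_cong) (simp add: w_yy_def algebra_simps)
  qed
  have hw_t: "rect_holder T w_t"
  proof (rule rect_holder_cong)
    \<comment> \<open>By \<open>nonlin\<close>, w_t is a sum of products of functions already in the
      class; y and its square are written as real powers so that \<open>rect_holder_powr\<close>
      applies.\<close>
    show "rect_holder T (\<lambda>t y. lam * w t y + (- lam) * (y powr 1 * w_y t y) + (- \<xi>) * (y powr 2 * w_yy t y)
      + (- 1) * (E t * y powr (- a) * (\<xi> * ((c0 * exp ((m * \<xi>) * (T - t))) * P t y powr p2))))"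
      by (intro rh hw hw_y hw_yy rect_holder_powr hE hPp hexp)
    show "w_t t y = lam * w t y + (- lam) * (y powr 1 * w_y t y) + (- \<xi>) * (y powr 2 * w_yy t y)
      + (- 1) * (E t * y powr (- a) * (\<xi> * ((c0 * exp ((m * \<xi>) * (T - t))) * P t y powr p2)))"
      if "t \<in> {0..T}" "y > 0" for t y
      unfolding w_t_def nonlin[OF that] using that by (simp add: c_def \<tau>_def ac_simps)
  qed
  have CP: "C_parabolic (1/2) {0..T} {0<..} w w_t w_y w_yy"
    unfolding C_parabolic_def
    using dwt dwy dwyy rect_holder_imp_parabolic_holder_on[OF hw] rect_holder_imp_parabolic_holder_on[OF hw_t]
      rect_holder_imp_parabolic_holder_on[OF hw_y] rect_holder_imp_parabolic_holder_on[OF hw_yy]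
    by (auto intro: has_field_derivative_at_within)
  \<comment> \<open>The bound in the theorem is the linear evolution of the datum, transported back:
    with q1 = - a - b one has \<kappa> + b^2 \<xi> - b \<beta> = (q1 - 1)(lam + \<xi> q1). The same
    identity yields the terminal condition at t = T and the sign of the bound.\<close>
  have lin: "- exp ((q1 - 1) * (lam + \<xi> * q1) * (T - t)) * (y powr q1 / q1) =
      E t * y powr (- a) * (exp (b\<^sup>2 * \<tau> t) * exp (- b * X t y))" if y: "y > 0" for t y
  proof -
    have q1: "q1 = - a - b" by (simp add: b_def Q_def)
    have "exp (- b * ln y) = y powr (- b)" using y by (simp add: powr_def)
    moreover have "y powr (- a) * y powr (- b) = y powr q1" unfolding q1 by (simp flip: powr_add)
    ultimately have "y powr q1 = y powr (- a) * exp (- b * ln y)" by simp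
    moreover have "exp ((q1 - 1) * (lam + \<xi> * q1) * (T - t)) = exp (\<kappa> * (T - t)) * exp (b\<^sup>2 * \<tau> t) * exp (- b * (\<beta> * (T - t)))"
      unfolding exp_add[symmetric] q1 \<kappa>_def \<tau>_def \<beta>_def
      by (intro arg_cong[of _ _ exp]) (simp add: algebra_simps power2_eq_square)
    moreover have "exp (- b * X t y) = exp (- b * ln y) * exp (- b * (\<beta> * (T - t)))"
      unfolding exp_add[symmetric] X_def by (intro arg_cong[of _ _ exp]) (simp add: algebra_simps)
    ultimately show ?thesis by (simp add: E_def Q_def)
  qed
  have lower: "- exp ((q1 - 1) * (lam + \<xi> * q1) * (T - t)) * (y powr q1 / q1) < w t y" if t: "t \<in> {0..<T}" and y: "y > 0" for t y
  proof -
    have "0 < \<tau> t" using t xi by (simp add: \<tau>_def)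
    then have "exp (b\<^sup>2 * \<tau> t) * exp (- b * X t y) < u (\<tau> t) (X t y)" using t tau(2)[of t] by (intro ulow) auto
    then show ?thesis unfolding lin[OF y] w_def using E[of t] y by (intro mult_strict_left_mono) auto
  qed
  have terminal: "w T y = - (y powr q1 / q1)" if "y > 0" for y
    using lin[OF that, of T] by (simp add: w_def \<tau>_def u0)
  have pos: "0 < w t y" if "t \<in> {0..T}" "y > 0" for t y
    unfolding w_def using E[of t] that upos[OF tau[OF that(1)], of "X t y"] by simp
  have anti: "strict_antimono_on {0<..} (w t)" if t: "t \<in> {0..T}" for t
  proof (rule monotone_onI)
    fix y z :: real assume "y \<in> {0<..}" "z \<in> {0<..}" "y < z"
    show "w t z < w t y"
    proof (rule DERIV_neg_imp_decreasing[OF \<open>y < z\<close>])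
      fix x assume "y \<le> x" "x \<le> z"
      then have "x > 0" using \<open>y \<in> {0<..}\<close> by simp
      then show "\<exists>l. (w t has_real_derivative l) (at x) \<and> l < 0" using dwy[OF t] w_y_neg[OF t] by blast
    qed
  qed
  have upper: "\<exists>\<eta>>0. \<exists>C>0. \<forall>t\<in>{0..T}. \<forall>y>0. w t y \<le> C * (1 + y powr (- \<eta>))"
  proof -
    define N where "N = exp (b * (\<bar>\<beta>\<bar> * T))"
    \<comment> \<open>The summand 1 only ensures C > 0, since K is merely known to be
      nonnegative.\<close>
    define C where "C = exp (\<bar>\<kappa>\<bar> * T) / Q * (K * (1 + N)) + 1"
    have N: "N \<ge> 0" by (simp add: N_def)
    have "w t y \<le> C * (1 + y powr (- Q))" if t: "t \<in> {0..T}" and y: "y > 0" for t y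
    proof -
      \<comment> \<open>The cosh bound would grow for large y. For x \<ge> 0 monotonicity replaces
        it by its value at 0, and for x < 0 it is already of size exp (- b x).\<close>
      have u1: "u (\<tau> t) x \<le> K * (1 + exp (- b * x))" for x
      proof (cases "x \<ge> 0")
        case True
        have "u (\<tau> t) (0 + x) \<le> u (\<tau> t) 0" by (rule umono[OF tau[OF t] True])
        also have "\<dots> \<le> K * 1" using ub[OF tau[OF t], of 0] by simp
        also have "\<dots> \<le> K * (1 + exp (- b * x))" using K by (intro mult_left_mono) auto
        finally show ?thesis by simp
      next
        case False
        have "u (\<tau> t) x \<le> K * cosh (b * x)" by (rule ub[OF tau[OF t]])
        also have "cosh (b * x) \<le> exp (- b * x)"
          using cosh_le_exp_abs[of "b * x"] False b by (simp add: abs_mult)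
        also have "\<dots> \<le> 1 + exp (- b * x)" by simp
        finally show ?thesis using K by (simp add: mult_left_mono)
      qed
      have "exp (- b * X t y) = y powr (- b) * exp (- b * (\<beta> * (T - t)))"
        unfolding X_def powr_def using y by (simp add: algebra_simps flip: exp_add)
      also have "\<dots> \<le> y powr (- b) * N"
      proof (rule mult_left_mono)
        have "(- \<beta>) * (T - t) \<le> \<bar>\<beta>\<bar> * T" using t by (intro mult_mono) auto
        then have "b * ((- \<beta>) * (T - t)) \<le> b * (\<bar>\<beta>\<bar> * T)" using b by (intro mult_left_mono) auto
        then show "exp (- b * (\<beta> * (T - t))) \<le> N" by (simp add: N_def)
      qed simp
      finally have eX: "exp (- b * X t y) \<le> y powr (- b) * N" .
      have Et: "E t \<le> exp (\<bar>\<kappa>\<bar> * T) / Q"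
      proof -
        have "\<kappa> * (T - t) \<le> \<bar>\<kappa>\<bar> * T" using t by (intro mult_mono) auto
        then show ?thesis using Q by (simp add: E_def divide_right_mono)
      qed
      \<comment> \<open>Since a < Q, the factor y^(-a) is at most 1 for y \<ge> 1 and at most y^(-Q)
        below; together with y^(-a) y^(-b) = y^(-Q) this makes \<eta> = Q the exponent.\<close>
      have ya: "y powr (- a) \<le> 1 + y powr (- Q)"
      proof (cases "y \<ge> 1")
        case True
        then have "y powr (- a) \<le> 1 powr (- a)" using a by (intro powr_mono2') auto
        then show ?thesis by (simp add: add_increasing2)
      next
        case False
        then have "y powr (- a) \<le> y powr (- Q)" using y b by (intro powr_mono') (auto simp: b_def)
        then show ?thesis by simp
      qed
      have yq: "y powr (- a) * y powr (- b) = y powr (- Q)" by (simp add: b_def flip: powr_add)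
      have "u (\<tau> t) (X t y) \<le> K * (1 + y powr (- b) * N)"
        using u1[of "X t y"] mult_left_mono[OF eX K] by (simp add: distrib_left)
      then have "w t y \<le> E t * y powr (- a) * (K * (1 + y powr (- b) * N))"
        unfolding w_def using E[of t] by (intro mult_left_mono) auto
      also have "\<dots> = E t * (K * (y powr (- a) + y powr (- Q) * N))"
        unfolding yq[symmetric] by (simp add: algebra_simps)
      also have "\<dots> \<le> exp (\<bar>\<kappa>\<bar> * T) / Q * (K * ((1 + y powr (- Q)) + (1 + y powr (- Q)) * N))"
        using Et Q K N ya E[of t] by (intro mult_mono mult_left_mono add_mono mult_right_mono mult_nonneg_nonneg add_nonneg_nonneg) auto
      also have "\<dots> = exp (\<bar>\<kappa>\<bar> * T) / Q * (K * (1 + N)) * (1 + y powr (- Q))" by (simp add: algebra_simps add_divide_distrib)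
      also have "\<dots> \<le> C * (1 + y powr (- Q))" unfolding C_def by (intro mult_right_mono) (auto simp: add_nonneg_nonneg)
      finally show ?thesis .
    qed
    moreover have "C > 0" using Q K N by (simp add: C_def add_nonneg_pos)
    ultimately show ?thesis using Q by blast
  qed
  show ?thesis
  proof (rule exI[of _ "1/2"], rule exI[of _ w], rule exI[of _ w_t], rule exI[of _ w_y], rule exI[of _ w_yy],
      intro conjI ballI allI impI CP terminal pos lower anti upper)
    fix t y assume t: "t \<in> {0..T}" and y: "y > (0 :: real)"
    show "w_y t y \<le> 0" using w_y_neg[OF t y] by simp
    show "w_t t y - lam * w t y + lam * y * w_y t y + \<xi> * y\<^sup>2 * w_yy t y + lam * f t * ((- w_y t y) powr p2 / p2) = 0"
      unfolding w_t_def \<open>\<And>t. t \<in> {0..T} \<Longrightarrow> f t = exp (- \<xi> * (T - t))\<close>[OF t] by simp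
    show "0 < - exp ((q1 - 1) * (lam + \<xi> * q1) * (T - t)) * (y powr q1 / q1)"
      unfolding lin[OF y] using E[of t] y by simp
  qed auto
qed

end
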